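(* Let $X\subset\mathbb R^2$ be a planar continuum (compact connected subset of the plane), and fix any countable dense set $\{(P_i,Q_i)\}$ of pairs of distinct parallel lines used to define the total oscillation $\mathcal T$. Then every homotopy class (relative to endpoints) of paths in $X$ contains an oscillatory geodesic, i.e. a path of minimal total oscillation among all paths in that class.
   Context: Let $g:\mathbb R^n\to[-1,1]$ depend only on the first coordinate $x_1$: $g=-1$ if $x_1\le-3$, $g=\frac12(x_1+1)$ if $-3\le x_1\le-1$, $g=0$ if $-1\le x_1\le 1$, $g=\frac12(x_1-1)$ if $1\le x_1\le 3$, $g=1$ if $x_1\ge3$. For a pair $(P,Q)$ of distinct parallel hyperplanes, let $h_{(P,Q)}$ be a composition of a dilation, rotation and translation sending $P$ to $\{x_1=-3\}$ and $Q$ to $\{x_1=3\}$, and set $g_{(P,Q)}=g\circ h_{(P,Q)}$ (independent of the choice). For a continuous $f:[a,b]\to\mathbb R^n$, the oscillation $o(f,(P,Q))$ is the supremum of $-\sum_{i=1}^k g_{(P,Q)}(f(a_{i-1}))\,g_{(P,Q)}(f(a_i))$ over all finite collections $a\le a_0\le\dots\le a_k\le b$ (the sum over $0$ or $1$ points is $0$). The set of pairs of parallel hyperplanes, topologized via the compact-open topology on the affine maps producing them, is separable metric; fix a countable dense set $\{(P_i,Q_i)\}$ and define the total oscillation $\mathcal T(\alpha)=\sum_{i\ge1}2^{-i}\,\frac{o(\alpha,(P_i,Q_i))}{1+o(\alpha,(P_i,Q_i))}$. Here $n=2$, so hyperplanes are lines. *)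

theory Defs
  imports "HOL-Analysis.Analysis"
begin

definition gprof :: "real \<Rightarrow> real" where
  "gprof t = (if t \<le> -3 then -1
              else if t \<le> -1 then (t + 1) / 2
              else if t \<le> 1 then 0
              else if t \<le> 3 then (t - 1) / 2
              else 1)"

text \<open>An ordered pair (P,Q) of distinct parallel lines in the plane is encoded by
  (a,c) with a \<noteq> 0: P = {x. a\<bullet>x + c = -3}, Q = {x. a\<bullet>x + c = 3}.
  Then the first coordinate of h_(P,Q) (dilation, rotation, translation) is x \<mapsto> a\<bullet>x + c,
  so g_(P,Q) x = g (a\<bullet>x + c). The map (a,c) is a homeomorphism between the space of
  such pairs (topology induced by the compact-open topology on the affine maps) and
  {(a,c). a \<noteq> 0} \<subseteq> R^2 \<times> R.\<close>
type_synonym linepair = "(real^2) \<times> real"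

definition is_linepair :: "linepair \<Rightarrow> bool" where
  "is_linepair pq \<longleftrightarrow> fst pq \<noteq> 0"

definition gPQ :: "linepair \<Rightarrow> real^2 \<Rightarrow> real" where
  "gPQ pq x = gprof (fst pq \<bullet> x + snd pq)"

definition osc :: "(real \<Rightarrow> real^2) \<Rightarrow> linepair \<Rightarrow> ereal" where
  "osc f pq = Sup { ereal (- (\<Sum>i\<in>{1..<length ts}.
                      gPQ pq (f (ts ! (i - 1))) * gPQ pq (f (ts ! i))))
                  | ts. sorted ts \<and> set ts \<subseteq> {0..1} }"

definition osc_ratio :: "ereal \<Rightarrow> real" where
  "osc_ratio x = (if x = \<infinity> then 1 else real_of_ereal x / (1 + real_of_ereal x))"

text \<open>Total oscillation w.r.t. the enumerated dense family s 0, s 1, ...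
  (s i plays the role of (P_{i+1},Q_{i+1}), weight 2^{-(i+1)}).\<close>
definition total_osc :: "(nat \<Rightarrow> linepair) \<Rightarrow> (real \<Rightarrow> real^2) \<Rightarrow> real" where
  "total_osc s f = (\<Sum>i. (1/2) ^ Suc i * osc_ratio (osc f (s i)))"

definition dense_linepairs :: "(nat \<Rightarrow> linepair) \<Rightarrow> bool" where
  "dense_linepairs s \<longleftrightarrow> (\<forall>i. is_linepair (s i)) \<and>
     (\<forall>pq. is_linepair pq \<longrightarrow> (\<forall>e>0. \<exists>i. dist (s i) pq < e))"

end

theory Submission
  imports Defs "HOL-Complex_Analysis.Great_Picard"
begin

text \<open>
  A minimizing sequence of paths in the homotopy class is made equicontinuous, a limit is extracted
  by Arzela--Ascoli, and total oscillation is lower semicontinuous. Two facts about the plane are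
  needed.

  First, oscillation does not increase when a subpath is replaced by a segment of a line to which it
  is homotopic in \<open>X\<close>, and enough such replacements bound the crossings of any given strip in terms of
  \<open>p\<close> alone: if \<open>r\<close> crosses a strip too often then, in the square of a homotopy from \<open>p\<close> to \<open>r\<close>, some
  component of the preimage of a line in the strip joins two points of the \<open>r\<close>-side, and the excursion
  of \<open>r\<close> between them can be straightened. Bounds on the crossings of all strips give an
  equicontinuous reparametrization.

  Second, a uniform limit of equicontinuous null-homotopic loops in \<open>X\<close> is null-homotopic in \<open>X\<close>. Cut a
  neighbourhood of \<open>X\<close> into components over thin vertical slabs. Their nerve is a graph, and the
  walk traced by a null-homotopic loop in it reduces to a point by cancelling backtracks. The
  cancellations are the ears of a triangulation of a convex region bounded by a parabola and a
  chord; the piecewise affine extensions of the loops have values close to \<open>X\<close> and, since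
  the chords do not cross, a modulus of continuity depending only on that of the loops.
\<close>


text \<open>The total oscillation of every path is at most 1, so a minimizing sequence carries no
  compactness by itself: its members may cross a fixed strip ever more often. Straightening supplies
  the missing bound, and it must not raise the oscillation for any pair of lines. This is why
  \<open>dominated\<close> treats one direction at a time: an oscillation sees only one linear
  functional of the path. \<open>X\<close> need not be locally connected, and the given homotopies
  need have no common modulus of continuity, so no limit of them can be taken. They only serve as
  certificates, once for the reduction of a walk and once for the position of level sets; the
  filling that survives the limit is built anew. The parabola suits this filling because distinct
  parameters are in convex position, the side of a chord is the sign of a product, and
  \<open>t |-> (t, t^2)\<close> makes every function on three parameters the restriction of an
  affine function of the plane, even if some of them coincide. This gives well-defined values on
  degenerate triangles, which do occur as limits.\<close>

no_notation fps_nth (infixl "$" 75)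

section \<open>Free reduction of walks\<close>

text \<open>The stack is the reduced form of the walk read so far, last vertex first; a step is cancelled if
  it stays at the same vertex or backtracks.\<close>

fun push :: "'l \<Rightarrow> 'l list \<Rightarrow> 'l list" where
  "push x [] = [x]"
| "push x [a] = (if x = a then [a] else [x, a])"
| "push x (a # b # st) = (if x = a then a # b # st else if x = b then b # st else x # a # b # st)"

fun reduced :: "'l list \<Rightarrow> bool" where
  "reduced (a # b # c # st) \<longleftrightarrow> a \<noteq> b \<and> a \<noteq> c \<and> reduced (b # c # st)"
| "reduced [a, b] \<longleftrightarrow> a \<noteq> b"
| "reduced _ \<longleftrightarrow> True"

lemma reduced_tl: "reduced (a # st) \<Longrightarrow> reduced st"
  by (cases st rule: reduced.cases) auto

lemma reduced_push: "reduced st \<Longrightarrow> reduced (push x st)"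
  by (induction x st rule: push.induct) (auto dest: reduced_tl elim: reduced.elims)

lemma hd_push: "\<exists>r. push x st = x # r"
  by (induction x st rule: push.induct) auto

lemma push_same [simp]: "push t (t # st) = t # st"
  by (cases st) auto

lemma push_idem [simp]: "push x (push x st) = push x st"
  using hd_push[of x st] push_same by metis

lemma push_back: "reduced (t # st) \<Longrightarrow> push t (push x (t # st)) = t # st"
  by (cases st rule: reduced.cases) auto

text \<open>\<open>t\<close> and \<open>z\<close> are opposite corners of a grid cell,
  \<open>x\<close> and \<open>y\<close> the other two. With only two labels available, either
  \<open>x = y\<close>, or one route begins by standing still and the step of the other is undone by
  \<open>push_back\<close> or repeated, which \<open>push\<close> ignores.\<close>

lemma push_cell:
  assumes "reduced (t # st)" and "{t, x, y, z} \<subseteq> {l, l'}"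
  shows "push z (push x (t # st)) = push z (push y (t # st))"
proof -
  consider "x = t" "y = t" | "x = t" "y \<noteq> t" | "x \<noteq> t" "y = t" | "x = y"
    using assms(2) by auto
  then show ?thesis
  proof cases
    case 2
    then have "z = t \<or> z = y" using assms(2) by auto
    then show ?thesis using 2 push_back[OF assms(1), of y] by auto
  next
    case 3
    then have "z = t \<or> z = x" using assms(2) by auto
    then show ?thesis using 3 push_back[OF assms(1), of x] by auto
  qed auto
qed

definition free_reduction :: "'l list \<Rightarrow> 'l list" where
  "free_reduction xs = foldl (\<lambda>st x. push x st) [] xs"

lemma free_reduction_simps [simp]: "free_reduction [] = []" "free_reduction (xs @ [x]) = push x (free_reduction xs)"
  by (auto simp: free_reduction_def)

lemma reduced_free_reduction: "reduced (free_reduction xs)"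
  by (induction xs rule: rev_induct) (auto simp: reduced_push)

lemma free_reduction_hd: "\<exists>r. free_reduction (xs @ [x]) = x # r"
  by (simp add: hd_push)

text \<open>A rung is swept along two neighbouring rows of a grid: \<open>push_cell\<close> carries
  it over each cell, and at both ends of the ladder it has coinciding endpoints.\<close>

lemma free_reduction_ladder:
  assumes cell: "\<And>i. i < m \<Longrightarrow> \<exists>l l'. {a i, a (Suc i), b i, b (Suc i)} \<subseteq> {l, l'}"
    and "a 0 = b 0" "a m = b m"
  shows "free_reduction (map a [0..<Suc m]) = free_reduction (map b [0..<Suc m])"
proof -
  \<comment> \<open>Invariant: walking along \<open>b\<close> and then across the rung to
    \<open>a k\<close> gives the same stack as walking along \<open>a\<close>.\<close>
  have *: "push (a k) (free_reduction (map b [0..<Suc k])) = free_reduction (map a [0..<Suc k])" if "k \<le> m" for k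
    using that
  proof (induction k)
    case 0
    then show ?case using assms(2) by (simp add: free_reduction_def)
  next
    case (Suc k)
    obtain r where r: "free_reduction (map b [0..<Suc k]) = b k # r"
      using free_reduction_hd[of "map b [0..<k]" "b k"] by (auto simp del: free_reduction_simps)
    have red: "reduced (b k # r)"
      using reduced_free_reduction[of "map b [0..<Suc k]"] r by simp
    obtain l l' where "{a k, a (Suc k), b k, b (Suc k)} \<subseteq> {l, l'}"
      using cell[of k] Suc.prems by auto
    then have "push (a (Suc k)) (push (b (Suc k)) (b k # r)) = push (a (Suc k)) (push (a k) (b k # r))"
      by (intro push_cell[OF red, of _ _ _ l l']) auto
    moreover have "push (a k) (b k # r) = free_reduction (map a [0..<Suc k])"
      using Suc r by simp
    ultimately show ?case
      using r free_reduction_simps(2)[of "map a [0..<Suc k]" "a (Suc k)"] free_reduction_simps(2)[of "map b [0..<Suc k]" "b (Suc k)"]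
      by simp
  qed
  have "push (b m) (free_reduction (map b [0..<Suc m])) = free_reduction (map b [0..<Suc m])"
    using free_reduction_hd[of "map b [0..<m]" "b m"] by auto
  with *[of m] assms(3) show ?thesis by simp
qed

text \<open>Without an ear every vertex is simply pushed. The length bound excludes lists such as
  \<open>[x, x]\<close>, which have no three consecutive entries but still cancel.\<close>

lemma free_reduction_no_ear:
  assumes "\<And>A B a b c. xs = A @ [a, b, c] @ B \<Longrightarrow> a \<noteq> b \<and> b \<noteq> c \<and> a \<noteq> c" and "length xs \<ge> 3"
  shows "free_reduction xs = rev xs"
  using assms
proof (induction xs rule: rev_induct)
  case (snoc x xs)
  obtain ys b c where xs: "xs = ys @ [b, c]"
  proof -
    have "length xs \<ge> 2" using snoc.prems(2) by simp
    then obtain ys c where 1: "xs = ys @ [c]" by (cases xs rule: rev_cases) auto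
    with \<open>length xs \<ge> 2\<close> obtain zs b where "ys = zs @ [b]" by (cases ys rule: rev_cases) auto
    with 1 that show ?thesis by auto
  qed
  have ne: "b \<noteq> c \<and> c \<noteq> x \<and> b \<noteq> x"
    using snoc.prems(1)[of ys b c x "[]"] xs by auto
  have "free_reduction xs = rev xs"
  proof (cases "length xs \<ge> 3")
    case True
    show ?thesis
    proof (rule snoc.IH[OF _ True])
      fix A B a b c assume "xs = A @ [a, b, c] @ B"
      then show "a \<noteq> b \<and> b \<noteq> c \<and> a \<noteq> c" using snoc.prems(1)[of A a b c "B @ [x]"] by simp
    qed
  next
    case False
    then have "xs = [b, c]" using xs by (cases ys) auto
    then show ?thesis using ne by (auto simp: free_reduction_def)
  qed
  then have "free_reduction (xs @ [x]) = push x (c # b # rev ys)"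
    using xs by (simp only: free_reduction_simps) simp
  then show ?case using xs ne by auto
qed simp

lemma free_reduction_append: "free_reduction (xs @ ys) = foldl (\<lambda>st x. push x st) (free_reduction xs) ys"
  by (simp add: free_reduction_def)

lemma free_reduction_remove_ear:
  assumes "a = b \<or> b = c \<or> a = c"
  shows "free_reduction (A @ [a, c] @ B) = free_reduction (A @ [a, b, c] @ B)"
proof -
  obtain r where r: "free_reduction (A @ [a]) = a # r" using free_reduction_hd[of A a] by blast
  have red: "reduced (a # r)" using reduced_free_reduction[of "A @ [a]"] r by simp
  have "push c (push b (a # r)) = push c (a # r)"
    using assms push_back[OF red, of b] by auto
  then have "free_reduction (A @ [a, c]) = free_reduction (A @ [a, b, c])"
    using r by (simp add: free_reduction_append)
  then show ?thesis
    using free_reduction_append[of "A @ [a, c]" B] free_reduction_append[of "A @ [a, b, c]" B] by simp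
qed

lemma ear_exists:
  assumes "length xs \<ge> 3" "length (free_reduction xs) = 1"
  obtains A B a b c where "xs = A @ [a, b, c] @ B" "a = b \<or> b = c \<or> a = c"
proof -
  have "\<not> (\<forall>A B a b c. xs = A @ [a, b, c] @ B \<longrightarrow> a \<noteq> b \<and> b \<noteq> c \<and> a \<noteq> c)"
    using free_reduction_no_ear[of xs] assms by (metis length_rev One_nat_def Suc_le_mono le_zero_eq numeral_3_eq_3 nat.distinct(1))
  then show ?thesis using that by blast
qed

section \<open>Triangulations of the region above a parabola\<close>

text \<open>The side of the chord through \<open>parab c\<close> and \<open>parab d\<close> is the sign of \<open>chordf c d\<close>, which equals
  \<open>(t - c) * (t - d)\<close> at \<open>parab t\<close>.\<close>

definition parab :: "real \<Rightarrow> real \<times> real" where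
  "parab t = (t, t\<^sup>2)"

definition chordf :: "real \<Rightarrow> real \<Rightarrow> real \<times> real \<Rightarrow> real" where
  "chordf c d z = snd z - (c + d) * fst z + c * d"

lemma chordf_parab: "chordf c d (parab t) = (t - c) * (t - d)"
  by (simp add: chordf_def parab_def power2_eq_square algebra_simps)

lemma chordf_affine:
  assumes "u + v = 1"
  shows "chordf c d (u *\<^sub>R x + v *\<^sub>R y) = u * chordf c d x + v * chordf c d y"
proof -
  have v: "v = 1 - u" using assms by simp
  show ?thesis unfolding v by (simp add: chordf_def algebra_simps)
qed

lemma chordf_nonneg_hull:
  assumes "\<And>t. t \<in> S \<Longrightarrow> t \<le> c \<or> d \<le> t" and "c \<le> d" and "z \<in> convex hull (parab ` S)"
  shows "chordf c d z \<ge> 0"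
proof -
  have "convex {z. chordf c d z \<ge> 0}"
    unfolding convex_def by (auto simp: chordf_affine)
  moreover have "parab ` S \<subseteq> {z. chordf c d z \<ge> 0}"
    using assms(1,2) by (auto simp: chordf_parab zero_le_mult_iff dest!: assms(1))
  ultimately show ?thesis
    using hull_minimal[of "parab ` S" "{z. chordf c d z \<ge> 0}" convex] assms(3) by auto
qed

text \<open>The tangent to the parabola at parameter \<open>fst z\<close> is the chord with both
  ends there, and no parameter lies strictly between equal ends.\<close>

lemma parab_hull_above:
  assumes "z \<in> convex hull (parab ` S)"
  shows "(fst z)\<^sup>2 \<le> snd z"
proof -
  have "chordf (fst z) (fst z) z \<ge> 0"
    using assms by (intro chordf_nonneg_hull[of S]) auto
  then show ?thesis by (simp add: chordf_def power2_eq_square algebra_simps)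
qed

text \<open>A point of the new hull lies on a segment from \<open>parab b\<close> to some
  \<open>y\<close> in the old hull. This segment crosses the chord from \<open>parab a\<close> to
  \<open>parab c\<close> at a point \<open>q\<close>; the piece before \<open>q\<close> lies in the
  ear, the piece after \<open>q\<close> in the old hull.\<close>

lemma convex_hull_insert_ear:
  assumes "a < b" "b < c" "a \<in> S" "c \<in> S" and S: "\<And>t. t \<in> S \<Longrightarrow> t \<le> a \<or> c \<le> t"
  shows "convex hull (parab ` insert b S) \<subseteq> convex hull (parab ` {a, b, c}) \<union> convex hull (parab ` S)"
proof
  fix z assume "z \<in> convex hull (parab ` insert b S)"
  then obtain u v y where uv: "u \<ge> 0" "v \<ge> 0" "u + v = 1" and y: "y \<in> convex hull (parab ` S)"
    and z: "z = u *\<^sub>R parab b + v *\<^sub>R y"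
  proof -
    have "z \<in> {u *\<^sub>R parab b + v *\<^sub>R y | u v y. 0 \<le> u \<and> 0 \<le> v \<and> u + v = 1 \<and> y \<in> convex hull (parab ` S)}"
      using \<open>z \<in> _\<close> assms(3) by (subst (asm) image_insert, subst (asm) convex_hull_insert) auto
    then show ?thesis using that by blast
  qed
  let ?\<phi> = "chordf a c"
  define lb where "lb = ?\<phi> (parab b)"
  have lb: "lb < 0"
    unfolding lb_def chordf_parab using assms(1,2) by (simp add: mult_less_0_iff)
  have ly: "?\<phi> y \<ge> 0"
    using chordf_nonneg_hull[OF S _ y] assms(1,2) by simp
  \<comment> \<open>The parameter at which the affine function \<open>?\<phi>\<close>, running from
    \<open>lb\<close> at \<open>parab b\<close> to its value at \<open>y\<close>, vanishes.\<close>
  define \<tau> where "\<tau> = lb / (lb - ?\<phi> y)"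
  have \<tau>: "0 < \<tau>" "\<tau> \<le> 1"
    using lb ly by (auto simp: \<tau>_def divide_simps)
  define q where "q = (1 - \<tau>) *\<^sub>R parab b + \<tau> *\<^sub>R y"
  have \<phi>q: "?\<phi> q = 0"
  proof -
    have "\<tau> * (lb - ?\<phi> y) = lb" using lb ly by (simp add: \<tau>_def)
    moreover have "?\<phi> q = (1 - \<tau>) * lb + \<tau> * ?\<phi> y"
      unfolding q_def lb_def by (rule chordf_affine) simp
    ultimately show ?thesis by (simp add: algebra_simps)
  qed
  have "q \<in> convex hull (parab ` insert b S)"
    unfolding q_def
    by (rule convexD[OF convex_convex_hull])
       (use \<tau> y hull_mono[of "parab ` S" "parab ` insert b S"] in \<open>auto intro: hull_inc\<close>)
  then have "(fst q)\<^sup>2 \<le> snd q" by (rule parab_hull_above)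
  \<comment> \<open>On the line of the chord, a point that is not below the parabola lies between
    the ends of the chord.\<close>
  with \<phi>q have "(fst q - a) * (fst q - c) \<le> 0"
    by (simp add: chordf_def power2_eq_square algebra_simps)
  then have q1: "a \<le> fst q" "fst q \<le> c"
    using assms(1,2) by (auto simp: mult_le_0_iff)
  define w where "w = (fst q - a) / (c - a)"
  have w: "0 \<le> w" "w \<le> 1"
    using q1 assms(1,2) by (auto simp: w_def)
  have "w * (c - a) = fst q - a"
    using assms(1,2) by (simp add: w_def)
  then have fq: "fst q = (1 - w) * a + w * c"
    by (simp add: algebra_simps)
  have sq: "snd q = (a + c) * fst q - a * c"
    using \<phi>q by (simp add: chordf_def)
  have "q = (1 - w) *\<^sub>R parab a + w *\<^sub>R parab c"
    by (rule prod_eqI) (auto simp: parab_def fq sq power2_eq_square algebra_simps)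
  then have qs: "q \<in> closed_segment (parab a) (parab c)"
    using w by (auto simp: closed_segment_def)
  show "z \<in> convex hull (parab ` {a, b, c}) \<union> convex hull (parab ` S)"
  proof (cases "v \<ge> \<tau>")
    case True
    have "z \<in> convex hull (parab ` S)"
    proof -
      have qS: "q \<in> convex hull (parab ` S)"
        using qs closed_segment_subset[of "parab a" "convex hull (parab ` S)" "parab c"] assms(3,4)
        by (auto simp: hull_inc)
      show ?thesis
      proof (cases "\<tau> = 1")
        case True
        then have "v = 1" "u = 0" using \<open>v \<ge> \<tau>\<close> uv by linarith+
        then have "z = y" using z by simp
        then show ?thesis using y by simp
      next
        case False
        define k where "k = (1 - v) / (1 - \<tau>)"
        have k: "0 \<le> k" "k \<le> 1" using False \<tau> True uv by (auto simp: k_def divide_simps)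
        have k': "k * (1 - \<tau>) = 1 - v" using False by (simp add: k_def)
        have "k *\<^sub>R q + (1 - k) *\<^sub>R y = (k * (1 - \<tau>)) *\<^sub>R parab b + (k * \<tau> + 1 - k) *\<^sub>R y"
          by (simp add: q_def algebra_simps)
        also have "k * \<tau> + 1 - k = v" using k' by (simp add: algebra_simps)
        also have "k * (1 - \<tau>) = u" using k' uv by simp
        finally have "z = k *\<^sub>R q + (1 - k) *\<^sub>R y" using z by simp
        then show ?thesis using k convexD[OF convex_convex_hull qS y, of k "1 - k"] by simp
      qed
    qed
    then show ?thesis by simp
  next
    case False
    define k where "k = v / \<tau>"
    have k: "0 \<le> k" "k \<le> 1" using False \<tau> uv by (auto simp: k_def divide_simps)
    have k': "k * \<tau> = v" using \<tau> by (simp add: k_def)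
    have "(1 - k) *\<^sub>R parab b + k *\<^sub>R q = (1 - k * \<tau>) *\<^sub>R parab b + (k * \<tau>) *\<^sub>R y"
      by (simp add: q_def algebra_simps)
    moreover have "1 - v = u" using uv by simp
    ultimately have ze: "z = (1 - k) *\<^sub>R parab b + k *\<^sub>R q" using z k' by simp
    have "q \<in> convex hull (parab ` {a, b, c})"
      using qs closed_segment_subset[of "parab a" "convex hull (parab ` {a, b, c})" "parab c"]
      by (auto simp: hull_inc)
    moreover have "parab b \<in> convex hull (parab ` {a, b, c})" by (simp add: hull_inc)
    ultimately have "z \<in> convex hull (parab ` {a, b, c})"
      unfolding ze using k by (intro convexD[OF convex_convex_hull]) auto
    then show ?thesis by simp
  qed
qed

text \<open>It puts the triangles \<open>u\<close> and \<open>v\<close> on opposite closed sides of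
  a chord, but speaks of parameters alone: in this form the condition is closed in
  \<open>(u, v, c, d)\<close> and passes to limits.\<close>

definition chord_separated :: "real^3 \<Rightarrow> real^3 \<Rightarrow> real \<Rightarrow> real \<Rightarrow> bool" where
  "chord_separated u v c d \<longleftrightarrow> c \<le> d \<and> (\<forall>i. c \<le> u $ i \<and> u $ i \<le> d) \<and> (\<forall>i. v $ i \<le> c \<or> d \<le> v $ i)"

text \<open>Triangles are triples of parameters and may be degenerate. Labels from one adjacent pair
  will keep interpolated values near \<open>X\<close>; the separating chords will give a common
  modulus of continuity.\<close>

definition triangulates :: "('l \<Rightarrow> 'l \<Rightarrow> bool) \<Rightarrow> (real \<Rightarrow> 'l) \<Rightarrow> real set \<Rightarrow> (real^3) set \<Rightarrow> bool" where
  "triangulates E lab U T \<longleftrightarrow>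
     (\<forall>u\<in>T. range (($) u) \<subseteq> U) \<and>
     (\<forall>u\<in>T. \<exists>a\<in>U. \<exists>b\<in>U. E (lab a) (lab b) \<and> (\<forall>i. lab (u $ i) \<in> {lab a, lab b})) \<and>
     (\<forall>u\<in>T. \<forall>v\<in>T. u = v \<or> (\<exists>c\<in>U. \<exists>d\<in>U. chord_separated u v c d \<or> chord_separated v u c d)) \<and>
     convex hull (parab ` U) \<subseteq> (\<Union>u\<in>T. convex hull (parab ` range (($) u)))"

text \<open>The old parameters lie outside the open interval from \<open>a\<close> to
  \<open>c\<close>, so a single chord separates the new triangle from all old ones.\<close>

lemma triangulates_insert:
  assumes T: "triangulates E lab U T" and "a < b" "b < c" "a \<in> U" "c \<in> U"
    and out: "\<And>t. t \<in> U \<Longrightarrow> t \<le> a \<or> c \<le> t"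
    and lab: "lab a = lab b \<or> lab b = lab c \<or> lab a = lab c"
    and E: "E (lab a) (lab b)" "E (lab b) (lab c)"
  shows "triangulates E lab (insert b U) (insert (vector [a, b, c]) T)"
proof -
  let ?u = "vector [a, b, c] :: real^3"
  have rng: "range (($) ?u) = {a, b, c}" by (auto simp: UNIV_3)
  have T1: "range (($) u) \<subseteq> U" if "u \<in> T" for u
    using T that by (auto simp: triangulates_def)
  have T2: "\<exists>a\<in>U. \<exists>b\<in>U. E (lab a) (lab b) \<and> (\<forall>i. lab (u $ i) \<in> {lab a, lab b})" if "u \<in> T" for u
    using T that by (auto simp: triangulates_def)
  have T3: "u = v \<or> (\<exists>c\<in>U. \<exists>d\<in>U. chord_separated u v c d \<or> chord_separated v u c d)" if "u \<in> T" "v \<in> T" for u v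
    using T that by (simp add: triangulates_def)
  have T4: "convex hull (parab ` U) \<subseteq> (\<Union>u\<in>T. convex hull (parab ` range (($) u)))"
    using T by (simp add: triangulates_def)
  have sep: "chord_separated ?u v a c" if "v \<in> T" for v
    unfolding chord_separated_def using T1[OF that] out assms(2,3) by (auto simp: forall_3)
  have ear: "\<exists>p\<in>insert b U. \<exists>q\<in>insert b U. E (lab p) (lab q) \<and> (\<forall>i. lab (?u $ i) \<in> {lab p, lab q})"
  proof (cases "lab b = lab c \<or> lab a = lab c")
    case True
    then show ?thesis using E assms(4) by (intro bexI[of _ a] bexI[of _ b]) (auto simp: forall_3)
  next
    case False
    then show ?thesis using E assms(5) lab by (intro bexI[of _ b] bexI[of _ c]) (auto simp: forall_3)
  qed
  show ?thesis
    unfolding triangulates_def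
  proof (intro conjI ballI)
    fix u assume u: "u \<in> insert ?u T"
    show "range (($) u) \<subseteq> insert b U"
    proof (cases "u = ?u")
      case True
      then show ?thesis unfolding True rng using assms(4,5) by simp
    next
      case False
      then show ?thesis using T1[of u] u by blast
    qed
    show "\<exists>a\<in>insert b U. \<exists>b\<in>insert b U. E (lab a) (lab b) \<and> (\<forall>i. lab (u $ i) \<in> {lab a, lab b})"
    proof (cases "u = ?u")
      case True
      then show ?thesis using ear by simp
    next
      case False
      then show ?thesis using T2[of u] u by blast
    qed
    fix v assume v: "v \<in> insert ?u T"
    show "u = v \<or> (\<exists>c\<in>insert b U. \<exists>d\<in>insert b U. chord_separated u v c d \<or> chord_separated v u c d)"
    proof (cases "u = ?u \<or> v = ?u")
      case True
      then show ?thesis using sep[of v] sep[of u] u v assms(4,5) by (metis insertCI insertE)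
    next
      case False
      then show ?thesis using T3[of u v] u v by blast
    qed
  next
    have "convex hull (parab ` insert b U) \<subseteq> convex hull (parab ` {a, b, c}) \<union> convex hull (parab ` U)"
      using assms by (intro convex_hull_insert_ear) auto
    also have "\<dots> \<subseteq> (\<Union>u\<in>insert ?u T. convex hull (parab ` range (($) u)))"
      unfolding UN_insert rng by (rule Un_mono[OF order_refl T4])
    finally show "convex hull (parab ` insert b U) \<subseteq> (\<Union>u\<in>insert ?u T. convex hull (parab ` range (($) u)))" .
  qed
qed

text \<open>Induction on the number of vertices: an ear of the label walk is cut off, which changes
  neither its reduced form nor the adjacency of consecutive labels, and is added back by
  \<open>triangulates_insert\<close>.\<close>

lemma ear_triangulation:
  fixes lab :: "real \<Rightarrow> 'l" and E :: "'l \<Rightarrow> 'l \<Rightarrow> bool"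
  assumes refl: "\<And>l. E l l"
    and "sorted_wrt (<) us" "length us \<ge> 2" "length (free_reduction (map lab us)) = 1"
    and "successively (\<lambda>a b. E (lab a) (lab b)) us"
  shows "\<exists>T. triangulates E lab (set us) T"
  using assms(2-)
proof (induction "length us" arbitrary: us rule: less_induct)
  case less
  show ?case
  proof (cases "length us \<ge> 3")
    case False
    with less.prems(2) have "length us = 2" by simp
    then obtain a b where us: "us = [a, b]"
      by (metis (no_types, lifting) Suc_length_conv length_0_conv numeral_2_eq_2)
    \<comment> \<open>Two vertices are covered by a degenerate triangle, whose hull is the segment
      between them.\<close>
    let ?u = "vector [a, b, b] :: real^3"
    have "range (($) ?u) = {a, b}"
      by (auto simp: UNIV_3)
    then have "triangulates E lab (set us) {?u}"
      using less.prems us unfolding triangulates_def by (auto simp: forall_3)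
    then show ?thesis ..
  next
    case True
    have "length (map lab us) \<ge> 3" using True by simp
    then obtain A' B' a' b' c' where
      "map lab us = A' @ [a', b', c'] @ B'" and lab: "a' = b' \<or> b' = c' \<or> a' = c'"
      by (rule ear_exists[OF _ less.prems(3)])
    then obtain A R where R: "us = A @ R" "map lab R = a' # b' # c' # B'"
      by (auto simp: map_eq_append_conv)
    then obtain a b c B where "R = a # b # c # B" and eq: "a' = lab a" "b' = lab b" "c' = lab c"
      unfolding map_eq_Cons_conv by blast
    with R have us: "us = A @ [a, b, c] @ B" by simp
    let ?us = "A @ [a, c] @ B"
    have lab: "lab a = lab b \<or> lab b = lab c \<or> lab a = lab c" using lab eq by simp
    have set: "set us = insert b (set ?us)" using us by auto
    have srt: "sorted_wrt (<) ?us" and abc: "a < b" "b < c"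
      and out: "\<And>t. t \<in> set ?us \<Longrightarrow> t \<le> a \<or> c \<le> t"
      using less.prems(1) us by (auto simp: sorted_wrt_append)
    have E: "E (lab a) (lab b)" "E (lab b) (lab c)"
      using less.prems(4) us by (auto simp: successively_append_iff)
    \<comment> \<open>Dropping \<open>b\<close> leaves a walk: if \<open>b\<close> shares its label
      with a neighbour, one of the old edges serves, and \<open>lab a = lab c\<close> is covered by
      reflexivity.\<close>
    have "E (lab a) (lab c)" using lab E refl[of "lab a"] by metis
    then have succ: "successively (\<lambda>a b. E (lab a) (lab b)) ?us"
      using less.prems(4) us by (auto simp: successively_append_iff successively_Cons)
    have wd: "length (free_reduction (map lab ?us)) = 1"
      using less.prems(3) us free_reduction_remove_ear[OF lab, of "map lab A" "map lab B"] by simp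
    have "length ?us < length us" "length ?us \<ge> 2" using us by auto
    from less.hyps[OF this(1) srt this(2) wd succ] obtain T where "triangulates E lab (set ?us) T" ..
    then have "triangulates E lab (set us) (insert (vector [a, b, c]) T)"
      unfolding set by (rule triangulates_insert) (use abc out lab E in auto)
    then show ?thesis ..
  qed
qed

section \<open>Affine interpolation over triangles with vertices on the parabola\<close>

text \<open>The affine interpolation of \<open>f\<close> at barycentric coordinates
  \<open>l\<close>; for \<open>f = parab\<close> it is the point itself. The coordinates are kept as
  data because on a degenerate triangle the point does not determine them.\<close>

definition bary :: "(real \<Rightarrow> 'a::real_vector) \<Rightarrow> real^3 \<Rightarrow> real^3 \<Rightarrow> 'a" where
  "bary f u l = (\<Sum>i\<in>UNIV. l $ i *\<^sub>R f (u $ i))"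

definition weights :: "real^3 \<Rightarrow> bool" where
  "weights l \<longleftrightarrow> (\<forall>i. 0 \<le> l $ i) \<and> (\<Sum>i\<in>UNIV. l $ i) = 1"

lemma hull_imp_bary:
  assumes "z \<in> convex hull (f ` range (($) u))"
  obtains l where "weights l" "z = bary f u l"
proof -
  let ?B = "{bary f u l | l. weights l}"
  have "convex ?B"
  proof (rule convexI)
    fix x y and a b :: real
    assume "x \<in> ?B" "y \<in> ?B" and ab: "0 \<le> a" "0 \<le> b" "a + b = 1"
    then obtain l m where *: "weights l" "weights m" and xy: "x = bary f u l" "y = bary f u m" by blast
    have "weights (a *\<^sub>R l + b *\<^sub>R m)"
      using * ab by (auto simp: weights_def sum.distrib sum_distrib_left[symmetric])
    moreover have "a *\<^sub>R x + b *\<^sub>R y = bary f u (a *\<^sub>R l + b *\<^sub>R m)"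
      unfolding xy by (simp add: bary_def sum.distrib scaleR_sum_right algebra_simps)
    ultimately show "a *\<^sub>R x + b *\<^sub>R y \<in> ?B" by blast
  qed
  moreover have "f ` range (($) u) \<subseteq> ?B"
  proof clarify
    fix i
    have "weights (axis i 1)" by (auto simp: weights_def axis_def)
    moreover have "f (u $ i) = bary f u (axis i 1)"
      by (simp add: bary_def axis_def if_distrib[of "\<lambda>x. x *\<^sub>R _"] cong: if_cong)
    ultimately show "\<exists>l. f (u $ i) = bary f u l \<and> weights l" by auto
  qed
  ultimately have "convex hull (f ` range (($) u)) \<subseteq> ?B"
    by (intro hull_minimal)
  then show ?thesis using assms that by auto
qed

lemma bary_in_hull:
  assumes "weights l" shows "bary f u l \<in> convex hull (f ` range (($) u))"
  unfolding bary_def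
  by (rule convex_sum) (use assms in \<open>auto simp: weights_def intro: hull_inc\<close>)

text \<open>A quadratic polynomial in \<open>t\<close> is affine in \<open>parab t\<close>, so its
  interpolation depends on the point only. The factor \<open>l $ i\<close> in the hypothesis exempts
  vertices of weight zero.\<close>

lemma bary_affine:
  assumes "weights l" and "\<And>i. l $ i *\<^sub>R f (u $ i) = l $ i *\<^sub>R (A + (u $ i) *\<^sub>R B + (u $ i)\<^sup>2 *\<^sub>R C)"
  shows "bary f u l = A + fst (bary parab u l) *\<^sub>R B + snd (bary parab u l) *\<^sub>R C"
proof -
  have "bary f u l = (\<Sum>i\<in>UNIV. l $ i) *\<^sub>R A + (\<Sum>i\<in>UNIV. l $ i * u $ i) *\<^sub>R B + (\<Sum>i\<in>UNIV. l $ i * (u $ i)\<^sup>2) *\<^sub>R C"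
    by (simp add: bary_def assms(2) scaleR_sum_left sum.distrib[symmetric] scaleR_right_distrib)
  then show ?thesis using assms(1)
    by (simp add: weights_def bary_def parab_def fst_sum snd_sum)
qed

lemma chordf_bary:
  assumes "weights l"
  shows "chordf c d (bary parab u l) = (\<Sum>i\<in>UNIV. l $ i * ((u $ i - c) * (u $ i - d)))"
proof -
  have "bary (\<lambda>t. (t - c) * (t - d)) u l = c * d + fst (bary parab u l) *\<^sub>R (- (c + d)) + snd (bary parab u l) *\<^sub>R 1"
    by (rule bary_affine[OF assms]) (simp add: power2_eq_square algebra_simps)
  then show ?thesis by (simp add: bary_def chordf_def algebra_simps)
qed

text \<open>Only vertices at \<open>c\<close> or \<open>d\<close> carry weight, hence the value is
  linear along the chord and independent of the triangle. For \<open>c = d\<close> the quotient is 0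
  and the formula still holds.\<close>

lemma bary_on_chord:
  fixes f :: "real \<Rightarrow> 'a::real_vector"
  assumes "weights l" and "\<And>i. l $ i * ((u $ i - c) * (u $ i - d)) = 0"
  shows "bary f u l = f c + ((fst (bary parab u l) - c) / (d - c)) *\<^sub>R (f d - f c)"
proof -
  define B where "B = (1 / (d - c)) *\<^sub>R (f d - f c)"
  have B: "(d - c) *\<^sub>R B = f d - f c" by (cases "c = d") (auto simp: B_def)
  have "bary f u l = (f c - c *\<^sub>R B) + fst (bary parab u l) *\<^sub>R B + snd (bary parab u l) *\<^sub>R 0"
  proof (rule bary_affine[OF assms(1)])
    fix i
    have "l $ i = 0 \<or> u $ i = c \<or> u $ i = d" using assms(2)[of i] by auto
    then show "l $ i *\<^sub>R f (u $ i) = l $ i *\<^sub>R (f c - c *\<^sub>R B + u $ i *\<^sub>R B + (u $ i)\<^sup>2 *\<^sub>R 0)"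
    proof (rule disjE)
      assume "u $ i = c \<or> u $ i = d"
      then have "f (u $ i) = f c - c *\<^sub>R B + u $ i *\<^sub>R B" using B by (auto simp: algebra_simps)
      then show ?thesis by simp
    qed simp
  qed
  then show ?thesis by (simp add: B_def algebra_simps diff_divide_distrib)
qed

text \<open>\<open>chordf t t\<close> becomes a weighted sum of squares; its vanishing confines the
  weight to vertices equal to \<open>t\<close>.\<close>

lemma bary_at_vertex:
  assumes "weights l" "bary parab u l = parab t"
  shows "bary f u l = f t"
proof -
  have "chordf t t (bary parab u l) = 0" by (simp add: assms(2) chordf_parab)
  then have "(\<Sum>i\<in>UNIV. l $ i * ((u $ i - t) * (u $ i - t))) = 0" by (simp add: chordf_bary[OF assms(1)])
  then have "\<And>i. l $ i * ((u $ i - t) * (u $ i - t)) = 0"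
    using assms(1) by (subst (asm) sum_nonneg_eq_0_iff) (auto simp: weights_def)
  from bary_on_chord[OF assms(1) this, of f] show ?thesis by simp
qed

text \<open>All vertices lie on one side of the chord from 0 to 1, so a point on it has weight only
  at these two parameters, where \<open>f\<close> takes the same value.\<close>

lemma bary_on_closing_chord:
  assumes "weights l" "\<And>i. u $ i \<in> {0..1}" "bary parab u l = (t, t)" "f 0 = f 1"
  shows "bary f u l = f 0"
proof -
  have "chordf 0 1 (bary parab u l) = 0" by (simp add: assms(3) chordf_def)
  then have "(\<Sum>i\<in>UNIV. l $ i * ((u $ i - 0) * (1 - u $ i))) = 0"
    by (simp add: chordf_bary[OF assms(1)] algebra_simps sum_subtractf)
  moreover have "l $ i * ((u $ i - 0) * (1 - u $ i)) \<ge> 0" for i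
    using assms(1) assms(2)[of i] by (auto simp: weights_def)
  ultimately have "l $ i * ((u $ i - 0) * (1 - u $ i)) = 0" for i
    by (subst (asm) sum_nonneg_eq_0_iff) auto
  then have "l $ i * ((u $ i - 0) * (u $ i - 1)) = 0" for i by auto
  from bary_on_chord[OF assms(1) this, of f] show ?thesis using assms(4) by simp
qed

text \<open>Newton interpolation. Where nodes coincide, division by zero makes the divided
  difference 0, and the interpolation condition repeats an earlier one.\<close>

lemma quadratic_interpolation:
  fixes f :: "real \<Rightarrow> 'a::real_vector"
  shows "\<exists>A B C. \<forall>t\<in>{x, y, z}. f t = A + t *\<^sub>R B + t\<^sup>2 *\<^sub>R C"
proof -
  define D1 where "D1 = (1 / (y - x)) *\<^sub>R (f y - f x)"
  define D2 where "D2 = (1 / ((z - x) * (z - y))) *\<^sub>R (f z - f x - (z - x) *\<^sub>R D1)"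
  define q where "q t = f x + (t - x) *\<^sub>R D1 + ((t - x) * (t - y)) *\<^sub>R D2" for t
  have qx: "q x = f x" by (simp add: q_def)
  have qy: "q y = f y" by (cases "x = y") (auto simp: q_def D1_def)
  have qz: "q z = f z"
  proof (cases "z = x \<or> z = y")
    case True
    then show ?thesis using qx qy by auto
  next
    case False
    then have "((z - x) * (z - y)) *\<^sub>R D2 = f z - f x - (z - x) *\<^sub>R D1" by (simp add: D2_def)
    then show ?thesis by (simp add: q_def)
  qed
  have "q t = (f x - x *\<^sub>R D1 + (x * y) *\<^sub>R D2) + t *\<^sub>R (D1 - (x + y) *\<^sub>R D2) + t\<^sup>2 *\<^sub>R D2" for t
    by (simp add: q_def power2_eq_square algebra_simps)
  with qx qy qz show ?thesis by (metis empty_iff insert_iff)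
qed

lemma bary_unique_same:
  fixes f :: "real \<Rightarrow> 'a::real_vector"
  assumes "weights l" "weights m" "bary parab u l = bary parab u m"
  shows "bary f u l = bary f u m"
proof -
  obtain A B C where *: "\<forall>t\<in>{u $ 1, u $ 2, u $ 3}. f t = A + t *\<^sub>R B + t\<^sup>2 *\<^sub>R C"
    using quadratic_interpolation by blast
  have "f (u $ i) = A + (u $ i) *\<^sub>R B + (u $ i)\<^sup>2 *\<^sub>R C" for i
    using * exhaust_3[of i] by auto
  then show ?thesis
    using bary_affine[OF assms(1), of f u A B C] bary_affine[OF assms(2), of f u A B C] assms(3) by simp
qed

text \<open>A common point lies on both closed sides of the chord, hence on it: terms of one sign
  with sum zero vanish one by one, and \<open>bary_on_chord\<close> gives the same value from either
  triangle.\<close>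

lemma bary_unique_separated:
  fixes f :: "real \<Rightarrow> 'a::real_vector"
  assumes "weights l" "weights m" "bary parab u l = bary parab v m" "chord_separated u v c d"
  shows "bary f u l = bary f v m"
proof -
  let ?p = "\<lambda>w. (w - c) * (w - d)"
  have n1: "l $ i * ?p (u $ i) \<le> 0" for i
    using assms(1,4) by (auto simp: weights_def chord_separated_def mult_le_0_iff)
  have n2: "m $ i * ?p (v $ i) \<ge> 0" for i
    using assms(2,4) by (fastforce simp: weights_def chord_separated_def zero_le_mult_iff)
  have "(\<Sum>i\<in>UNIV. l $ i * ?p (u $ i)) = (\<Sum>i\<in>UNIV. m $ i * ?p (v $ i))"
    using assms(3) chordf_bary[OF assms(1), of c d u] chordf_bary[OF assms(2), of c d v] by simp
  moreover have "(\<Sum>i\<in>UNIV. l $ i * ?p (u $ i)) \<le> 0" by (rule sum_nonpos) (use n1 in auto)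
  moreover have "(\<Sum>i\<in>UNIV. m $ i * ?p (v $ i)) \<ge> 0" by (rule sum_nonneg) (use n2 in auto)
  ultimately have s: "(\<Sum>i\<in>UNIV. l $ i * ?p (u $ i)) = 0" "(\<Sum>i\<in>UNIV. m $ i * ?p (v $ i)) = 0" by auto
  have "(\<Sum>i\<in>UNIV. - (l $ i * ?p (u $ i))) = 0" using s(1) by (simp add: sum_negf)
  then have "- (l $ i * ?p (u $ i)) = 0" for i
    by (subst (asm) sum_nonneg_eq_0_iff) (use n1 in auto)
  then have "l $ i * ?p (u $ i) = 0" for i by simp
  moreover have "m $ i * ?p (v $ i) = 0" for i
    using s(2) by (subst (asm) sum_nonneg_eq_0_iff) (use n2 in auto)
  ultimately show ?thesis
    using bary_on_chord[OF assms(1), of u c d f] bary_on_chord[OF assms(2), of v c d f] assms(3) by simp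
qed

section \<open>Compactness of families of triangles with noncrossing chords\<close>

text \<open>The chord ends range over the compact unit interval instead of a finite vertex set, so
  that one condition fits all members of a sequence and the ends have convergent
  subsequences.\<close>

definition chord_family :: "(real^3) set \<Rightarrow> bool" where
  "chord_family T \<longleftrightarrow> (\<forall>u\<in>T. range (($) u) \<subseteq> {0..1}) \<and>
     (\<forall>u\<in>T. \<forall>v\<in>T. u = v \<or> (\<exists>c\<in>{0..1}. \<exists>d\<in>{0..1}. chord_separated u v c d \<or> chord_separated v u c d))"

definition separating :: "real^3 \<Rightarrow> real^3 \<Rightarrow> real \<Rightarrow> real \<Rightarrow> bool" where
  "separating u v c d \<longleftrightarrow> u = v \<or> chord_separated u v c d \<or> chord_separated v u c d"

lemma bary_unique:
  fixes f :: "real \<Rightarrow> 'a::real_vector"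
  assumes "weights l" "weights m" "bary parab u l = bary parab v m" "separating u v c d"
  shows "bary f u l = bary f v m"
  using assms bary_unique_same bary_unique_separated unfolding separating_def by metis

lemma closed_weights: "closed {p. weights (f p)}" if "continuous_on UNIV f" for f :: "'a::topological_space \<Rightarrow> real^3"
  unfolding weights_def
  by (intro closed_Collect_conj closed_Collect_all closed_Collect_le closed_Collect_eq continuous_intros
      continuous_on_vec_lambda that) 

lemma closed_chord_separated:
  fixes f :: "'a::topological_space \<Rightarrow> real^3"
  assumes "continuous_on UNIV f" "continuous_on UNIV g" "continuous_on UNIV c" "continuous_on UNIV d"
  shows "closed {p. chord_separated (f p) (g p) (c p) (d p)}"
  unfolding chord_separated_def
  by (intro closed_Collect_conj closed_Collect_disj closed_Collect_all closed_Collect_le continuous_intros assms)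

lemma closed_separating:
  fixes f :: "'a::topological_space \<Rightarrow> real^3"
  assumes "continuous_on UNIV f" "continuous_on UNIV g" "continuous_on UNIV c" "continuous_on UNIV d"
  shows "closed {p. separating (f p) (g p) (c p) (d p)}"
  unfolding separating_def
  by (intro closed_Collect_disj closed_Collect_eq closed_chord_separated assms)

lemma tendsto_bary:
  fixes f :: "nat \<Rightarrow> real \<Rightarrow> 'a::real_normed_vector"
  assumes unif: "\<And>e. 0 < e \<Longrightarrow> \<exists>N. \<forall>n t. n \<ge> N \<and> t \<in> {0..1} \<longrightarrow> norm (f n t - g t) < e"
    and g: "continuous_on {0..1} g"
    and "u \<longlonglongrightarrow> u0" "l \<longlonglongrightarrow> l0" "\<And>n i. u n $ i \<in> {0..1}"
  shows "(\<lambda>n. bary (f n) (u n) (l n)) \<longlonglongrightarrow> bary g u0 l0"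
  unfolding bary_def
proof (intro tendsto_sum tendsto_scaleR)
  fix i
  show "(\<lambda>n. l n $ i) \<longlonglongrightarrow> l0 $ i" using assms(4) by (rule tendsto_vec_nth)
  have ui: "(\<lambda>n. u n $ i) \<longlonglongrightarrow> u0 $ i" using assms(3) by (rule tendsto_vec_nth)
  have "u0 $ i \<in> {0..1}"
    by (rule closed_sequentially[OF closed_atLeastAtMost _ ui]) (use assms(5) in auto)
  then have "(\<lambda>n. g (u n $ i)) \<longlonglongrightarrow> g (u0 $ i)"
    using g ui assms(5) by (auto simp: continuous_on_sequentially o_def)
  moreover have "(\<lambda>n. f n (u n $ i) - g (u n $ i)) \<longlonglongrightarrow> 0"
    unfolding LIMSEQ_iff using unif assms(5) by (metis diff_zero)
  ultimately have "(\<lambda>n. (f n (u n $ i) - g (u n $ i)) + g (u n $ i)) \<longlonglongrightarrow> 0 + g (u0 $ i)"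
    by (intro tendsto_add)
  then show "(\<lambda>n. f n (u n $ i)) \<longlonglongrightarrow> g (u0 $ i)" by simp
qed

text \<open>In the limit the two triangles either coincide or are separated by a chord; in the latter case a
  common point lies on that chord, where both values interpolate \<open>f\<close> linearly.\<close>

lemma bary_equicontinuous:
  fixes f :: "nat \<Rightarrow> real \<Rightarrow> 'a::euclidean_space"
  assumes T: "\<And>n. chord_family (T n)"
    and bnd: "\<And>n t. t \<in> {0..1} \<Longrightarrow> norm (f n t) \<le> M"
    and eqc: "\<And>e. e > 0 \<Longrightarrow> \<exists>d>0. \<forall>n. \<forall>s\<in>{0..1}. \<forall>t\<in>{0..1}. \<bar>s - t\<bar> < d \<longrightarrow> norm (f n s - f n t) < e"
    and "e > 0"
  shows "\<exists>d>0. \<forall>n. \<forall>u\<in>T n. \<forall>v\<in>T n. \<forall>l m. weights l \<and> weights m \<and>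
           dist (bary parab u l) (bary parab v m) < d \<longrightarrow> dist (bary (f n) u l) (bary (f n) v m) < e"
proof (rule ccontr)
  assume "\<not> ?thesis"
  then have *: "\<forall>d. d > 0 \<longrightarrow> (\<exists>n u v l m. u \<in> T n \<and> v \<in> T n \<and> weights l \<and> weights m \<and>
      dist (bary parab u l) (bary parab v m) < d \<and> dist (bary (f n) u l) (bary (f n) v m) \<ge> e)"
    by (meson not_less)
  have "\<forall>k. \<exists>n u v l m c d. u \<in> T n \<and> v \<in> T n \<and> weights l \<and> weights m \<and>
      dist (bary parab u l) (bary parab v m) < inverse (real (Suc k)) \<and> dist (bary (f n) u l) (bary (f n) v m) \<ge> e
      \<and> c \<in> {0..1} \<and> d \<in> {0..1} \<and> separating u v c d"
  proof
    fix k
    obtain n u v l m where 1: "u \<in> T n" "v \<in> T n" "weights l" "weights m"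
      "dist (bary parab u l) (bary parab v m) < inverse (real (Suc k))" "dist (bary (f n) u l) (bary (f n) v m) \<ge> e"
      using *[rule_format, of "inverse (real (Suc k))"] by auto
    have "\<exists>c\<in>{0..1}. \<exists>d\<in>{0..1}. separating u v c d"
    proof (cases "u = v")
      case True
      then show ?thesis by (intro bexI[of _ 0]) (auto simp: separating_def)
    next
      case False
      then show ?thesis using T[of n] 1(1,2) unfolding chord_family_def separating_def by blast
    qed
    with 1 show "\<exists>n u v l m c d. u \<in> T n \<and> v \<in> T n \<and> weights l \<and> weights m \<and>
      dist (bary parab u l) (bary parab v m) < inverse (real (Suc k)) \<and> dist (bary (f n) u l) (bary (f n) v m) \<ge> e
      \<and> c \<in> {0..1} \<and> d \<in> {0..1} \<and> separating u v c d" by blast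
  qed
  then obtain N U V L M' C D where
    TT: "\<And>k. U k \<in> T (N k)" "\<And>k. V k \<in> T (N k)" and W: "\<And>k. weights (L k)" "\<And>k. weights (M' k)"
    and near: "\<And>k. dist (bary parab (U k) (L k)) (bary parab (V k) (M' k)) < inverse (real (Suc k))"
    and far: "\<And>k. dist (bary (f (N k)) (U k) (L k)) (bary (f (N k)) (V k) (M' k)) \<ge> e"
    and CD: "\<And>k. C k \<in> {0..1}" "\<And>k. D k \<in> {0..1}" "\<And>k. separating (U k) (V k) (C k) (D k)"
    by metis
  have U01: "U k $ i \<in> {0..1}" "V k $ i \<in> {0..1}" for k i
    using T[of "N k"] TT[of k] unfolding chord_family_def by blast+
  have W01: "L k $ i \<in> {0..1}" "M' k $ i \<in> {0..1}" for k i
  proof -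
    have "m $ i \<in> {0..1}" if "weights m" for m :: "real^3"
      using that member_le_sum[of i UNIV "($) m"] by (auto simp: weights_def)
    then show "L k $ i \<in> {0..1}" "M' k $ i \<in> {0..1}" using W by auto
  qed
  \<comment> \<open>The indices \<open>N k\<close> need not increase; equicontinuity holds uniformly
    over all members, so any sequence of them is admissible.\<close>
  obtain g r where g: "continuous_on {0..1} g" and r: "strict_mono (r :: nat \<Rightarrow> nat)"
    and unif: "\<And>e. 0 < e \<Longrightarrow> \<exists>n0. \<forall>n t. n \<ge> n0 \<and> t \<in> {0..1} \<longrightarrow> norm (f (N (r n)) t - g t) < e"
  proof (rule Arzela_Ascoli[of "{0..1::real}" "\<lambda>k. f (N k)" M])
    show "\<exists>d>0. \<forall>n t. t \<in> {0..1} \<and> norm (s - t) < d \<longrightarrow> norm (f (N n) s - f (N n) t) < e"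
      if "s \<in> {0..1}" "0 < e" for s :: real and e :: real
      using eqc[OF that(2)] that(1) by (metis real_norm_def)
  qed (use bnd in auto)
  \<comment> \<open>All data of the counterexamples go into one compact box, so a single subsequence
    makes them converge together.\<close>
  define Z where "Z k = (U k, V k, L k, M' k, C k, D k)" for k
  let ?K = "cbox (0 :: (real^3) \<times> (real^3) \<times> (real^3) \<times> (real^3) \<times> real \<times> real) (1, 1, 1, 1, 1, 1)"
  have "Z (r k) \<in> ?K" for k
    unfolding Z_def zero_prod_def cbox_Pair_eq mem_Times_iff
    using U01 W01 CD by (auto simp: mem_box_cart)
  then have "\<forall>k. (Z \<circ> r) k \<in> ?K" by simp
  moreover have "seq_compact ?K" by (intro compact_imp_seq_compact compact_cbox)
  ultimately obtain z0 r' where r': "strict_mono (r' :: nat \<Rightarrow> nat)" and "((Z \<circ> r) \<circ> r') \<longlonglongrightarrow> z0"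
    by (meson seq_compactE)
  then have lim: "(\<lambda>k. Z (r (r' k))) \<longlonglongrightarrow> z0" by (simp add: o_def)
  obtain u v l m c d where z0: "z0 = (u, v, l, m, c, d)" by (metis prod.collapse)
  let ?q = "\<lambda>k. r (r' k)"
  have lims: "(\<lambda>k. U (?q k)) \<longlonglongrightarrow> u" "(\<lambda>k. V (?q k)) \<longlonglongrightarrow> v" "(\<lambda>k. L (?q k)) \<longlonglongrightarrow> l"
    "(\<lambda>k. M' (?q k)) \<longlonglongrightarrow> m"
    using tendsto_fst[OF lim] tendsto_fst[OF tendsto_snd[OF lim]] tendsto_fst[OF tendsto_snd[OF tendsto_snd[OF lim]]]
      tendsto_fst[OF tendsto_snd[OF tendsto_snd[OF tendsto_snd[OF lim]]]]
    by (simp_all add: Z_def z0)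
  have "closed {p :: (real^3) \<times> (real^3) \<times> (real^3) \<times> (real^3) \<times> real \<times> real.
      weights (fst (snd (snd p))) \<and> weights (fst (snd (snd (snd p)))) \<and>
      separating (fst p) (fst (snd p)) (fst (snd (snd (snd (snd p))))) (snd (snd (snd (snd (snd p)))))}" (is "closed ?S")
    by (intro closed_Collect_conj closed_weights closed_separating continuous_intros)
  moreover have "Z (?q k) \<in> ?S" for k using W CD by (simp add: Z_def)
  ultimately have "z0 \<in> ?S" using lim by (metis (no_types, lifting) closed_sequentially)
  then have lim_ok: "weights l" "weights m" "separating u v c d" by (auto simp: z0)
  have unif': "\<exists>n0. \<forall>n t. n \<ge> n0 \<and> t \<in> {0..1} \<longrightarrow> norm (f (N (?q n)) t - g t) < e" if "0 < e" for e
    using unif[OF that] r' by (meson le_trans strict_mono_imp_increasing)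
  have cp: "continuous_on {0..1} parab" unfolding parab_def by (intro continuous_intros)
  have b1: "(\<lambda>k. bary (f (N (?q k))) (U (?q k)) (L (?q k))) \<longlonglongrightarrow> bary g u l"
    by (rule tendsto_bary[OF unif' g]) (use lims U01 in auto)
  have b2: "(\<lambda>k. bary (f (N (?q k))) (V (?q k)) (M' (?q k))) \<longlonglongrightarrow> bary g v m"
    by (rule tendsto_bary[OF unif' g]) (use lims U01 in auto)
  have p1: "(\<lambda>k. bary parab (U (?q k)) (L (?q k))) \<longlonglongrightarrow> bary parab u l"
    by (rule tendsto_bary[OF _ cp]) (use lims U01 in auto)
  have p2: "(\<lambda>k. bary parab (V (?q k)) (M' (?q k))) \<longlonglongrightarrow> bary parab v m"
    by (rule tendsto_bary[OF _ cp]) (use lims U01 in auto)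
  have "strict_mono ?q" using r r' by (simp add: strict_mono_def)
  then have inv: "(\<lambda>k. inverse (real (Suc (?q k)))) \<longlonglongrightarrow> 0"
    using LIMSEQ_subseq_LIMSEQ[OF LIMSEQ_inverse_real_of_nat] by (auto simp: o_def)
  have "dist (bary parab u l) (bary parab v m) \<le> 0"
    by (rule LIMSEQ_le[OF tendsto_dist[OF p1 p2] inv]) (use near in \<open>auto intro: less_imp_le\<close>)
  then have "bary parab u l = bary parab v m" by simp
  then have "bary g u l = bary g v m" using bary_unique lim_ok by metis
  moreover have "e \<le> dist (bary g u l) (bary g v m)"
    by (rule LIMSEQ_le_const[OF tendsto_dist[OF b1 b2]]) (use far in auto)
  ultimately show False using \<open>e > 0\<close> by simp
qed

text \<open>A filling of the loop sampled at \<open>U\<close>. Its values are only near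
  \<open>X\<close>, since segments between points of \<open>X\<close> may leave it; letting
  \<open>e\<close> tend to 0 brings them back.\<close>

definition approx_filling :: "'a::real_normed_vector set \<Rightarrow> (real \<Rightarrow> 'a::real_normed_vector) \<Rightarrow> real \<Rightarrow> real set \<Rightarrow> (real^3) set \<Rightarrow> bool" where
  "approx_filling X f e U T \<longleftrightarrow> finite U \<and> {0, 1} \<subseteq> U \<and> U \<subseteq> {0..1} \<and>
     (\<forall>t\<in>{0..1}. \<exists>u\<in>U. \<bar>t - u\<bar> < e) \<and> chord_family T \<and>
     convex hull (parab ` U) \<subseteq> (\<Union>u\<in>T. convex hull (parab ` range (($) u))) \<and>
     (\<forall>u\<in>T. \<forall>l. weights l \<longrightarrow> infdist (bary f u l) X \<le> e)"

lemma dist_parab_le: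
  assumes "s \<in> {0..1}" "t \<in> {0..1}"
  shows "dist (parab s) (parab t) \<le> 3 * \<bar>s - t\<bar>"
proof -
  have "s\<^sup>2 - t\<^sup>2 = (s - t) * (s + t)" by (simp add: power2_eq_square algebra_simps)
  then have "\<bar>s\<^sup>2 - t\<^sup>2\<bar> \<le> \<bar>s - t\<bar> * 2"
    using assms by (auto simp: abs_mult intro!: mult_left_mono)
  then show ?thesis
    using norm_Pair_le[of "s - t" "s\<^sup>2 - t\<^sup>2"] by (simp add: parab_def dist_norm)
qed

text \<open>The fillings live on varying polygons; composing them with the projection to the
  polygon, which does not increase distances, makes them equicontinuous on one region. Their uniform
  limit has values in the closed set \<open>X\<close>.\<close>

theorem extends_of_approx_fillings:
  fixes f :: "nat \<Rightarrow> real \<Rightarrow> 'a::euclidean_space"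
  assumes "compact X" "X \<noteq> {}"
    and fX: "\<And>n t. t \<in> {0..1} \<Longrightarrow> f n t \<in> X"
    and eqc: "\<And>e. e > 0 \<Longrightarrow> \<exists>d>0. \<forall>n. \<forall>s\<in>{0..1}. \<forall>t\<in>{0..1}. \<bar>s - t\<bar> < d \<longrightarrow> norm (f n s - f n t) < e"
    and lim: "\<And>t. t \<in> {0..1} \<Longrightarrow> (\<lambda>n. f n t) \<longlonglongrightarrow> g t"
    and loop: "\<And>n. f n 0 = f n 1"
    and fill: "\<And>n. approx_filling X (f n) (inverse (real (Suc n))) (U n) (T n)"
  obtains F where "continuous_on (convex hull (parab ` {0..1})) F" "F ` (convex hull (parab ` {0..1})) \<subseteq> X"
    "\<And>t. t \<in> {0..1} \<Longrightarrow> F (parab t) = g t" "\<And>t. t \<in> {0..1} \<Longrightarrow> F (t, t) = g 0"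
proof -
  let ?R = "convex hull (parab ` {0..1})"
  obtain M where M: "\<And>x. x \<in> X \<Longrightarrow> norm x \<le> M"
    using compact_imp_bounded[OF \<open>compact X\<close>] unfolding bounded_iff by blast
  have fM: "norm (f n t) \<le> M" if "t \<in> {0..1}" for n t using M fX that by blast
  define C where "C n = convex hull (parab ` U n)" for n
  have U: "finite (U n)" "{0, 1} \<subseteq> U n" "U n \<subseteq> {0..1}" "chord_family (T n)" for n
    using fill[of n] by (auto simp: approx_filling_def)
  have "compact (C n)" for n
    unfolding C_def by (intro compact_convex_hull finite_imp_compact finite_imageI U(1))
  then have C: "closed (C n)" "convex (C n)" "C n \<noteq> {}" for n
    using U(2)[of n] by (auto simp: C_def compact_imp_closed)
  \<comment> \<open>Triangle and coordinates are chosen arbitrarily for each point;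
    \<open>bary_equicontinuous\<close> compares any two such choices, so the resulting functions are
    still equicontinuous.\<close>
  have "\<exists>u l. u \<in> T n \<and> weights l \<and> bary parab u l = closest_point (C n) z" for n z
  proof -
    have "closest_point (C n) z \<in> C n" using C by (simp add: closest_point_in_set)
    then obtain u where "u \<in> T n" "closest_point (C n) z \<in> convex hull (parab ` range (($) u))"
      using fill[of n] by (auto simp: approx_filling_def C_def)
    then show ?thesis by (metis hull_imp_bary)
  qed
  then obtain u l where ul: "\<And>n z. u n z \<in> T n" "\<And>n z. weights (l n z)"
      "\<And>n z. bary parab (u n z) (l n z) = closest_point (C n) z"
    by metis
  define F where "F n z = bary (f n) (u n z) (l n z)" for n z
  have u01: "u n z $ i \<in> {0..1}" for n z i
    using U(4)[of n] ul(1)[of n z] unfolding chord_family_def by blast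
  have FM: "norm (F n z) \<le> M" for n z
  proof -
    have "F n z \<in> convex hull (f n ` range (($) (u n z)))"
      unfolding F_def by (rule bary_in_hull[OF ul(2)])
    also have "\<dots> \<subseteq> cball 0 M"
    proof (rule hull_minimal)
      show "f n ` range (($) (u n z)) \<subseteq> cball 0 M"
      proof clarify
        fix i show "f n (u n z $ i) \<in> cball 0 M" using fM[OF u01[of n z i], of n] by simp
      qed
    qed auto
    finally show ?thesis by simp
  qed
  have equi: "\<exists>d>0. \<forall>n z w. dist z w < d \<longrightarrow> dist (F n z) (F n w) < e" if e: "e > 0" for e
  proof -
    have "\<exists>d>0. \<forall>n. \<forall>u\<in>T n. \<forall>v\<in>T n. \<forall>l m. weights l \<and> weights m \<and>
           dist (bary parab u l) (bary parab v m) < d \<longrightarrow> dist (bary (f n) u l) (bary (f n) v m) < e"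
      by (rule bary_equicontinuous[OF _ _ _ e]) (fact U(4) fM eqc)+
    then obtain d where d: "d > 0" "\<And>n u v l m. u \<in> T n \<Longrightarrow> v \<in> T n \<Longrightarrow> weights l \<Longrightarrow> weights m \<Longrightarrow>
           dist (bary parab u l) (bary parab v m) < d \<Longrightarrow> dist (bary (f n) u l) (bary (f n) v m) < e"
      by blast
    have "dist (F n z) (F n w) < e" if "dist z w < d" for n z w
    proof -
      have "dist (closest_point (C n) z) (closest_point (C n) w) \<le> dist z w"
        by (rule closest_point_lipschitz) (use C in auto)
      then show ?thesis unfolding F_def using that by (intro d(2) ul) (simp add: ul)
    qed
    with d(1) show ?thesis by blast
  qed
  have compR: "compact ?R"
    by (intro compact_convex_hull compact_continuous_image) (auto simp: parab_def intro!: continuous_intros)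
  obtain G r where G: "continuous_on ?R G" and r: "strict_mono (r :: nat \<Rightarrow> nat)"
    and unif: "\<And>e. 0 < e \<Longrightarrow> \<exists>N. \<forall>n x. n \<ge> N \<and> x \<in> ?R \<longrightarrow> norm (F (r n) x - G x) < e"
  proof (rule Arzela_Ascoli[OF compR, of F M])
    show "\<exists>d>0. \<forall>n y. y \<in> ?R \<and> norm (x - y) < d \<longrightarrow> norm (F n x - F n y) < e" if "0 < e" for x e
      using equi[OF that] unfolding dist_norm by blast
  qed (use FM in auto)
  have limF: "(\<lambda>n. F (r n) z) \<longlonglongrightarrow> G z" if "z \<in> ?R" for z
    unfolding LIMSEQ_iff using unif that by blast
  have rlim: "(\<lambda>n. h (r n)) \<longlonglongrightarrow> x" if "h \<longlonglongrightarrow> x" for h :: "nat \<Rightarrow> 'b::topological_space" and x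
    using LIMSEQ_subseq_LIMSEQ[OF that r] by (simp add: o_def)
  have inv: "(\<lambda>n. inverse (real (Suc n))) \<longlonglongrightarrow> 0" by (rule LIMSEQ_inverse_real_of_nat)
  have GX: "G z \<in> X" if "z \<in> ?R" for z
  proof -
    have "infdist (F n z) X \<le> inverse (real (Suc n))" for n
      using fill[of n] ul unfolding approx_filling_def F_def by blast
    moreover have "(\<lambda>n. infdist (F (r n) z) X) \<longlonglongrightarrow> infdist (G z) X"
      by (rule tendsto_infdist[OF limF[OF that]])
    ultimately have "infdist (G z) X \<le> 0"
      using LIMSEQ_le[OF _ rlim[OF inv]] by blast
    then have "infdist (G z) X = 0" using infdist_nonneg[of "G z" X] by linarith
    then show ?thesis
      using in_closed_iff_infdist_zero[OF compact_imp_closed[OF assms(1)] assms(2)] by simp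
  qed
  \<comment> \<open>\<open>parab t\<close> may lie outside the polygon; it is compared with a nearby
    sample point \<open>s\<close> of \<open>U n\<close>, where the interpolation is exact.\<close>
  have Gp: "G (parab t) = g t" if t: "t \<in> {0..1}" for t
  proof -
    have "(\<lambda>n. F n (parab t) - f n t) \<longlonglongrightarrow> 0"
    proof (rule LIMSEQ_I)
      fix e :: real assume "e > 0"
      then have "e / 2 > 0" by simp
      obtain d1 where d1: "d1 > 0" "\<And>n z w. dist z w < d1 \<Longrightarrow> dist (F n z) (F n w) < e / 2"
        using equi[OF \<open>e / 2 > 0\<close>] by blast
      obtain d2 where d2: "d2 > 0" "\<And>n s t. s \<in> {0..1} \<Longrightarrow> t \<in> {0..1} \<Longrightarrow> \<bar>s - t\<bar> < d2 \<Longrightarrow> norm (f n s - f n t) < e / 2"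
        using eqc[OF \<open>e / 2 > 0\<close>] by blast
      have "min (d1 / 3) d2 > 0" using d1 d2 by simp
      then obtain N where N: "\<And>n. n \<ge> N \<Longrightarrow> inverse (real (Suc n)) < min (d1 / 3) d2"
        using inv unfolding LIMSEQ_iff by (metis abs_of_pos diff_zero inverse_positive_iff_positive of_nat_0_less_iff real_norm_def zero_less_Suc)
      have "norm (F n (parab t) - f n t - 0) < e" if "n \<ge> N" for n
      proof -
        obtain s where s: "s \<in> U n" "\<bar>t - s\<bar> < inverse (real (Suc n))"
          using fill[of n] t unfolding approx_filling_def by blast
        have s01: "s \<in> {0..1}" using s U by blast
        have "parab s \<in> C n" using s by (auto simp: C_def intro: hull_inc)
        then have "bary parab (u n (parab s)) (l n (parab s)) = parab s"
          by (simp add: ul closest_point_self)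
        then have Fs: "F n (parab s) = f n s"
          unfolding F_def by (rule bary_at_vertex[OF ul(2)])
        have "dist (parab t) (parab s) < d1"
          using dist_parab_le[OF t s01] s(2) N[OF that] by auto
        then have "dist (F n (parab t)) (f n s) < e / 2" using d1(2)[of "parab t" "parab s" n] Fs by simp
        moreover have "norm (f n s - f n t) < e / 2"
          using d2(2)[OF s01 t] s(2) N[OF that] by auto
        ultimately show ?thesis
          using norm_triangle_lt[of "F n (parab t) - f n s" "f n s - f n t" e] by (simp add: dist_norm)
      qed
      then show "\<exists>N. \<forall>n\<ge>N. norm (F n (parab t) - f n t - 0) < e" by blast
    qed
    then have "(\<lambda>n. F n (parab t) - f n t + f n t) \<longlonglongrightarrow> 0 + g t"
      by (intro tendsto_add lim t)
    then have "(\<lambda>n. F (r n) (parab t)) \<longlonglongrightarrow> g t" using rlim by force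
    moreover have "parab t \<in> ?R" using t by (auto intro: hull_inc)
    ultimately show ?thesis using limF LIMSEQ_unique by blast
  qed
  have chord: "(t, t) \<in> convex hull (parab ` S)" if "t \<in> {0..1}" "{0, 1} \<subseteq> S" for t and S :: "real set"
  proof -
    have "(t, t) = (1 - t) *\<^sub>R parab 0 + t *\<^sub>R parab 1" by (simp add: parab_def)
    also have "\<dots> \<in> convex hull (parab ` S)"
      by (rule convexD[OF convex_convex_hull]) (use that in \<open>auto intro: hull_inc\<close>)
    finally show ?thesis .
  qed
  have Gc: "G (t, t) = g 0" if t: "t \<in> {0..1}" for t
  proof -
    have "F n (t, t) = f n 0" for n
    proof -
      have "(t, t) \<in> C n" unfolding C_def by (rule chord[OF t U(2)])
      then have "bary parab (u n (t, t)) (l n (t, t)) = (t, t)" by (simp add: ul closest_point_self)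
      then show ?thesis unfolding F_def by (rule bary_on_closing_chord[OF ul(2) u01 _ loop])
    qed
    then have "(\<lambda>n. F (r n) (t, t)) \<longlonglongrightarrow> g 0" using rlim[OF lim[of 0]] by simp
    moreover have "(t, t) \<in> ?R" using t by (intro chord) auto
    ultimately show ?thesis using limF LIMSEQ_unique by blast
  qed
  show thesis using that[OF G _ Gp Gc] GX by blast
qed

text \<open>The parabola is slid to its chord along straight segments; \<open>F\<close> turns this
  into a homotopy from \<open>g\<close> to a constant path.\<close>

lemma homotopic_of_extends:
  assumes F: "continuous_on (convex hull (parab ` {0..1})) F" "F ` (convex hull (parab ` {0..1})) \<subseteq> X"
    and Fp: "\<And>t. t \<in> {0..1} \<Longrightarrow> F (parab t) = g t" and Fc: "\<And>t. t \<in> {0..1} \<Longrightarrow> F (t, t) = g 0"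
  shows "homotopic_paths X g (linepath (g 0) (g 0))"
proof -
  let ?R = "convex hull (parab ` {0..1})"
  define k where "k t = (t, t)" for t :: real
  have kR: "k t \<in> ?R" if "t \<in> {0..1}" for t
  proof -
    have "k t = (1 - t) *\<^sub>R parab 0 + t *\<^sub>R parab 1" by (simp add: parab_def k_def)
    also have "\<dots> \<in> ?R"
      by (rule convexD[OF convex_convex_hull]) (use that in \<open>auto intro: hull_inc\<close>)
    finally show ?thesis .
  qed
  have "homotopic_paths ?R parab k"
  proof (rule homotopic_paths_linear)
    show "path parab" "path k" by (auto simp: path_def parab_def k_def intro!: continuous_intros)
    show "closed_segment (parab t) (k t) \<subseteq> ?R" if "t \<in> {0..1}" for t
      using that kR by (intro closed_segment_subset) (auto intro: hull_inc)
  qed (auto simp: pathstart_def pathfinish_def parab_def k_def)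
  then have 1: "homotopic_paths X (F \<circ> parab) (F \<circ> k)"
    by (rule homotopic_paths_continuous_image[OF _ F(1)]) (use F(2) in auto)
  have pF: "path (F \<circ> parab)" "path (F \<circ> k)" "path_image (F \<circ> parab) \<subseteq> X" "path_image (F \<circ> k) \<subseteq> X"
    using homotopic_paths_imp_path[OF 1] homotopic_paths_imp_subset[OF 1] by auto
  have 2: "homotopic_paths X (F \<circ> parab) g"
    by (rule homotopic_paths_eq[OF pF(1,3)]) (simp add: Fp)
  have 3: "homotopic_paths X (F \<circ> k) (linepath (g 0) (g 0))"
    by (rule homotopic_paths_eq[OF pF(2,4)]) (simp add: Fc k_def)
  show ?thesis using 1 2 3 homotopic_paths_sym homotopic_paths_trans by blast
qed

section \<open>Null-homotopic loops in a plane compactum\<close>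

text \<open>A point of the plane is labelled by the index of its vertical slab of width \<open>h\<close> and by its
  component in the part of the \<open>e\<close>-neighbourhood of \<open>X\<close> lying over a slightly enlarged slab.\<close>

definition slab :: "(real^2) set \<Rightarrow> real \<Rightarrow> real \<Rightarrow> int \<Rightarrow> (real^2) set" where
  "slab X e h k = (\<Union>x\<in>X. ball x e) \<inter> {z. (of_int k - 1/2) * h < z $ 1 \<and> z $ 1 < (of_int k + 3/2) * h}"

definition slab_label :: "(real^2) set \<Rightarrow> real \<Rightarrow> real \<Rightarrow> real^2 \<Rightarrow> int \<times> (real^2) set" where
  "slab_label X e h z = (let k = \<lfloor>z $ 1 / h\<rfloor> in (k, connected_component_set (slab X e h k) z))"

text \<open>The edges of the nerve. Equality is a separate case because the set in a label may be
  empty while adjacency must be reflexive for every label.\<close>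

definition label_adj :: "int \<times> (real^2) set \<Rightarrow> int \<times> (real^2) set \<Rightarrow> bool" where
  "label_adj p q \<longleftrightarrow> p = q \<or> (\<bar>fst p - fst q\<bar> \<le> 1 \<and> snd p \<inter> snd q \<noteq> {})"

lemma floor_slab:
  fixes a h :: real
  assumes "h > 0" shows "of_int \<lfloor>a / h\<rfloor> * h \<le> a" "a < (of_int \<lfloor>a / h\<rfloor> + 1) * h"
proof -
  have "of_int \<lfloor>a / h\<rfloor> \<le> a / h" by simp
  then show "of_int \<lfloor>a / h\<rfloor> * h \<le> a" using assms pos_le_divide_eq by blast
  have "a / h < of_int \<lfloor>a / h\<rfloor> + 1" by linarith
  then show "a < (of_int \<lfloor>a / h\<rfloor> + 1) * h" using assms pos_divide_less_eq by blast
qed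

text \<open>Each slab is enlarged by \<open>h / 2\<close> on both sides, which leaves room for any
  shorter segment starting in it.\<close>

lemma segment_in_slab:
  assumes "x \<in> X" "y \<in> X" "dist x y < e" "dist x y < h / 2" "h > 0"
  shows "closed_segment x y \<subseteq> slab X e h \<lfloor>x $ 1 / h\<rfloor>"
proof
  fix z assume z: "z \<in> closed_segment x y"
  then have d: "dist x z \<le> dist x y"
    using dist_in_closed_segment[OF z] by (simp add: dist_commute)
  then have "\<bar>x $ 1 - z $ 1\<bar> < h / 2"
    using assms(4) dist_vec_nth_le[of x 1 z] by (simp add: dist_real_def)
  moreover have "z \<in> ball x e" using d assms(3) by simp
  ultimately show "z \<in> slab X e h \<lfloor>x $ 1 / h\<rfloor>"
    using floor_slab[OF \<open>h > 0\<close>, of "x $ 1"] assms(1) unfolding slab_def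
    by (auto simp: algebra_simps abs_if split: if_splits)
qed

lemma floor_near:
  fixes x y :: real
  assumes "\<bar>x - y\<bar> < h / 2" "h > 0"
  shows "\<bar>\<lfloor>x / h\<rfloor> - \<lfloor>y / h\<rfloor>\<bar> \<le> 1"
proof -
  have "\<bar>x / h - y / h\<bar> < 1" using assms by (simp add: abs_if field_simps split: if_splits)
  then show ?thesis by linarith
qed

lemma slab_label_near:
  assumes "x \<in> X" "y \<in> X" "dist x y < e" "dist x y < h / 2" "h > 0"
  shows "label_adj (slab_label X e h x) (slab_label X e h y)"
    and "\<lfloor>x $ 1 / h\<rfloor> = \<lfloor>y $ 1 / h\<rfloor> \<Longrightarrow> slab_label X e h x = slab_label X e h y"
proof -
  let ?k = "\<lambda>x. \<lfloor>x $ 1 / h\<rfloor>"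
  have cc: "connected_component (slab X e h (?k x)) x y"
    using segment_in_slab[OF assms] unfolding connected_component_def
    by (intro exI[of _ "closed_segment x y"]) auto
  have yy: "connected_component (slab X e h (?k y)) y y"
    using segment_in_slab[of y X x e h] assms by (simp add: dist_commute connected_component_refl subset_iff)
  show eq: "slab_label X e h x = slab_label X e h y" if "?k x = ?k y"
    using cc that connected_component_eq[of y "slab X e h (?k x)" x] by (simp add: slab_label_def Let_def)
  have "\<bar>x $ 1 - y $ 1\<bar> < h / 2"
    using assms(4) dist_vec_nth_le[of x 1 y] by (simp add: dist_real_def)
  then have "\<bar>?k x - ?k y\<bar> \<le> 1" using floor_near[OF _ assms(5)] by blast
  then show "label_adj (slab_label X e h x) (slab_label X e h y)"
    using cc yy unfolding label_adj_def slab_label_def Let_def by auto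
qed

text \<open>Pairwise close points have indices differing by at most 1, so only two slabs occur, and
  in each of them short segments put the points into one component.\<close>

lemma slab_labels_two:
  assumes "\<And>x y. x \<in> S \<Longrightarrow> y \<in> S \<Longrightarrow> dist x y < e \<and> dist x y < h / 2" "S \<subseteq> X" "h > 0"
  shows "\<exists>l l'. slab_label X e h ` S \<subseteq> {l, l'}"
proof (cases "S = {}")
  case False
  let ?k = "\<lambda>x::real^2. \<lfloor>x $ 1 / h\<rfloor>"
  have near: "\<bar>?k x - ?k y\<bar> \<le> 1" if "x \<in> S" "y \<in> S" for x y
    using assms(1)[OF that] dist_vec_nth_le[of x 1 y] floor_near[OF _ assms(3), of "x $ 1" "y $ 1"]
    by (auto simp: dist_real_def)
  have same: "slab_label X e h x = slab_label X e h y" if "x \<in> S" "y \<in> S" "?k x = ?k y" for x y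
    using slab_label_near(2)[of x X y e h] assms that by blast
  obtain x where x: "x \<in> S" using False by blast
  show ?thesis
  proof (cases "\<exists>y\<in>S. ?k y \<noteq> ?k x")
    case True
    then obtain y where y: "y \<in> S" "?k y \<noteq> ?k x" by blast
    have "slab_label X e h z \<in> {slab_label X e h x, slab_label X e h y}" if "z \<in> S" for z
    proof -
      have "?k z = ?k x \<or> ?k z = ?k y"
        using near[OF that x] near[OF that y(1)] near[OF x y(1)] y(2) by linarith
      then show ?thesis using same[OF that x] same[OF that y(1)] by blast
    qed
    then show ?thesis by blast
  next
    case False
    then have "slab_label X e h ` S \<subseteq> {slab_label X e h x, slab_label X e h x}"
      using same[OF _ x] by blast
    then show ?thesis by blast
  qed
qed auto

text \<open>Adjacent labels span a connected set over an interval of length \<open>3 * h\<close>, and such a set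
  contains a point at the height of any point of the convex hull.\<close>

lemma infdist_hull_labels:
  assumes adj: "label_adj p q" and p: "p = slab_label X e h a" "a \<in> X" and q: "q = slab_label X e h b" "b \<in> X"
    and "e > 0" "h > 0" and S: "\<And>x. x \<in> S \<Longrightarrow> x \<in> X \<and> slab_label X e h x \<in> {p, q}"
    and z: "z \<in> convex hull S"
  shows "infdist z X \<le> 3 * h + e"
proof -
  have mem: "x \<in> snd (slab_label X e h x)" and con: "connected (snd (slab_label X e h x))"
    and sub: "snd (slab_label X e h x) \<subseteq> slab X e h (fst (slab_label X e h x))" if "x \<in> X" for x
  proof -
    have "x \<in> slab X e h \<lfloor>x $ 1 / h\<rfloor>"
      using segment_in_slab[of x X x e h] that assms(6,7) by simp
    then show "x \<in> snd (slab_label X e h x)" by (simp add: slab_label_def Let_def connected_component_refl)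
  qed (auto simp: slab_label_def Let_def connected_component_subset)
  let ?V = "snd p \<union> snd q"
  have conV: "connected ?V"
  proof (rule connected_Un)
    show "snd p \<inter> snd q \<noteq> {}" using adj mem[OF p(2)] p(1) by (auto simp: label_adj_def)
  qed (use con p q in auto)
  have SV: "S \<subseteq> ?V" using S mem by fastforce
  define m where "m = min (fst p) (fst q)"
  have fst: "fst p \<in> {m, m + 1}" "fst q \<in> {m, m + 1}"
    using adj unfolding label_adj_def m_def by auto
  have strip: "(of_int m - 1/2) * h < v $ 1 \<and> v $ 1 < (of_int m + 5/2) * h" if "v \<in> ?V" for v
  proof -
    have "v \<in> slab X e h (fst p) \<or> v \<in> slab X e h (fst q)"
      using that sub[OF p(2)] sub[OF q(2)] p(1) q(1) by blast
    then obtain k where k: "k \<in> {m, m + 1}" "v \<in> slab X e h k" using fst by blast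
    then show ?thesis using \<open>h > 0\<close> by (auto simp: slab_def algebra_simps)
  qed
  let ?I = "{z::real^2. (of_int m - 1/2) * h < z $ 1 \<and> z $ 1 < (of_int m + 5/2) * h}"
  have "convex ?I"
  proof -
    have "?I = (\<lambda>z. z $ 1) -` {(of_int m - 1/2) * h <..< (of_int m + 5/2) * h}" by auto
    moreover have "convex \<dots>"
      by (intro convex_linear_vimage bounded_linear.linear bounded_linear_vec_nth) simp
    ultimately show ?thesis by (simp only:)
  qed
  then have zI: "z \<in> ?I"
    using hull_minimal[of S ?I convex] SV strip z by blast
  \<comment> \<open>The second coordinates of a connected set form an interval, whose preimage is
    convex and contains \<open>S\<close>, hence also its hull.\<close>
  have "connected ((\<lambda>v. v $ 2) ` ?V)"
    by (intro connected_continuous_image conV continuous_intros)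
  then have "convex ((\<lambda>v. v $ 2) ` ?V)" 
    using is_interval_connected_1 is_interval_convex_1 by blast
  then have "convex ((\<lambda>v::real^2. v $ 2) -` ((\<lambda>v. v $ 2) ` ?V))"
    by (intro convex_linear_vimage bounded_linear.linear bounded_linear_vec_nth)
  moreover have "S \<subseteq> (\<lambda>v::real^2. v $ 2) -` ((\<lambda>v. v $ 2) ` ?V)" using SV by auto
  ultimately have "convex hull S \<subseteq> (\<lambda>v::real^2. v $ 2) -` ((\<lambda>v. v $ 2) ` ?V)"
    by (intro hull_minimal)
  then have "z $ 2 \<in> (\<lambda>v. v $ 2) ` ?V" using z by auto
  then obtain v where v: "v \<in> ?V" "v $ 2 = z $ 2" by (metis (no_types, lifting) imageE)
  have "\<bar>v $ 1 - z $ 1\<bar> < 3 * h" using strip[OF v(1)] zI by (auto simp: algebra_simps)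
  then have "dist z v \<le> 3 * h"
    using norm_le_l1_cart[of "z - v"] v(2) by (simp add: dist_norm sum_2)
  moreover obtain x where "x \<in> X" "dist x v < e"
  proof -
    have "v \<in> slab X e h (fst p) \<union> slab X e h (fst q)"
      using v(1) sub[OF p(2)] sub[OF q(2)] p(1) q(1) by blast
    then show thesis using that by (auto simp: slab_def)
  qed
  ultimately show ?thesis
    using infdist_le[of x X z] dist_triangle[of z x v] by (simp add: dist_commute)
qed

lemma free_reduction_const: "free_reduction (map (\<lambda>i. c) [0..<Suc m]) = [c]"
proof (induction m)
  case (Suc m)
  then show ?case using free_reduction_simps(2)[of "map (\<lambda>i. c) [0..<Suc m]" c] by simp
qed (simp add: free_reduction_def)

lemma null_homotopy_square:
  assumes "homotopic_paths X f (linepath (f 0) (f 0))"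
  obtains h :: "real \<times> real \<Rightarrow> 'a::real_normed_vector" where "continuous_on ({0..1} \<times> {0..1}) h" "h ` ({0..1} \<times> {0..1}) \<subseteq> X"
    "\<And>t. t \<in> {0..1} \<Longrightarrow> h (0, t) = f t" "\<And>t. t \<in> {0..1} \<Longrightarrow> h (1, t) = f 0"
    "\<And>s. s \<in> {0..1} \<Longrightarrow> h (s, 0) = f 0" "\<And>s. s \<in> {0..1} \<Longrightarrow> h (s, 1) = f 1"
proof -
  obtain h :: "real \<times> real \<Rightarrow> 'a" where h: "continuous_on ({0..1} \<times> {0..1}) h" "h \<in> {0..1} \<times> {0..1} \<rightarrow> X"
    "\<forall>x\<in>{0..1}. h (0, x) = f x" "\<forall>x\<in>{0..1}. h (1, x) = linepath (f 0) (f 0) x"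
    "\<forall>t\<in>{0..1}. pathstart (h \<circ> Pair t) = pathstart f \<and> pathfinish (h \<circ> Pair t) = pathfinish f"
    using assms unfolding homotopic_paths by blast
  show thesis
  proof (rule that[of h])
    show "h (1, t) = f 0" if "t \<in> {0..1}" for t
      using h(4) that by (simp add: linepath_def algebra_simps)
    show "h (s, 0) = f 0" "h (s, 1) = f 1" if "s \<in> {0..1}" for s
      using h(5) that by (auto simp: pathstart_def pathfinish_def)
  qed (use h in auto)
qed

text \<open>On a fine grid of the homotopy square each cell carries at most two labels, so all rows
  have the same reduced walk. The last row is constant; hence the walk of the loop reduces to one
  vertex and \<open>ear_triangulation\<close> applies.\<close>

lemma approx_filling_exists:
  fixes f :: "real \<Rightarrow> real^2"
  assumes null: "homotopic_paths X f (linepath (f 0) (f 0))" and "e > 0"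
  shows "\<exists>U T. approx_filling X f e U T"
proof -
  obtain h :: "real \<times> real \<Rightarrow> real^2" where h: "continuous_on ({0..1} \<times> {0..1}) h" "h ` ({0..1} \<times> {0..1}) \<subseteq> X"
      and h0: "\<And>t. t \<in> {0..1} \<Longrightarrow> h (0, t) = f t" and h1: "\<And>t. t \<in> {0..1} \<Longrightarrow> h (1, t) = f 0"
      and hs: "\<And>s. s \<in> {0..1} \<Longrightarrow> h (s, 0) = f 0" "\<And>s. s \<in> {0..1} \<Longrightarrow> h (s, 1) = f 1"
    using null by (rule null_homotopy_square) blast
  have f1: "f 1 = f 0" using h1[of 1] hs(2)[of 1] by force
  have fX: "f t \<in> X" if "t \<in> {0..1}" for t
  proof -
    have "h (0, t) \<in> h ` ({0..1} \<times> {0..1})" using that by (intro imageI) simp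
    then show ?thesis using h0[OF that] h(2) by auto
  qed
  \<comment> \<open>The split makes the bound \<open>3 * w + e1\<close> from
    \<open>infdist_hull_labels\<close> equal to \<open>e\<close>.\<close>
  define e1 where "e1 = e / 2"
  define w where "w = e / 6"
  have ew: "e1 > 0" "w > 0" "3 * w + e1 = e" using \<open>e > 0\<close> by (auto simp: e1_def w_def)
  have "uniformly_continuous_on ({0..1} \<times> {0..1}) h"
    by (intro compact_uniformly_continuous h(1) compact_Times) auto
  then obtain d where d: "d > 0" "\<And>x y. x \<in> {0..1} \<times> {0..1} \<Longrightarrow> y \<in> {0..1} \<times> {0..1} \<Longrightarrow> dist y x < d \<Longrightarrow> dist (h y) (h x) < min e1 (w / 2)"
    using ew unfolding uniformly_continuous_on_def by (metis half_gt_zero min_less_iff_conj)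
  \<comment> \<open>\<open>d / 2\<close> appears because neighbouring grid points may differ in both
    coordinates; the bound by \<open>e\<close> makes the grid points \<open>e\<close>-dense in the
    interval.\<close>
  obtain M :: nat where M: "M > 0" "1 / real M < min (d / 2) e"
  proof -
    obtain n where "inverse (real (Suc n)) < min (d / 2) e"
      using reals_Archimedean[of "min (d / 2) e"] d(1) \<open>e > 0\<close> by auto
    then show thesis using that[of "Suc n"] by (simp add: inverse_eq_divide)
  qed
  define A where "A j i = slab_label X e1 w (h (real j / M, real i / M))" for j i :: nat
  define lab where "lab t = slab_label X e1 w (f t)" for t
  have grid: "(real j / M, real i / M) \<in> {0..1} \<times> {0..1}" if "j \<le> M" "i \<le> M" for i j
    using that M(1) by auto
  have near: "dist (h (real j / M, real i / M)) (h (real j' / M, real i' / M)) < min e1 (w / 2)"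
    if "j \<le> M" "i \<le> M" "j' \<le> M" "i' \<le> M" "\<bar>int j - int j'\<bar> \<le> 1" "\<bar>int i - int i'\<bar> \<le> 1" for i j i' j'
  proof (rule d(2)[OF grid[OF that(3,4)] grid[OF that(1,2)]])
    have 1: "\<bar>real a / M - real b / M\<bar> \<le> 1 / M" if "\<bar>int a - int b\<bar> \<le> 1" for a b
    proof -
      have "\<bar>real a - real b\<bar> \<le> 1" using that by linarith
      then have "\<bar>(real a - real b) / M\<bar> \<le> 1 / M" using M(1) by (simp add: divide_right_mono)
      then show ?thesis by (simp add: diff_divide_distrib)
    qed
    have "dist (real j / M, real i / M) (real j' / M, real i' / M) \<le> \<bar>real j / M - real j' / M\<bar> + \<bar>real i / M - real i' / M\<bar>"
      using norm_Pair_le[of "real j / M - real j' / M" "real i / M - real i' / M"] by (simp add: dist_norm)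
    also have "\<dots> < d" using 1[OF that(5)] 1[OF that(6)] M(2) by linarith
    finally show "dist (real j / M, real i / M) (real j' / M, real i' / M) < d" .
  qed
  have rows: "free_reduction (map (A j) [0..<Suc M]) = free_reduction (map (A (Suc j)) [0..<Suc M])" if "j < M" for j
  proof (rule free_reduction_ladder)
    fix i assume "i < M"
    define H where "H j i = h (real j / M, real i / M)" for j i :: nat
    define S where "S = {H j i, H j (Suc i), H (Suc j) i, H (Suc j) (Suc i)}"
    have HX: "H a b \<in> X" if "a \<le> M" "b \<le> M" for a b
    proof -
      have "H a b \<in> h ` ({0..1} \<times> {0..1})" unfolding H_def using grid[OF that] by (rule imageI)
      then show ?thesis using h(2) by blast
    qed
    have "\<exists>l l'. slab_label X e1 w ` S \<subseteq> {l, l'}"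
    proof (rule slab_labels_two)
      show "S \<subseteq> X" using HX \<open>i < M\<close> that unfolding S_def by simp
      fix x y assume "x \<in> S" "y \<in> S"
      then obtain a b a' b' where *: "a \<in> {j, Suc j}" "a' \<in> {j, Suc j}" "b \<in> {i, Suc i}" "b' \<in> {i, Suc i}"
        "x = H a b" "y = H a' b'"
        unfolding S_def by (metis insert_iff singletonD)
      have "dist x y < min e1 (w / 2)"
        unfolding *(5,6) H_def using *(1-4) \<open>i < M\<close> that by (intro near) auto
      then show "dist x y < e1 \<and> dist x y < w / 2" by simp
    qed (use ew in auto)
    then show "\<exists>l l'. {A j i, A j (Suc i), A (Suc j) i, A (Suc j) (Suc i)} \<subseteq> {l, l'}"
      by (simp add: S_def H_def A_def)
  next
    show "A j 0 = A (Suc j) 0" "A j M = A (Suc j) M"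
      using M(1) that hs by (auto simp: A_def)
  qed
  have "free_reduction (map (A 0) [0..<Suc M]) = free_reduction (map (A j) [0..<Suc M])" if "j \<le> M" for j
    using that by (induction j) (auto simp: rows simp del: upt_Suc)
  then have "free_reduction (map (A 0) [0..<Suc M]) = free_reduction (map (A M) [0..<Suc M])" by blast
  also have "map (A M) [0..<Suc M] = map (\<lambda>i. lab 0) [0..<Suc M]"
    using M(1) by (intro map_cong refl) (auto simp: A_def lab_def h1)
  finally have wd: "free_reduction (map (A 0) [0..<Suc M]) = [lab 0]" by (simp only: free_reduction_const)
  define us where "us = map (\<lambda>i. real i / M) [0..<Suc M]"
  have lus: "map lab us = map (A 0) [0..<Suc M]"
    unfolding us_def map_map using M(1) by (intro map_cong refl) (auto simp: A_def lab_def h0)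
  have set_us: "set us = (\<lambda>i. real i / M) ` {..M}" by (auto simp: us_def atMost_upto simp del: upt_Suc)
  have us01: "set us \<subseteq> {0..1}" using M(1) by (auto simp: set_us)
  have "\<exists>T. triangulates label_adj lab (set us) T"
  proof (rule ear_triangulation)
    show "label_adj l l" for l by (simp add: label_adj_def)
    show "sorted_wrt (<) us"
      using M(1) by (auto simp: us_def sorted_wrt_map sorted_wrt_iff_nth_less divide_strict_right_mono simp del: upt_Suc)
    show "length us \<ge> 2" using M(1) by (simp add: us_def)
    show "length (free_reduction (map lab us)) = 1" by (simp add: lus wd del: upt_Suc)
    show "successively (\<lambda>a b. label_adj (lab a) (lab b)) us"
      unfolding successively_conv_nth
    proof (intro allI impI)
      fix i assume i: "Suc i < length us"
      then have iM: "Suc i \<le> M" by (simp add: us_def)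
      have n: "us ! i = real i / M" "us ! Suc i = real (Suc i) / M"
        using i unfolding us_def by (simp_all del: upt_Suc)
      have t: "real i / M \<in> {0..1}" "real (Suc i) / M \<in> {0..1}" using iM M(1) by auto
      have "dist (f (real i / M)) (f (real (Suc i) / M)) < min e1 (w / 2)"
        using near[of 0 i 0 "Suc i"] iM h0[OF t(1)] h0[OF t(2)] by simp
      then show "label_adj (lab (us ! i)) (lab (us ! Suc i))"
        unfolding lab_def n using fX[OF t(1)] fX[OF t(2)] ew by (intro slab_label_near(1)) auto
    qed
  qed
  then obtain T where T: "triangulates label_adj lab (set us) T" ..
  have "approx_filling X f e (set us) T"
    unfolding approx_filling_def chord_family_def
  proof (intro conjI ballI allI impI)
    show "{0, 1} \<subseteq> set us"
      using M(1) by (auto simp: set_us intro: image_eqI[of _ _ 0] image_eqI[of _ _ M])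
    show "set us \<subseteq> {0..1}" by (rule us01)
    show "convex hull (parab ` set us) \<subseteq> (\<Union>u\<in>T. convex hull (parab ` range (($) u)))"
      using T unfolding triangulates_def by blast
  next
    fix t :: real assume t: "t \<in> {0..1}"
    define i where "i = nat \<lfloor>t * M\<rfloor>"
    have i: "real i \<le> t * M" "t * M < real i + 1" using t by (auto simp: i_def)
    have "t * M \<le> M" using t M(1) by (simp add: mult_left_le_one_le)
    then have "i \<le> M" using i(1) by (metis of_nat_le_iff order_trans)
    then have "real i / M \<in> set us" by (auto simp: set_us)
    moreover have "\<bar>t - real i / M\<bar> < e"
    proof -
      have "t - real i / M = (t * M - real i) / M" using M(1) by (simp add: diff_divide_distrib)
      moreover have "(t * M - real i) / M \<ge> 0" "(t * M - real i) / M \<le> 1 / M"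
        using i M(1) by (auto intro!: divide_right_mono)
      ultimately have "t - real i / M \<ge> 0" "t - real i / M \<le> 1 / M" by simp_all
      then show ?thesis using M(2) by linarith
    qed
    ultimately show "\<exists>u\<in>set us. \<bar>t - u\<bar> < e" by blast
  next
    fix u assume u: "u \<in> T"
    show r: "range (($) u) \<subseteq> {0..1}" using T us01 u unfolding triangulates_def by blast
    show "u = v \<or> (\<exists>c\<in>{0..1}. \<exists>d\<in>{0..1}. chord_separated u v c d \<or> chord_separated v u c d)" if "v \<in> T" for v
      using T us01 u that unfolding triangulates_def by (meson subsetD)
    fix l assume l: "weights l"
    obtain a b where ab: "a \<in> set us" "b \<in> set us" "label_adj (lab a) (lab b)" "\<And>i. lab (u $ i) \<in> {lab a, lab b}"
      using T u unfolding triangulates_def by blast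
    have ui: "u $ i \<in> {0..1}" for i using r by blast
    have "infdist (bary f u l) X \<le> 3 * w + e1"
    proof (rule infdist_hull_labels[OF ab(3)[unfolded lab_def] refl _ refl _ ew(1,2) _ bary_in_hull[OF l]])
      show "f a \<in> X" "f b \<in> X" using ab us01 fX by auto
      show "x \<in> X \<and> slab_label X e1 w x \<in> {slab_label X e1 w (f a), slab_label X e1 w (f b)}"
        if x: "x \<in> f ` range (($) u)" for x
      proof -
        obtain i where x: "x = f (u $ i)" using x by blast
        show ?thesis unfolding x using fX[OF ui] ab(4)[of i, unfolded lab_def] by (rule conjI)
      qed
    qed
    then show "infdist (bary f u l) X \<le> e" by (simp add: ew)
  qed simp
  then show ?thesis by blast
qed

theorem null_homotopic_limit:
  fixes f :: "nat \<Rightarrow> real \<Rightarrow> real^2"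
  assumes "compact X"
    and null: "\<And>n. homotopic_paths X (f n) (linepath (f n 0) (f n 0))"
    and eqc: "\<And>e. e > 0 \<Longrightarrow> \<exists>d>0. \<forall>n. \<forall>s\<in>{0..1}. \<forall>t\<in>{0..1}. \<bar>s - t\<bar> < d \<longrightarrow> norm (f n s - f n t) < e"
    and lim: "\<And>t. t \<in> {0..1} \<Longrightarrow> (\<lambda>n. f n t) \<longlonglongrightarrow> g t"
  shows "homotopic_paths X g (linepath (g 0) (g 0))"
proof -
  have fX: "f n t \<in> X" if "t \<in> {0..1}" for n t
    using homotopic_paths_imp_subset[OF null[of n]] that by (auto simp: path_image_def)
  have loop: "f n 0 = f n 1" for n
    using homotopic_paths_imp_pathfinish[OF null[of n]] by (simp add: pathfinish_def linepath_def)
  have "\<forall>n. \<exists>U T. approx_filling X (f n) (inverse (real (Suc n))) U T"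
    using approx_filling_exists[OF null] by simp
  then obtain U T where UT: "\<And>n. approx_filling X (f n) (inverse (real (Suc n))) (U n) (T n)"
    by metis
  have "X \<noteq> {}" using fX[of 0] by auto
  obtain F where "continuous_on (convex hull (parab ` {0..1})) F" "F ` (convex hull (parab ` {0..1})) \<subseteq> X"
    "\<And>t. t \<in> {0..1} \<Longrightarrow> F (parab t) = g t" "\<And>t. t \<in> {0..1} \<Longrightarrow> F (t, t) = g 0"
    by (rule extends_of_approx_fillings[OF \<open>compact X\<close> \<open>X \<noteq> {}\<close> fX eqc lim loop UT]) blast+
  then show ?thesis by (rule homotopic_of_extends)
qed

section \<open>Level sets of a map on the square\<close>

text \<open>Continua need not be path connected, but these neighbourhoods are: they are open in a
  convex set, where connectedness implies path connectedness.\<close>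

lemma path_connected_neighbourhood:
  fixes S :: "'a::euclidean_space set"
  assumes "connected S" "S \<subseteq> H" "convex H" "r > 0"
  shows "path_connected ((\<Union>c\<in>S. ball c r) \<inter> H)"
proof -
  let ?N = "(\<Union>c\<in>S. ball c r) \<inter> H"
  have SN: "S \<subseteq> ?N" using assms(2,4) by auto
  have near: "\<exists>c\<in>S. connected_component ?N c v" if v: "v \<in> ?N" for v
  proof -
    obtain c where c: "c \<in> S" "v \<in> ball c r" "v \<in> H" using v by blast
    have "convex (ball c r \<inter> H)" using assms(3) by (simp add: convex_Int)
    then have "connected (ball c r \<inter> H)" by (rule convex_connected)
    moreover have "ball c r \<inter> H \<subseteq> ?N" using c by blast
    moreover have "c \<in> ball c r \<inter> H" using c assms by auto
    ultimately show ?thesis using c unfolding connected_component_def by blast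
  qed
  have SS: "connected_component ?N c c'" if "c \<in> S" "c' \<in> S" for c c'
    unfolding connected_component_def using assms(1) SN that by blast
  have "connected ?N"
    unfolding connected_iff_connected_component
  proof (intro ballI)
    fix v w assume "v \<in> ?N" "w \<in> ?N"
    then obtain c c' where "c \<in> S" "connected_component ?N c v" "c' \<in> S" "connected_component ?N c' w"
      using near by metis
    then show "connected_component ?N v w"
      using SS[of c c'] by (metis connected_component_sym connected_component_trans)
  qed
  moreover have "locally path_connected ?N"
  proof (rule locally_open_subset[OF convex_imp_locally_path_connected[OF assms(3)]])
    show "openin (top_of_set H) ?N"
      by (metis (no_types, lifting) Int_commute open_UN open_ball openin_open)
  qed
  ultimately show ?thesis
    by (simp add: path_connected_component connected_iff_connected_component[of ?N] path_component_eq_connected_component)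
qed

definition pt :: "real \<Rightarrow> real^2" where
  "pt t = vector [t, 0]"

lemma pt_simps [simp]: "pt t $ 1 = t" "pt t $ 2 = 0"
  by (auto simp: pt_def)

text \<open>Disjoint continua would have a positive distance \<open>d\<close>; paths in their
  neighbourhoods of radius \<open>d / 2\<close> within the half plane then contradict the crossing
  theorem \<open>fashoda_interlace\<close>.\<close>

lemma crossing_sets_meet:
  assumes C: "compact C" "connected C" and K: "compact K" "connected K"
    and up: "\<And>v. v \<in> C \<union> K \<Longrightarrow> 0 \<le> v $ 2"
    and "pt x \<in> C" "pt y \<in> C" "pt t \<in> K" "pt k \<in> K" "x < t" "t < y" "y < k"
  shows "C \<inter> K \<noteq> {}"
proof
  assume "C \<inter> K = {}"
  obtain d where d: "d > 0" "\<And>c k. c \<in> C \<Longrightarrow> k \<in> K \<Longrightarrow> d \<le> dist c k"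
    using separate_compact_closed[OF C(1) compact_imp_closed[OF K(1)] \<open>C \<inter> K = {}\<close>] by blast
  let ?H = "{v::real^2. 0 \<le> v $ 2}"
  let ?N = "\<lambda>S. (\<Union>c\<in>S. ball c (d/2)) \<inter> ?H"
  have "convex ((\<lambda>v::real^2. v $ 2) -` {0..})"
    by (intro convex_linear_vimage bounded_linear.linear bounded_linear_vec_nth) simp
  moreover have "(\<lambda>v::real^2. v $ 2) -` {0..} = ?H" by auto
  ultimately have cH: "convex ?H" by (simp only:)
  have pc: "path_connected (?N C)" "path_connected (?N K)"
    using up d(1) by (intro path_connected_neighbourhood C K cH; auto)+
  have "S \<subseteq> ?N S" if "S \<subseteq> ?H" for S
    using d(1) that by auto
  moreover have "C \<subseteq> ?H" "K \<subseteq> ?H" using up by auto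
  ultimately have "pt x \<in> ?N C" "pt y \<in> ?N C" "pt t \<in> ?N K" "pt k \<in> ?N K"
    using assms(6-9) by blast+
  then obtain f g where f: "path f" "path_image f \<subseteq> ?N C" "pathstart f = pt x" "pathfinish f = pt y"
    and g: "path g" "path_image g \<subseteq> ?N K" "pathstart g = pt t" "pathfinish g = pt k"
    using pc unfolding path_connected_def by meson
  have "bounded (path_image f \<union> path_image g)"
    using f(1) g(1) by (simp add: bounded_path_image)
  then obtain B where B: "\<And>v. v \<in> path_image f \<union> path_image g \<Longrightarrow> norm v \<le> B"
    unfolding bounded_iff by blast
  let ?a = "vector [-B, 0] :: real^2" and ?b = "vector [B, B] :: real^2"
  have sub: "v \<in> cbox ?a ?b" if "v \<in> path_image f \<union> path_image g" for v
  proof -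
    have "0 \<le> v $ 2" using that f(2) g(2) by auto
    moreover have "\<bar>v $ i\<bar> \<le> B" for i
      using component_le_norm_cart[of v i] B[OF that] by linarith
    ultimately show ?thesis
      by (simp add: mem_box_cart forall_2 abs_le_iff) (metis abs_le_iff minus_le_iff)
  qed
  obtain z where z: "z \<in> path_image f" "z \<in> path_image g"
    by (rule fashoda_interlace[OF f(1) g(1), of ?a ?b]) (use sub f g assms in auto)
  then obtain c k where "c \<in> C" "k \<in> K" "dist c z < d / 2" "dist k z < d / 2"
    using f(2) g(2) by fastforce
  then show False using d(2)[of c k] dist_triangle_half_l[of c z d k] by simp
qed

definition unit_square :: "(real^2) set" where
  "unit_square = cbox 0 1"

lemma mem_unit_square: "v \<in> unit_square \<longleftrightarrow> v $ 1 \<in> {0..1} \<and> v $ 2 \<in> {0..1}"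
  by (auto simp: unit_square_def mem_box_cart forall_2)

lemma unit_square: "compact unit_square" "convex unit_square" "closed unit_square"
  by (auto simp: unit_square_def)

text \<open>For \<open>pt x\<close> and \<open>pt y\<close> on the bottom side, this is the boundary
  of the square without the open bottom interval between them.\<close>

definition outer_arc :: "real \<Rightarrow> real \<Rightarrow> (real^2) set" where
  "outer_arc x y = {v \<in> unit_square. v $ 1 = 0 \<or> v $ 1 = 1 \<or> v $ 2 = 1 \<or> (v $ 2 = 0 \<and> (v $ 1 \<le> x \<or> y \<le> v $ 1))}"

lemma vec2_eq: "v = w \<longleftrightarrow> v $ 1 = w $ 1 \<and> v $ 2 = (w $ 2 :: real)" for v w :: "real^2"
  by (auto simp: vec_eq_iff forall_2)

lemma closed_segment_vec2:
  fixes a b :: "real^2"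
  assumes "v \<in> closed_segment a b"
  shows "v $ i \<in> closed_segment (a $ i) (b $ i)"
  using assms by (auto simp: closed_segment_def)

text \<open>\<open>crossing_sets_meet\<close> wants all four points on the axis. A point on one of
  the other sides is linked to the axis by a polygonal arc outside the square, which creates no new
  intersection with sets inside.\<close>

lemma escape_arc:
  assumes "z \<in> unit_square" "z $ 1 = 0 \<or> z $ 1 = 1 \<or> z $ 2 = 1"
  obtains L where "compact L" "connected L" "z \<in> L" "L \<inter> unit_square = {z}" "\<And>v. v \<in> L \<Longrightarrow> 0 \<le> v $ 2"
    "pt 2 \<in> L \<or> pt (-1) \<in> L"
proof -
  have z: "0 \<le> z $ 1" "z $ 1 \<le> 1" "0 \<le> z $ 2" "z $ 2 \<le> 1" using assms(1) by (auto simp: mem_unit_square)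
  have con: "compact (closed_segment a b \<union> closed_segment b c)" "connected (closed_segment a b \<union> closed_segment b c)" for a b c :: "real^2"
    by (auto intro!: compact_Un connected_Un)
  consider "z $ 1 = 1" | "z $ 1 = 0" | "z $ 2 = 1" using assms(2) by blast
  then show ?thesis
  proof cases
    case 1
    let ?m = "vector [2, z $ 2] :: real^2"
    let ?L = "closed_segment z ?m \<union> closed_segment ?m (pt 2)"
    have L: "0 \<le> v $ 2 \<and> (v $ 1 > 1 \<or> v = z)" if "v \<in> ?L" for v
      using that closed_segment_vec2[of v z ?m 1] closed_segment_vec2[of v z ?m 2]
        closed_segment_vec2[of v ?m "pt 2" 1] closed_segment_vec2[of v ?m "pt 2" 2] z 1
      by (auto simp: closed_segment_eq_real_ivl vec2_eq split: if_splits)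
    show ?thesis
    proof (rule that[of ?L])
      show "?L \<inter> unit_square = {z}" using L assms(1) by (fastforce simp: mem_unit_square)
    qed (use con L in auto)
  next
    case 2
    let ?m = "vector [-1, z $ 2] :: real^2"
    let ?L = "closed_segment z ?m \<union> closed_segment ?m (pt (-1))"
    have L: "0 \<le> v $ 2 \<and> (v $ 1 < 0 \<or> v = z)" if "v \<in> ?L" for v
      using that closed_segment_vec2[of v z ?m 1] closed_segment_vec2[of v z ?m 2]
        closed_segment_vec2[of v ?m "pt (-1)" 1] closed_segment_vec2[of v ?m "pt (-1)" 2] z 2
      by (auto simp: closed_segment_eq_real_ivl vec2_eq split: if_splits)
    show ?thesis
    proof (rule that[of ?L])
      show "?L \<inter> unit_square = {z}" using L assms(1) by (fastforce simp: mem_unit_square)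
    qed (use con L in auto)
  next
    case 3
    let ?m = "vector [z $ 1, 2] :: real^2" and ?n = "vector [2, 2] :: real^2"
    let ?L = "closed_segment z ?m \<union> (closed_segment ?m ?n \<union> closed_segment ?n (pt 2))"
    have L1: "0 \<le> v $ 2 \<and> (v $ 2 > 1 \<or> v = z)" if "v \<in> closed_segment z ?m" for v
      using closed_segment_vec2[OF that, of 1] closed_segment_vec2[OF that, of 2] z 3
      by (auto simp: closed_segment_eq_real_ivl vec2_eq split: if_splits)
    have L2: "0 \<le> v $ 2 \<and> v $ 2 > 1" if "v \<in> closed_segment ?m ?n" for v
      using closed_segment_vec2[OF that, of 2]
      by (auto simp: closed_segment_eq_real_ivl split: if_splits)
    have L3: "0 \<le> v $ 2 \<and> v $ 1 > 1" if "v \<in> closed_segment ?n (pt 2)" for v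
      using closed_segment_vec2[OF that, of 1] closed_segment_vec2[OF that, of 2]
      by (auto simp: closed_segment_eq_real_ivl split: if_splits)
    show ?thesis
    proof (rule that[of ?L])
      show "?L \<inter> unit_square = {z}" using L1 L2 L3 assms(1) by (fastforce simp: mem_unit_square)
      show "connected ?L"
        using con by (intro connected_Un) auto
    qed (use con L1 L2 L3 in \<open>auto intro!: compact_Un\<close>)
  qed
qed

text \<open>If \<open>K\<close> reached the outer arc, it could be prolonged to the axis beyond
  \<open>x\<close> or \<open>y\<close>; its ends would interlace with those of \<open>C\<close> and
  the two would meet.\<close>

lemma separates_outer_arc:
  assumes C: "compact C" "connected C" "C \<subseteq> unit_square" and K: "compact K" "connected K" "K \<subseteq> unit_square"
    and disj: "C \<inter> K = {}" and mem: "pt x \<in> C" "pt y \<in> C" "pt t \<in> K" and "x < t" "t < y"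
  shows "K \<inter> outer_arc x y = {}"
proof (rule ccontr)
  assume "K \<inter> outer_arc x y \<noteq> {}"
  then obtain z where z: "z \<in> K" "z \<in> outer_arc x y" by blast
  have up: "0 \<le> v $ 2" if "v \<in> unit_square" for v using that by (simp add: mem_unit_square)
  have xy: "0 \<le> x" "y \<le> 1" using mem C(3) by (auto simp: mem_unit_square)
  \<comment> \<open>\<open>L\<close> prolongs \<open>K\<close> to the axis point
    \<open>pt k\<close>; for \<open>k < x\<close> the two continua exchange roles in
    \<open>crossing_sets_meet\<close>.\<close>
  have *: False if L: "compact L" "connected L" "C \<inter> L = {}" "\<And>v. v \<in> L \<Longrightarrow> 0 \<le> v $ 2" "z \<in> L"
    and k: "pt k \<in> L" "k < x \<or> y < k" for L k
  proof -
    have KL: "compact (K \<union> L)" "connected (K \<union> L)"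
      using K L z(1) by (auto intro!: compact_Un connected_Un)
    have disj': "C \<inter> (K \<union> L) = {}" "(K \<union> L) \<inter> C = {}" using disj L(3) by auto
    have up': "0 \<le> v $ 2" if "v \<in> C \<union> (K \<union> L)" for v using that up C(3) K(3) L(4) by auto
    from k(2) show False
    proof
      assume "y < k"
      then show False
        using crossing_sets_meet[OF C(1,2) KL up', of x y t k] mem k(1) disj' assms(11,12) by auto
    next
      assume "k < x"
      then show False
        using crossing_sets_meet[OF KL C(1,2), of k t x y] up' mem k(1) disj' assms(11,12) by auto
    qed
  qed
  show False
  proof (cases "z $ 1 = 0 \<or> z $ 1 = 1 \<or> z $ 2 = 1")
    case True
    obtain L where L: "compact L" "connected L" "z \<in> L" "L \<inter> unit_square = {z}" "\<And>v. v \<in> L \<Longrightarrow> 0 \<le> v $ 2"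
      "pt 2 \<in> L \<or> pt (-1) \<in> L"
      using escape_arc[OF _ True] z(1) K(3) by blast
    have "v \<notin> L" if "v \<in> C" for v
    proof
      assume "v \<in> L"
      then have "v = z" using L(4) C(3) that by blast
      then show False using that z(1) disj by blast
    qed
    then have CL: "C \<inter> L = {}" by blast
    show False
      using L(6)
    proof
      assume "pt 2 \<in> L"
      then show False using xy by (intro *[OF L(1,2) CL L(5,3), of 2]) auto
    next
      assume "pt (-1) \<in> L"
      then show False using xy by (intro *[OF L(1,2) CL L(5,3), of "-1"]) auto
    qed
  next
    case False
    then have z2: "z = pt (z $ 1)" "z $ 1 \<le> x \<or> y \<le> z $ 1" using z(2) by (auto simp: outer_arc_def vec2_eq)
    have "z $ 1 \<noteq> x" "z $ 1 \<noteq> y" using z2(1) z(1) mem disj by (metis disjoint_iff)+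
    then have "z $ 1 < x \<or> y < z $ 1" using z2(2) by linarith
    then show False
      using *[of "{z}" "z $ 1"] z2(1) z(1) disj up K(3) by auto
  qed
qed

lemma path_connected_outer_arc:
  assumes "0 \<le> x" "x < y" "y \<le> 1"
  shows "path_connected (outer_arc x y)"
proof -
  let ?a = "vector [0, 1] :: real^2" and ?b = "vector [1, 1] :: real^2"
  let ?L = "closed_segment (pt x) (pt 0) \<union> (closed_segment (pt 0) ?a \<union> (closed_segment ?a ?b \<union>
    (closed_segment ?b (pt 1) \<union> closed_segment (pt 1) (pt y))))"
  have seg: "v \<in> closed_segment a b" if "v $ 1 = a $ 1" "a $ 1 = b $ 1" "v $ 2 \<in> closed_segment (a $ 2) (b $ 2)" for v a b :: "real^2"
    using that by (auto simp: closed_segment_def vec2_eq algebra_simps)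
  have seg': "v \<in> closed_segment a b" if "v $ 2 = a $ 2" "a $ 2 = b $ 2" "v $ 1 \<in> closed_segment (a $ 1) (b $ 1)" for v a b :: "real^2"
    using that by (auto simp: closed_segment_def vec2_eq algebra_simps)
  have "outer_arc x y \<subseteq> ?L"
  proof
    fix v assume "v \<in> outer_arc x y"
    then have v: "0 \<le> v $ 1" "v $ 1 \<le> 1" "0 \<le> v $ 2" "v $ 2 \<le> 1"
      "v $ 1 = 0 \<or> v $ 1 = 1 \<or> v $ 2 = 1 \<or> (v $ 2 = 0 \<and> (v $ 1 \<le> x \<or> y \<le> v $ 1))"
      by (auto simp: outer_arc_def mem_unit_square)
    from v(5) consider "v $ 1 = 0" | "v $ 1 = 1" | "v $ 2 = 1" | "v $ 2 = 0" "v $ 1 \<le> x" | "v $ 2 = 0" "y \<le> v $ 1" by blast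
    then show "v \<in> ?L"
    proof cases
      case 1
      then have "v \<in> closed_segment (pt 0) ?a" using v by (intro seg) (auto simp: closed_segment_eq_real_ivl)
      then show ?thesis by blast
    next
      case 2
      then have "v \<in> closed_segment ?b (pt 1)" using v by (intro seg) (auto simp: closed_segment_eq_real_ivl)
      then show ?thesis by blast
    next
      case 3
      then have "v \<in> closed_segment ?a ?b" using v by (intro seg') (auto simp: closed_segment_eq_real_ivl)
      then show ?thesis by blast
    next
      case 4
      then have "v \<in> closed_segment (pt x) (pt 0)" using v by (intro seg') (auto simp: closed_segment_eq_real_ivl)
      then show ?thesis by blast
    next
      case 5
      then have "v \<in> closed_segment (pt 1) (pt y)" using v by (intro seg') (auto simp: closed_segment_eq_real_ivl)
      then show ?thesis by blast
    qed
  qed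
  moreover have both: "v $ 1 \<in> closed_segment (a $ 1) (b $ 1) \<and> v $ 2 \<in> closed_segment (a $ 2) (b $ 2)"
    if "v \<in> closed_segment a b" for v a b :: "real^2"
    using closed_segment_vec2[OF that] by blast
  have "?L \<subseteq> outer_arc x y"
  proof
    fix v assume "v \<in> ?L"
    then consider "v \<in> closed_segment (pt x) (pt 0)" | "v \<in> closed_segment (pt 0) ?a" | "v \<in> closed_segment ?a ?b"
      | "v \<in> closed_segment ?b (pt 1)" | "v \<in> closed_segment (pt 1) (pt y)" by blast
    then show "v \<in> outer_arc x y"
      by cases (use assms in \<open>auto dest!: both simp: outer_arc_def mem_unit_square closed_segment_eq_real_ivl split: if_splits\<close>)
  qed
  moreover have "path_connected ?L"
    by (intro path_connected_Un convex_imp_path_connected convex_closed_segment) auto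
  ultimately show ?thesis by (metis subset_antisym)
qed

lemma pt_mem_unit_square: "t \<in> {0..1} \<Longrightarrow> pt t \<in> unit_square"
  by (auto simp: mem_unit_square)

lemma continuous_on_pt [continuous_intros]: "continuous_on S f \<Longrightarrow> continuous_on S (\<lambda>x. pt (f x))"
proof -
  assume f: "continuous_on S f"
  have "continuous_on S (\<lambda>x. if i = 1 then f x else 0)" for i :: 2
    using f by (cases "i = 1") auto
  then have "continuous_on S (\<lambda>x. \<chi> i. if i = (1::2) then f x else 0)"
    by (rule continuous_on_vec_lambda)
  also have "(\<lambda>x. \<chi> i. if i = (1::2) then f x else 0) = (\<lambda>x. pt (f x))"
    by (auto simp: vec2_eq)
  finally show ?thesis .
qed

text \<open>The relative frontier of a component of the complement of a connected set is connected,
  by unicoherence of the square; here it lies in a level set of \<open>f\<close>.\<close>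
lemma level_continuum:
  fixes f :: "real^2 \<Rightarrow> real"
  assumes f: "continuous_on unit_square f" and xy: "0 \<le> x" "x < y" "y \<le> 1"
    and c: "f (pt x) < c \<and> c < f (pt y) \<or> f (pt y) < c \<and> c < f (pt x)"
  obtains G where "compact G" "connected G" "G \<subseteq> unit_square" "\<And>v. v \<in> G \<Longrightarrow> f v = c"
    "\<exists>i\<in>{x..y}. pt i \<in> G" "G \<inter> outer_arc x y \<noteq> {}"
proof -
  have *: "\<exists>G. compact G \<and> connected G \<and> G \<subseteq> unit_square \<and> (\<forall>v\<in>G. f v = c) \<and>
      (\<exists>i\<in>{x..y}. pt i \<in> G) \<and> G \<inter> outer_arc x y \<noteq> {}"
    if f: "continuous_on unit_square f" and c: "f (pt x) < c" "c < f (pt y)" for f :: "real^2 \<Rightarrow> real" and c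
  proof -
    let ?Q = unit_square
    have pxy: "pt x \<in> ?Q" "pt y \<in> ?Q" using xy by (auto simp: mem_unit_square)
    define U where "U = {v \<in> ?Q. f v < c}"
    have opU: "openin (top_of_set ?Q) U"
    proof -
      have "U = ?Q \<inter> f -` {..<c}" by (auto simp: U_def)
      then show ?thesis using continuous_openin_preimage_gen[OF f, of "{..<c}"] by simp
    qed
    define V where "V = connected_component_set U (pt x)"
    have VU: "V \<subseteq> U" unfolding V_def by (rule connected_component_subset)
    have xV: "pt x \<in> V" using c pxy by (auto simp: V_def U_def connected_component_refl_eq)
    have conV: "connected V" by (simp add: V_def)
    have opV: "openin (top_of_set ?Q) V"
      unfolding V_def using convex_imp_locally_connected[OF unit_square(2)] opU
      by (rule locally_connected_2) (use c pxy in \<open>auto simp: U_def\<close>)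
    \<comment> \<open>\<open>W\<close> is the far side of \<open>V\<close>. Its complement in the
      square stays connected, so \<open>W\<close> and the closure of that complement are the two
      pieces for unicoherence.\<close>
    define W where "W = connected_component_set (?Q - V) (pt y)"
    have yQV: "pt y \<in> ?Q - V" using VU c pxy by (auto simp: U_def)
    then have yW: "pt y \<in> W" by (simp add: W_def)
    have WQV: "W \<subseteq> ?Q - V" unfolding W_def by (rule connected_component_subset)
    have conW: "connected W" by (simp add: W_def)
    have "closedin (top_of_set ?Q) (?Q - V)" using opV by (simp add: closedin_diff)
    then have "closedin (top_of_set ?Q) W"
      unfolding W_def using closedin_connected_component closedin_trans by blast
    then have clW: "closed W" using unit_square(3) closedin_closed_trans by blast
    have conQW: "connected (?Q - W)"
      by (rule component_diff_connected[OF conV convex_connected[OF unit_square(2)]])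
        (use VU yQV in \<open>auto simp: W_def U_def intro!: componentsI\<close>)
    define B where "B = closure (?Q - W)"
    have BQ: "B \<subseteq> ?Q" unfolding B_def by (intro closure_minimal) (auto simp: unit_square)
    have WB: "W \<union> B = ?Q" using BQ WQV closure_subset[of "?Q - W"] by (auto simp: B_def)
    define G where "G = W \<inter> B"
    have clB: "closed B" by (simp add: B_def)
    have "connected G"
      using convex_imp_unicoherent[OF unit_square(2)] conW connected_imp_connected_closure[OF conQW] WB
      unfolding unicoherent_def G_def B_def[symmetric]
      using clW clB by (metis Un_upper1 Un_upper2 closed_subset)
    moreover have GQ: "G \<subseteq> ?Q" using WQV by (auto simp: G_def)
    moreover have "compact G"
      using clW clB GQ unit_square(1) by (metis G_def closed_Int compact_Int_closed inf.absorb_iff2)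
    \<comment> \<open>Off the level, a small convex neighbourhood of \<open>v\<close> lies on one
      side of it and misses \<open>V\<close>; being connected it lies in \<open>W\<close>, although
      \<open>v\<close> is in the closure of \<open>?Q - W\<close>.\<close>
    moreover have "f v = c" if v: "v \<in> G" for v
    proof (rule ccontr)
      assume "f v \<noteq> c"
      have vQ: "v \<in> ?Q" using v GQ by blast
      then obtain r where r: "r > 0" "\<And>w. w \<in> ?Q \<Longrightarrow> dist w v < r \<Longrightarrow> dist (f w) (f v) < \<bar>f v - c\<bar>"
        using f \<open>f v \<noteq> c\<close> unfolding continuous_on_iff by (metis zero_less_abs_iff right_minus_eq)
      define N where "N = ball v r \<inter> ?Q"
      have conN: "connected N"
        unfolding N_def by (intro convex_connected convex_Int convex_ball unit_square)
      have vN: "v \<in> N" using r vQ by (auto simp: N_def)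
      have side: "(f w < c) = (f v < c)" if "w \<in> N" for w
        using r(2)[of w] that by (auto simp: N_def dist_commute dist_real_def abs_if split: if_splits)
      have vV: "v \<notin> V" using v WQV by (auto simp: G_def)
      have NV: "N \<inter> V = {}"
      proof (cases "f v < c")
        case True
        then have "N \<subseteq> U" using side by (auto simp: U_def N_def)
        show ?thesis
        proof (rule ccontr)
          assume "N \<inter> V \<noteq> {}"
          then obtain w where w: "w \<in> N" "connected_component U (pt x) w" by (auto simp: V_def)
          have "connected_component U w v"
            unfolding connected_component_def using conN \<open>N \<subseteq> U\<close> w(1) vN by blast
          then have "v \<in> V" using w(2) connected_component_trans by (auto simp: V_def)
          then show False using vV by simp
        qed
      next
        case False
        then show ?thesis using side VU by (auto simp: U_def)
      qed
      then have "N \<subseteq> ?Q - V" by (auto simp: N_def)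
      then have "N \<subseteq> connected_component_set (?Q - V) v"
        by (rule connected_component_maximal[OF vN conN])
      also have "\<dots> = W"
        using v connected_component_eq[of v "?Q - V" "pt y"] by (simp add: G_def W_def)
      finally have "N \<subseteq> W" .
      have "v \<in> closure (?Q - W)" using v by (simp add: G_def B_def)
      then obtain w where "w \<in> ?Q - W" "dist w v < r" using r(1) closure_approachable by blast
      then show False using \<open>N \<subseteq> W\<close> by (auto simp: N_def dist_commute)
    qed
    \<comment> \<open>\<open>W\<close> and \<open>B\<close> are closed and cover the square, so a
      connected set containing \<open>pt x\<close> in \<open>B\<close> and \<open>pt y\<close> in
      \<open>W\<close> meets their intersection.\<close>
    moreover have meet: "A \<inter> G \<noteq> {}" if "connected A" "A \<subseteq> ?Q" "pt x \<in> A" "pt y \<in> A" for A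
    proof
      assume "A \<inter> G = {}"
      then have "W \<inter> B \<inter> A = {}" by (auto simp: G_def)
      moreover have "pt x \<notin> W" using xV WQV by blast
      then have "pt x \<in> B" using WB pxy by blast
      then have "B \<inter> A \<noteq> {}" using that(3) by blast
      moreover have "W \<inter> A \<noteq> {}" using that(4) yW by blast
      moreover have "A \<subseteq> W \<union> B" using that(2) WB by simp
      ultimately show False
        using connected_closedD[OF that(1), of W B] clW clB by blast
    qed
    moreover have "\<exists>i\<in>{x..y}. pt i \<in> G"
    proof -
      have "connected (pt ` {x..y})" by (intro connected_continuous_image continuous_intros) auto
      then have "pt ` {x..y} \<inter> G \<noteq> {}"
        using xy by (intro meet) (auto intro!: pt_mem_unit_square)
      then show ?thesis by blast
    qed
    moreover have "G \<inter> outer_arc x y \<noteq> {}"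
    proof -
      have "outer_arc x y \<subseteq> ?Q" by (auto simp: outer_arc_def)
      moreover have "pt x \<in> outer_arc x y" "pt y \<in> outer_arc x y" using xy by (auto simp: outer_arc_def mem_unit_square)
      ultimately show ?thesis
        using meet[OF path_connected_imp_connected[OF path_connected_outer_arc[OF xy]]] by (metis Int_commute)
    qed
    ultimately show ?thesis by blast
  qed
  show thesis
  proof (cases "f (pt x) < c")
    case True
    with c have "f (pt x) < c" "c < f (pt y)" by auto
    from *[OF f this] show ?thesis using that by blast
  next
    case False
    then have "- f (pt x) < - c" "- c < - f (pt y)" using c by auto
    moreover have "continuous_on unit_square (\<lambda>v. - f v)" using f by (rule continuous_on_minus)
    ultimately obtain G where "compact G" "connected G" "G \<subseteq> unit_square" "\<forall>v\<in>G. - f v = - c"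
      "\<exists>i\<in>{x..y}. pt i \<in> G" "G \<inter> outer_arc x y \<noteq> {}"
      using *[of "\<lambda>v. - f v" "- c"] by blast
    then show ?thesis by (intro that[of G]) auto
  qed
qed

section \<open>Straightening between two points of a level continuum\<close>

lemma collinear_line:
  fixes a :: "real^2"
  assumes "a \<noteq> 0" and S: "\<And>v. v \<in> S \<Longrightarrow> a \<bullet> v = c"
  shows "collinear S"
  unfolding collinear_def
proof (intro exI ballI)
  let ?u = "vector [- a $ 2, a $ 1] :: real^2"
  fix v w assume "v \<in> S" "w \<in> S"
  then have "a \<bullet> (v - w) = 0" using S by (simp add: inner_diff_right)
  then have o: "a $ 1 * (v - w) $ 1 + a $ 2 * (v - w) $ 2 = 0" by (simp add: inner_vec_def sum_2)
  define n where "n = (a $ 1)\<^sup>2 + (a $ 2)\<^sup>2"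
  have n: "n \<noteq> 0" using assms(1) by (auto simp: n_def vec2_eq sum_power2_eq_zero_iff)
  define k where "k = a $ 1 * (v - w) $ 2 - a $ 2 * (v - w) $ 1"
  have "n * (v - w) $ 1 = - (k * a $ 2) + a $ 1 * (a $ 1 * (v - w) $ 1 + a $ 2 * (v - w) $ 2)"
    "n * (v - w) $ 2 = k * a $ 1 + a $ 2 * (a $ 1 * (v - w) $ 1 + a $ 2 * (v - w) $ 2)"
    by (simp_all add: n_def k_def power2_eq_square algebra_simps)
  then have "n * (v - w) $ 1 = - (k * a $ 2)" "n * (v - w) $ 2 = k * a $ 1" by (simp_all only: o)
  then show "v - w = (k / n) *\<^sub>R ?u"
    using n by (simp add: vec2_eq field_simps)
qed

text \<open>The image of \<open>C\<close> under \<open>H\<close> is a connected part of a line,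
  hence a convex set inside \<open>X\<close>. Only the part \<open>V\<close> of the square that
  \<open>C\<close> cuts off from the outer arc is kept; elsewhere \<open>H\<close> is replaced by an
  extension with values in that convex set. The new map deforms the bottom path into a path inside
  it, which is homotopic there to the segment.\<close>

lemma level_excursion_homotopic:
  fixes H :: "real^2 \<Rightarrow> real^2"
  assumes H: "continuous_on unit_square H" "H ` unit_square \<subseteq> X"
    and C: "compact C" "connected C" "C \<subseteq> unit_square" "pt x \<in> C" "pt y \<in> C" and "x < y"
    and "a \<noteq> 0" and level: "\<And>v. v \<in> C \<Longrightarrow> a \<bullet> H v = c"
  shows "homotopic_paths X (\<lambda>s. H (pt ((1 - s) * x + s * y))) (linepath (H (pt x)) (H (pt y)))"
proof -
  let ?Q = unit_square
  have xy: "0 \<le> x" "y \<le> 1" using C by (auto simp: mem_unit_square)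
  define D where "D = ?Q - C"
  have opD: "openin (top_of_set ?Q) D"
    unfolding D_def using C compact_imp_closed by (metis closed_subset closedin_diff closedin_self openin_diff openin_subtopology_self)
  have lpc: "locally path_connected D"
    using locally_open_subset[OF convex_imp_locally_path_connected[OF unit_square(2)] opD] .
  have opc: "openin (top_of_set ?Q) (connected_component_set D v)" if "v \<in> D" for v
    using locally_connected_2[OF convex_imp_locally_connected[OF unit_square(2)] opD that] .
  \<comment> \<open>The components of the complement of \<open>C\<close> that contain points of the
    open bottom interval; \<open>separates_outer_arc\<close> keeps them off the outer arc.\<close>
  define V where "V = (\<Union>t\<in>{t. x < t \<and> t < y \<and> pt t \<in> D}. connected_component_set D (pt t))"
  have VD: "V \<subseteq> D" unfolding V_def using connected_component_subset by fastforce
  have opV: "openin (top_of_set ?Q) V" unfolding V_def by (intro openin_Union) (auto intro: opc)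
  \<comment> \<open>The rest of \<open>D\<close> is also a union of components, thus relatively
    open, which makes \<open>V \<union> C\<close> closed.\<close>
  have "D - V = (\<Union>z\<in>D - V. connected_component_set D z)"
  proof
    show "(\<Union>z\<in>D - V. connected_component_set D z) \<subseteq> D - V"
    proof clarify
      fix z w assume z: "z \<in> D" "z \<notin> V" "connected_component D z w"
      have "w \<notin> V"
      proof
        assume "w \<in> V"
        then obtain t where t: "x < t" "t < y" "pt t \<in> D" "connected_component D (pt t) w" by (auto simp: V_def)
        then have "connected_component D (pt t) z"
          using z(3) connected_component_sym connected_component_trans by metis
        then show False using t z(2) by (auto simp: V_def)
      qed
      then show "w \<in> D - V" using connected_component_in[OF z(3)] by blast
    qed
  qed (auto simp: connected_component_refl_eq)
  moreover have "openin (top_of_set ?Q) (\<Union>z\<in>D - V. connected_component_set D z)"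
    by (intro openin_Union) (auto intro: opc)
  ultimately have "openin (top_of_set ?Q) (D - V)" by simp
  then have "closedin (top_of_set ?Q) (?Q - (D - V))" by (simp add: closedin_diff)
  moreover have "?Q - (D - V) = V \<union> C" using VD C(3) by (auto simp: D_def)
  ultimately have clVC: "closed (V \<union> C)" using unit_square(3) closedin_closed_trans by metis
  have "closedin (top_of_set ?Q) (?Q - V)" using opV by (simp add: closedin_diff)
  then have clQV: "closed (?Q - V)" using unit_square(3) closedin_closed_trans by metis
  have out: "V \<inter> outer_arc x y = {}"
  proof (rule ccontr)
    assume "V \<inter> outer_arc x y \<noteq> {}"
    then obtain z where z: "z \<in> V" "z \<in> outer_arc x y" by blast
    then obtain t where t: "x < t" "t < y" "pt t \<in> D" "connected_component D (pt t) z"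
      unfolding V_def by blast
    then have "path_component D (pt t) z"
      using path_component_eq_connected_component[OF lpc] by simp
    then obtain g where g: "path g" "path_image g \<subseteq> D" "pathstart g = pt t" "pathfinish g = z"
      unfolding path_component_def by blast
    have "path_image g \<inter> outer_arc x y = {}"
    proof (rule separates_outer_arc[OF C(1-3) _ _ _ _ C(4,5) _ t(1,2)])
      show "pt t \<in> path_image g" using g(3) pathstart_in_path_image by metis
    qed (use g in \<open>auto simp: D_def compact_path_image connected_path_image\<close>)
    then show False using z g(4) pathfinish_in_path_image by blast
  qed
  define S where "S = H ` C"
  have SX: "S \<subseteq> X" using H(2) C(3) by (auto simp: S_def)
  have cHC: "continuous_on C H" using H(1) C(3) by (rule continuous_on_subset)
  have "connected S" unfolding S_def using cHC C(2) by (rule connected_continuous_image)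
  moreover have "collinear S" using \<open>a \<noteq> 0\<close> level by (intro collinear_line[of a _ c]) (auto simp: S_def)
  ultimately have "convex S" by (simp add: convex_connected_collinear)
  have "S \<noteq> {}" using C(4) by (auto simp: S_def)
  \<comment> \<open>Dugundji extension keeps the values in the convex set \<open>S\<close>, thus in
    \<open>X\<close>.\<close>
  obtain e where e: "continuous_on ?Q e" "e ` ?Q \<subseteq> S" "\<And>v. v \<in> C \<Longrightarrow> e v = H v"
  proof (rule Dugundji[OF \<open>convex S\<close> \<open>S \<noteq> {}\<close> _ cHC])
    show "closedin (top_of_set ?Q) C" using C compact_imp_closed closed_subset by blast
  qed (auto simp: S_def)
  define H' where "H' v = (if v \<in> V then H v else e v)" for v
  have "continuous_on ((V \<union> C) \<union> (?Q - V)) H'"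
    unfolding H'_def
  proof (rule continuous_on_cases[OF clVC clQV])
    show "continuous_on (V \<union> C) H" using H(1) VD C(3) by (elim continuous_on_subset) (auto simp: D_def)
    show "continuous_on (?Q - V) e" using e(1) by (rule continuous_on_subset) auto
  qed (use e(3) in auto)
  moreover have "(V \<union> C) \<union> (?Q - V) = ?Q" using VD C(3) by (auto simp: D_def)
  ultimately have H': "continuous_on ?Q H'" by simp
  have H'X: "H' ` ?Q \<subseteq> X"
    using H(2) e(2) SX by (auto simp: H'_def)
  define b where "b s = pt ((1 - s) * x + s * y)" for s
  have pb: "path b" unfolding path_def b_def by (intro continuous_intros)
  have xs: "x \<le> (1 - s) * x + s * y \<and> (1 - s) * x + s * y \<le> y" if "s \<in> {0..1}" for s
  proof -
    have "(1 - s) * x + s * y = x + s * (y - x)" "(1 - s) * x + s * y = y - (1 - s) * (y - x)"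
      by (simp_all add: algebra_simps)
    moreover have "s * (y - x) \<ge> 0" "(1 - s) * (y - x) \<ge> 0" using that \<open>x < y\<close> by auto
    ultimately show ?thesis by linarith
  qed
  have bQ: "b s \<in> ?Q" if "s \<in> {0..1}" for s
    unfolding b_def using xs[OF that] xy by (intro pt_mem_unit_square) auto
  have "pt x \<in> outer_arc x y" "pt y \<in> outer_arc x y" using xy \<open>x < y\<close> by (auto simp: outer_arc_def mem_unit_square)
  then obtain q where q: "path q" "path_image q \<subseteq> outer_arc x y" "pathstart q = pt x" "pathfinish q = pt y"
    using path_connected_outer_arc[OF xy(1) \<open>x < y\<close> xy(2)] unfolding path_connected_def by meson
  have qo: "q s \<in> outer_arc x y" if "s \<in> {0..1}" for s using q(2) that by (auto simp: path_image_def)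
  have qQ: "q s \<in> ?Q" if "s \<in> {0..1}" for s using qo[OF that] by (auto simp: outer_arc_def)
  have "homotopic_paths ?Q b q"
  proof (rule homotopic_paths_linear[OF pb q(1)])
    show "closed_segment (b t) (q t) \<subseteq> ?Q" if "t \<in> {0..1}" for t
      using bQ[OF that] qQ[OF that] unit_square(2) by (rule closed_segment_subset)
  qed (use q in \<open>auto simp: pathstart_def pathfinish_def b_def\<close>)
  then have 1: "homotopic_paths X (H' \<circ> b) (H' \<circ> q)"
    by (rule homotopic_paths_continuous_image[OF _ H']) (use H'X in auto)
  have pH: "path (H' \<circ> b)" "path_image (H' \<circ> b) \<subseteq> X" "path (H' \<circ> q)"
    using homotopic_paths_imp_path[OF 1] homotopic_paths_imp_subset[OF 1] by auto
  have H'C: "H' v = H v" if "v \<in> V \<union> C" for v using that e(3) by (auto simp: H'_def)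
  have 2: "homotopic_paths X (H' \<circ> b) (\<lambda>s. H (b s))"
  proof (rule homotopic_paths_eq[OF pH(1,2)])
    fix s :: real assume s: "s \<in> {0..1}"
    have "b s \<in> V \<union> C"
    proof (cases "b s \<in> C")
      case False
      then have bD: "b s \<in> D" using bQ[OF s] by (simp add: D_def)
      define t where "t = (1 - s) * x + s * y"
      have bt: "b s = pt t" by (simp add: b_def t_def)
      have "t \<noteq> x" "t \<noteq> y" using False C(4,5) bt by auto
      then have "x < t" "t < y" using xs[OF s] by (auto simp: t_def)
      then show ?thesis using bD bt by (auto simp: V_def connected_component_refl_eq)
    qed simp
    then show "(H' \<circ> b) s = H (b s)" using H'C by simp
  qed
  have He: "H' (q s) = e (q s)" if "s \<in> {0..1}" for s
    using out qo[OF that] by (auto simp: H'_def)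
  have ends: "H' (pt x) = H (pt x)" "H' (pt y) = H (pt y)" using H'C C(4,5) by auto
  have "homotopic_paths S (H' \<circ> q) (linepath (H (pt x)) (H (pt y)))"
  proof (rule homotopic_paths_linear[OF pH(3)])
    show "closed_segment ((H' \<circ> q) t) (linepath (H (pt x)) (H (pt y)) t) \<subseteq> S" if t: "t \<in> {0..1}" for t
    proof (rule closed_segment_subset[OF _ _ \<open>convex S\<close>])
      show "(H' \<circ> q) t \<in> S" using He[OF t] e(2) qQ[OF t] by auto
      have "linepath (H (pt x)) (H (pt y)) t \<in> closed_segment (H (pt x)) (H (pt y))"
        using t linepath_in_path by blast
      also have "\<dots> \<subseteq> S" using C(4,5) \<open>convex S\<close> by (intro closed_segment_subset) (auto simp: S_def)
      finally show "linepath (H (pt x)) (H (pt y)) t \<in> S" .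
    qed
  qed (use q ends in \<open>auto simp: pathstart_def pathfinish_def linepath_0' linepath_1'\<close>)
  then have "homotopic_paths X (H' \<circ> q) (linepath (H (pt x)) (H (pt y)))"
    using SX by (rule homotopic_paths_subset)
  then show ?thesis using 1 2 unfolding b_def by (meson homotopic_paths_sym homotopic_paths_trans)
qed

section \<open>Straightening a path along a line\<close>

text \<open>The time change may depend on the direction \<open>a\<close> and may jump. Oscillations,
  and excursions from a line, see one direction at a time, so they cannot be larger for
  \<open>q\<close> than for \<open>r\<close>.\<close>

definition dominated :: "(real \<Rightarrow> 'a::real_inner) \<Rightarrow> (real \<Rightarrow> 'a) \<Rightarrow> bool" where
  "dominated q r \<longleftrightarrow> (\<forall>a. \<exists>\<sigma>. mono_on {0..1} \<sigma> \<and> (\<forall>t\<in>{0..1}. \<sigma> t \<in> {0..1} \<and> a \<bullet> q t = a \<bullet> r (\<sigma> t)))"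

lemma dominated_refl: "dominated r r"
  unfolding dominated_def by (intro allI exI[of _ id]) (auto simp: mono_on_def)

lemma dominated_trans:
  assumes "dominated p q" "dominated q r" shows "dominated p r"
  unfolding dominated_def
proof
  fix a
  obtain \<sigma> where \<sigma>: "mono_on {0..1} \<sigma>" "\<And>t. t \<in> {0..1} \<Longrightarrow> \<sigma> t \<in> {0..1} \<and> a \<bullet> p t = a \<bullet> q (\<sigma> t)"
    using assms(1) unfolding dominated_def by meson
  obtain \<tau> where \<tau>: "mono_on {0..1} \<tau>" "\<And>t. t \<in> {0..1} \<Longrightarrow> \<tau> t \<in> {0..1} \<and> a \<bullet> q t = a \<bullet> r (\<tau> t)"
    using assms(2) unfolding dominated_def by meson
  show "\<exists>\<sigma>. mono_on {0..1} \<sigma> \<and> (\<forall>t\<in>{0..1}. \<sigma> t \<in> {0..1} \<and> a \<bullet> p t = a \<bullet> r (\<sigma> t))"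
  proof (intro exI[of _ "\<tau> \<circ> \<sigma>"] conjI ballI)
    show "mono_on {0..1} (\<tau> \<circ> \<sigma>)"
      using \<sigma> \<tau>(1) unfolding mono_on_def by (auto simp del: atLeastAtMost_iff)
    show "(\<tau> \<circ> \<sigma>) t \<in> {0..1}" "a \<bullet> p t = a \<bullet> r ((\<tau> \<circ> \<sigma>) t)" if "t \<in> {0..1}" for t
      using \<sigma>(2)[OF that] \<tau>(2)[of "\<sigma> t"] by auto
  qed
qed

text \<open>\<open>\<tau> w\<close> is the first time at which \<open>f\<close> is at least
  \<open>w\<close>; it is monotone in \<open>w\<close>, even where it jumps.\<close>

lemma first_hit:
  fixes f :: "real \<Rightarrow> real"
  assumes f: "continuous_on {x..y} f" and "x \<le> y" "f x \<le> f y"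
  obtains \<tau> where "mono_on {f x..f y} \<tau>" "\<And>w. w \<in> {f x..f y} \<Longrightarrow> \<tau> w \<in> {x..y} \<and> f (\<tau> w) = w"
proof -
  define A where "A w = {u \<in> {x..y}. w \<le> f u}" for w
  have A: "A w \<noteq> {}" "bdd_below (A w)" "closed (A w)" if "w \<in> {f x..f y}" for w
  proof -
    show "A w \<noteq> {}" using that assms(2) by (auto simp: A_def)
    show "bdd_below (A w)" by (rule bdd_belowI[of _ x]) (auto simp: A_def)
    have "A w = {x..y} \<inter> f -` {w..}" by (auto simp: A_def)
    then show "closed (A w)" using continuous_on_closed_vimage[of "{x..y}" f] f by (metis Int_commute closed_atLeast closed_real_atLeastAtMost)
  qed
  define \<tau> where "\<tau> w = Inf (A w)" for w
  have \<tau>A: "\<tau> w \<in> A w" if "w \<in> {f x..f y}" for w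
    unfolding \<tau>_def using closed_contains_Inf[OF A[OF that]] .
  show thesis
  proof (rule that[of \<tau>])
    show "mono_on {f x..f y} \<tau>"
    proof (rule mono_onI)
      fix v w assume vw: "v \<in> {f x..f y}" "w \<in> {f x..f y}" "v \<le> w"
      have "A w \<subseteq> A v" using vw(3) by (auto simp: A_def)
      then show "\<tau> v \<le> \<tau> w" unfolding \<tau>_def using A[OF vw(1)] A[OF vw(2)] by (intro cInf_superset_mono)
    qed
    fix w assume w: "w \<in> {f x..f y}"
    have t: "\<tau> w \<in> {x..y}" "w \<le> f (\<tau> w)" using \<tau>A[OF w] by (auto simp: A_def)
    obtain u where u: "x \<le> u" "u \<le> \<tau> w" "f u = w"
      using IVT'[of f x w "\<tau> w"] t w continuous_on_subset[OF f, of "{x..\<tau> w}"] by auto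
    then have "u \<in> A w" using t by (auto simp: A_def)
    then have "\<tau> w \<le> u" unfolding \<tau>_def using A(2)[OF w] by (rule cInf_lower)
    then show "\<tau> w \<in> {x..y} \<and> f (\<tau> w) = w" using u t by auto
  qed
qed

definition straighten :: "(real \<Rightarrow> 'a::real_normed_vector) \<Rightarrow> real \<Rightarrow> real \<Rightarrow> real \<Rightarrow> 'a" where
  "straighten r x y t = (if x \<le> t \<and> t \<le> y then linepath (r x) (r y) ((t - x) / (y - x)) else r t)"

lemma straighten_ends: "x < y \<Longrightarrow> straighten r x y x = r x" "x < y \<Longrightarrow> straighten r x y y = r y"
  by (auto simp: straighten_def linepath_def)

lemma straighten_path:
  fixes r :: "real \<Rightarrow> 'a::real_normed_vector"
  assumes "path r" "0 \<le> x" "x < y" "y \<le> 1"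
  shows "path (straighten r x y)"
proof -
  have r: "continuous_on {0..1} r" using assms(1) by (simp add: path_def)
  have "continuous_on ({x..y} \<union> ({0..x} \<union> {y..1})) (straighten r x y)"
    unfolding straighten_def
  proof (rule continuous_on_cases)
    show "continuous_on {x..y} (\<lambda>t. linepath (r x) (r y) ((t - x) / (y - x)))"
      unfolding linepath_def by (intro continuous_intros) (use assms in auto)
    show "continuous_on ({0..x} \<union> {y..1}) r" using r by (rule continuous_on_subset) (use assms in auto)
    show "\<forall>t. t \<in> {x..y} \<and> \<not> (x \<le> t \<and> t \<le> y) \<or> t \<in> {0..x} \<union> {y..1} \<and> x \<le> t \<and> t \<le> y \<longrightarrow>
        linepath (r x) (r y) ((t - x) / (y - x)) = r t"
      using assms(3) by (auto simp: linepath_def)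
  qed auto
  moreover have "{x..y} \<union> ({0..x} \<union> {y..1}) = {0..1}" using assms by auto
  ultimately show ?thesis by (simp add: path_def)
qed

lemma straighten_homotopic:
  fixes r :: "real \<Rightarrow> 'a::real_normed_vector"
  assumes r: "path r" "path_image r \<subseteq> X" and xy: "0 \<le> x" "x < y" "y \<le> 1"
    and hom: "homotopic_paths X (subpath x y r) (linepath (r x) (r y))"
  shows "homotopic_paths X r (straighten r x y)"
proof -
  let ?q = "straighten r x y"
  have q: "path ?q" using straighten_path[OF r(1) xy] .
  have lin: "path_image (linepath (r x) (r y)) \<subseteq> X" using homotopic_paths_imp_subset[OF hom] by simp
  have rX: "r t \<in> X" if "t \<in> {0..1}" for t using r(2) that by (auto simp: path_image_def)
  have qX: "path_image ?q \<subseteq> X"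
  proof -
    have "?q t \<in> X" if "t \<in> {0..1}" for t
    proof (cases "x \<le> t \<and> t \<le> y")
      case True
      then have "(t - x) / (y - x) \<in> {0..1}" using xy by (auto simp: divide_simps)
      then have "linepath (r x) (r y) ((t - x) / (y - x)) \<in> X" using lin unfolding path_image_def by blast
      then show ?thesis using True by (simp add: straighten_def)
    next
      case False
      then show ?thesis using rX[OF that] by (auto simp: straighten_def)
    qed
    then show ?thesis by (auto simp: path_image_def)
  qed
  have join: "homotopic_paths X (subpath 0 x g +++ (subpath x y g +++ subpath y 1 g)) g"
    if g: "path g" "path_image g \<subseteq> X" for g :: "real \<Rightarrow> 'a"
  proof -
    have s: "path (subpath 0 x g)" "path_image (subpath 0 x g) \<subseteq> X"
      using g xy path_image_subpath_subset[of 0 x g] by (auto simp: path_subpath)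
    have 1: "homotopic_paths X (subpath x y g +++ subpath y 1 g) (subpath x 1 g)"
      using g xy by (intro homotopic_join_subpaths) auto
    have 2: "homotopic_paths X (subpath 0 x g +++ subpath x 1 g) (subpath 0 1 g)"
      using g xy by (intro homotopic_join_subpaths) auto
    have "homotopic_paths X (subpath 0 x g +++ (subpath x y g +++ subpath y 1 g)) (subpath 0 x g +++ subpath x 1 g)"
      using s 1 by (intro homotopic_paths_join) auto
    then show ?thesis using 2 by (simp add: homotopic_paths_trans)
  qed
  have sub: "path (subpath u v r)" "path_image (subpath u v r) \<subseteq> X" if "u \<in> {0..1}" "v \<in> {0..1}" for u v
    using that r path_image_subpath_subset[of u v r] by (auto simp: path_subpath)
  have s1: "homotopic_paths X (subpath 0 x r) (subpath 0 x ?q)"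
  proof (rule homotopic_paths_eq)
    fix t :: real assume t: "t \<in> {0..1}"
    then have "x * t \<le> x" using xy by (simp add: mult_left_le)
    then show "subpath 0 x r t = subpath 0 x ?q t"
      using straighten_ends[OF xy(2), of r] xy by (auto simp: subpath_def straighten_def)
  qed (use sub xy in auto)
  have s3: "homotopic_paths X (subpath y 1 r) (subpath y 1 ?q)"
  proof (rule homotopic_paths_eq)
    fix t :: real assume t: "t \<in> {0..1}"
    then have "(1 - y) * t + y \<ge> y" using xy by simp
    then show "subpath y 1 r t = subpath y 1 ?q t"
      using straighten_ends[OF xy(2), of r] by (auto simp: subpath_def straighten_def)
  qed (use sub xy in auto)
  have s2: "homotopic_paths X (linepath (r x) (r y)) (subpath x y ?q)"
  proof (rule homotopic_paths_eq)
    fix t :: real assume t: "t \<in> {0..1}"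
    have "(y - x) * t \<ge> 0" using t xy by simp
    moreover have "(y - x) * t \<le> y - x" using t xy by (intro mult_left_le) auto
    ultimately have "x \<le> (y - x) * t + x" "(y - x) * t + x \<le> y" by linarith+
    then show "linepath (r x) (r y) t = subpath x y ?q t"
      using xy by (auto simp: subpath_def straighten_def)
  qed (use lin in auto)
  have "homotopic_paths X r (subpath 0 x r +++ (subpath x y r +++ subpath y 1 r))"
    using join[OF r] by (rule homotopic_paths_sym)
  also have "homotopic_paths X \<dots> (subpath 0 x ?q +++ (subpath x y ?q +++ subpath y 1 ?q))"
    using s1 s3 homotopic_paths_trans[OF hom s2] by (intro homotopic_paths_join) auto
  also have "homotopic_paths X \<dots> ?q" by (rule join[OF q qX])
  finally show ?thesis .
qed

text \<open>In each direction the segment runs monotonically between its end values, so it follows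
  the first hits of these values by \<open>r\<close>; a decreasing direction becomes increasing by a
  change of sign.\<close>

lemma straighten_dominated:
  fixes r :: "real \<Rightarrow> 'a::real_inner"
  assumes "path r" and xy: "0 \<le> x" "x < y" "y \<le> 1"
  shows "dominated (straighten r x y) r"
  unfolding dominated_def
proof
  fix a :: 'a
  define f where "f t = a \<bullet> r t" for t
  define g where "g t = a \<bullet> straighten r x y t" for t
  have f: "continuous_on {x..y} f"
    using assms(1) xy unfolding f_def path_def
    by (intro continuous_intros) (auto elim: continuous_on_subset)
  have g: "g t = f x + ((t - x) / (y - x)) * (f y - f x)" if "x \<le> t" "t \<le> y" for t
    using that by (simp add: g_def f_def straighten_def linepath_def inner_add_right algebra_simps)
  have l: "0 \<le> (t - x) / (y - x)" "(t - x) / (y - x) \<le> 1" if "x \<le> t" "t \<le> y" for t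
    using that xy by auto
  have lm: "(s - x) / (y - x) \<le> (t - x) / (y - x)" if "s \<le> t" for s t
    using that xy by (auto intro: divide_right_mono)
  have "\<exists>\<tau>. mono_on {x..y} \<tau> \<and> (\<forall>t\<in>{x..y}. \<tau> t \<in> {x..y} \<and> g t = f (\<tau> t))"
  proof (cases "f x \<le> f y")
    case True
    obtain \<tau> where \<tau>: "mono_on {f x..f y} \<tau>" "\<And>w. w \<in> {f x..f y} \<Longrightarrow> \<tau> w \<in> {x..y} \<and> f (\<tau> w) = w"
      using first_hit[OF f _ True] xy by (metis less_imp_le)
    have gr: "g t \<in> {f x..f y}" if "t \<in> {x..y}" for t
    proof -
      have "0 \<le> ((t - x) / (y - x)) * (f y - f x)" "((t - x) / (y - x)) * (f y - f x) \<le> 1 * (f y - f x)"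
        using l[of t] that True by (intro mult_nonneg_nonneg mult_right_mono; simp)+
      then show ?thesis using g[of t] that by auto
    qed
    have gm: "g s \<le> g t" if "s \<in> {x..y}" "t \<in> {x..y}" "s \<le> t" for s t
    proof -
      have "((s - x) / (y - x)) * (f y - f x) \<le> ((t - x) / (y - x)) * (f y - f x)"
        using lm[OF that(3)] True by (intro mult_right_mono) auto
      then show ?thesis using g[of s] g[of t] that by simp
    qed
    show ?thesis
    proof (intro exI[of _ "\<lambda>t. \<tau> (g t)"] conjI ballI)
      show "mono_on {x..y} (\<lambda>t. \<tau> (g t))"
        using gr gm by (intro mono_onI mono_onD[OF \<tau>(1)])
    qed (use \<tau>(2) gr in auto)
  next
    case False
    then have le: "- f x \<le> - f y" by simp
    have f': "continuous_on {x..y} (\<lambda>t. - f t)" using f by (intro continuous_intros)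
    obtain \<tau> where \<tau>: "mono_on {- f x..- f y} \<tau>" "\<And>w. w \<in> {- f x..- f y} \<Longrightarrow> \<tau> w \<in> {x..y} \<and> - f (\<tau> w) = w"
      using first_hit[OF f' _ le] xy by (metis less_imp_le)
    have gr: "- g t \<in> {- f x..- f y}" if "t \<in> {x..y}" for t
    proof -
      have "0 \<le> ((t - x) / (y - x)) * (f x - f y)" "((t - x) / (y - x)) * (f x - f y) \<le> 1 * (f x - f y)"
        using l[of t] that False by (intro mult_nonneg_nonneg mult_right_mono; simp)+
      moreover have "((t - x) / (y - x)) * (f y - f x) = - (((t - x) / (y - x)) * (f x - f y))"
        by (simp only: minus_diff_eq[symmetric, of "f x" "f y"] mult_minus_right)
      ultimately show ?thesis using g[of t] that by auto
    qed
    have gm: "- g s \<le> - g t" if "s \<in> {x..y}" "t \<in> {x..y}" "s \<le> t" for s t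
    proof -
      have "((t - x) / (y - x)) * (f y - f x) \<le> ((s - x) / (y - x)) * (f y - f x)"
        using lm[OF that(3)] False by (intro mult_right_mono_neg) auto
      then show ?thesis using g[of s] g[of t] that by simp
    qed
    show ?thesis
    proof (intro exI[of _ "\<lambda>t. \<tau> (- g t)"] conjI ballI)
      show "mono_on {x..y} (\<lambda>t. \<tau> (- g t))"
        using gr gm by (intro mono_onI mono_onD[OF \<tau>(1)])
      show "\<tau> (- g t) \<in> {x..y}" "g t = f (\<tau> (- g t))" if "t \<in> {x..y}" for t
        using \<tau>(2)[OF gr[OF that]] by auto
    qed
  qed
  then obtain \<tau> where \<tau>: "mono_on {x..y} \<tau>" "\<And>t. t \<in> {x..y} \<Longrightarrow> \<tau> t \<in> {x..y} \<and> g t = f (\<tau> t)" by blast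
  define \<sigma> where "\<sigma> t = (if x \<le> t \<and> t \<le> y then \<tau> t else t)" for t
  show "\<exists>\<sigma>. mono_on {0..1} \<sigma> \<and> (\<forall>t\<in>{0..1}. \<sigma> t \<in> {0..1} \<and> a \<bullet> straighten r x y t = a \<bullet> r (\<sigma> t))"
  proof (intro exI[of _ \<sigma>] conjI ballI)
    have range: "t \<in> {x..y} \<Longrightarrow> x \<le> \<tau> t \<and> \<tau> t \<le> y" for t using \<tau>(2)[of t] by auto
    show "mono_on {0..1} \<sigma>"
    proof (rule mono_onI)
      fix s t :: real assume "s \<le> t"
      then show "\<sigma> s \<le> \<sigma> t"
        using range[of s] range[of t] mono_onD[OF \<tau>(1), of s t] by (auto simp: \<sigma>_def)
    qed
    fix t :: real assume t: "t \<in> {0..1}"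
    show "\<sigma> t \<in> {0..1}" using t range[of t] xy by (auto simp: \<sigma>_def)
    show "a \<bullet> straighten r x y t = a \<bullet> r (\<sigma> t)"
      using \<tau>(2)[of t] by (auto simp: \<sigma>_def g_def f_def) (auto simp: straighten_def)
  qed
qed

text \<open>\<open>excursions a c d r\<close> counts the excursions of \<open>r\<close> from the line \<open>a \<bullet> v = c\<close> that reach
  distance \<open>d\<close>.\<close>

definition excursion_set :: "'a::real_inner \<Rightarrow> real \<Rightarrow> real \<Rightarrow> (real \<Rightarrow> 'a) \<Rightarrow> real set \<Rightarrow> bool" where
  "excursion_set a c d r L \<longleftrightarrow> finite L \<and> L \<subseteq> {0..1} \<and> (\<forall>u\<in>L. d \<le> \<bar>a \<bullet> r u - c\<bar>) \<and>
     (\<forall>u\<in>L. \<forall>v\<in>L. u < v \<longrightarrow> (\<exists>\<tau>\<in>{u..v}. a \<bullet> r \<tau> = c))"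

definition excursions :: "'a::real_inner \<Rightarrow> real \<Rightarrow> real \<Rightarrow> (real \<Rightarrow> 'a) \<Rightarrow> nat" where
  "excursions a c d r = Max (card ` {L. excursion_set a c d r L})"

lemma card_separated_le:
  fixes L :: "real set"
  assumes "finite L" "L \<subseteq> {0..1}" "\<delta> > 0" and sep: "\<And>u v. u \<in> L \<Longrightarrow> v \<in> L \<Longrightarrow> u < v \<Longrightarrow> \<delta> \<le> v - u"
  shows "card L \<le> Suc (nat \<lfloor>1 / \<delta>\<rfloor>)"
proof -
  let ?f = "\<lambda>u. nat \<lfloor>u / \<delta>\<rfloor>"
  have lt: "?f u < ?f v" if "u \<in> L" "v \<in> L" "u < v" for u v
  proof -
    have "(u + \<delta>) / \<delta> \<le> v / \<delta>" using sep[OF that] \<open>\<delta> > 0\<close> by (intro divide_right_mono) auto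
    then have "u / \<delta> + 1 \<le> v / \<delta>" using \<open>\<delta> > 0\<close> by (simp add: add_divide_distrib)
    moreover have "0 \<le> u / \<delta>" using that(1) assms(2,3) by auto
    ultimately show ?thesis by linarith
  qed
  have "inj_on ?f L" by (rule linorder_inj_onI) (use lt in \<open>auto simp: less_imp_neq\<close>)
  moreover have "?f ` L \<subseteq> {..nat \<lfloor>1 / \<delta>\<rfloor>}"
  proof clarify
    fix u assume "u \<in> L"
    then have "u \<le> 1" using assms(2) by auto
    then have "u / \<delta> \<le> 1 / \<delta>" using assms(3) by (intro divide_right_mono) auto
    then show "?f u \<le> nat \<lfloor>1 / \<delta>\<rfloor>" by (intro nat_mono floor_mono)
  qed
  ultimately show ?thesis
    using card_inj_on_le[of ?f L "{..nat \<lfloor>1 / \<delta>\<rfloor>}"] by simp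
qed

lemma inner_path_modulus:
  fixes r :: "real \<Rightarrow> 'a::real_inner"
  assumes "path r" "d > 0"
  obtains \<delta> where "\<delta> > 0" "\<And>s t. s \<in> {0..1} \<Longrightarrow> t \<in> {0..1} \<Longrightarrow> \<bar>s - t\<bar> < \<delta> \<Longrightarrow> \<bar>a \<bullet> r s - a \<bullet> r t\<bar> < d"
proof -
  have "continuous_on {0..1} (\<lambda>t. a \<bullet> r t)"
    using assms(1) unfolding path_def by (intro continuous_intros)
  then have "uniformly_continuous_on {0..1} (\<lambda>t. a \<bullet> r t)" by (intro compact_uniformly_continuous) auto
  then show thesis using assms(2) that unfolding uniformly_continuous_on_def dist_real_def by metis
qed

text \<open>Between two members of an excursion set the functional returns to \<open>c\<close>, so
  uniform continuity keeps them at least \<open>\<delta>\<close> apart.\<close>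

lemma finite_excursions:
  fixes r :: "real \<Rightarrow> 'a::real_inner"
  assumes "path r" "d > 0"
  shows "finite (card ` {L. excursion_set a c d r L})"
proof -
  obtain \<delta> where \<delta>: "\<delta> > 0" "\<And>s t. s \<in> {0..1} \<Longrightarrow> t \<in> {0..1} \<Longrightarrow> \<bar>s - t\<bar> < \<delta> \<Longrightarrow> \<bar>a \<bullet> r s - a \<bullet> r t\<bar> < d"
    using inner_path_modulus[OF assms, of a] by blast
  have "card L \<le> Suc (nat \<lfloor>1 / \<delta>\<rfloor>)" if L: "excursion_set a c d r L" for L
  proof (rule card_separated_le[OF _ _ \<delta>(1)])
    fix u v assume uv: "u \<in> L" "v \<in> L" "u < v"
    then have "\<exists>\<tau>\<in>{u..v}. a \<bullet> r \<tau> = c" using L unfolding excursion_set_def by blast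
    then obtain \<tau> where \<tau>: "u \<le> \<tau>" "\<tau> \<le> v" "a \<bullet> r \<tau> = c" by auto
    have "u \<in> {0..1}" "v \<in> {0..1}" "d \<le> \<bar>a \<bullet> r u - c\<bar>" using uv L by (auto simp: excursion_set_def)
    then have "\<not> \<bar>u - \<tau>\<bar> < \<delta>" using \<delta>(2)[of u \<tau>] \<tau> by auto
    then show "\<delta> \<le> v - u" using \<tau> by auto
  qed (use L in \<open>auto simp: excursion_set_def\<close>)
  then have "card ` {L. excursion_set a c d r L} \<subseteq> {..Suc (nat \<lfloor>1 / \<delta>\<rfloor>)}" by auto
  then show ?thesis by (rule finite_subset) simp
qed

lemma excursions_attained:
  fixes r :: "real \<Rightarrow> 'a::real_inner"
  assumes "path r" "d > 0"
  obtains L where "excursion_set a c d r L" "card L = excursions a c d r"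
proof -
  have "excursion_set a c d r {}" by (simp add: excursion_set_def)
  then have "excursions a c d r \<in> card ` {L. excursion_set a c d r L}"
    unfolding excursions_def by (intro Max_in finite_excursions assms) auto
  then show thesis using that by auto
qed

lemma card_le_excursions:
  fixes r :: "real \<Rightarrow> 'a::real_inner"
  assumes "path r" "d > 0" "excursion_set a c d r L"
  shows "card L \<le> excursions a c d r"
  unfolding excursions_def using assms by (intro Max_ge finite_excursions) auto

text \<open>The time change maps an excursion set of \<open>q\<close> to one of \<open>r\<close>. It
  is injective there because the intermediate visits to level \<open>c\<close> have images strictly
  in between.\<close>

lemma excursions_dominated:
  fixes r :: "real \<Rightarrow> 'a::real_inner"
  assumes "path q" "path r" "d > 0" "dominated q r"
  shows "excursions a c d q \<le> excursions a c d r"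
proof -
  obtain L where L: "excursion_set a c d q L" "card L = excursions a c d q"
    by (rule excursions_attained[OF assms(1,3)])
  obtain \<sigma> where \<sigma>: "mono_on {0..1} \<sigma>" "\<And>t. t \<in> {0..1} \<Longrightarrow> \<sigma> t \<in> {0..1} \<and> a \<bullet> q t = a \<bullet> r (\<sigma> t)"
    using assms(4) unfolding dominated_def by meson
  have L01: "L \<subseteq> {0..1}" and Ld: "\<And>u. u \<in> L \<Longrightarrow> d \<le> \<bar>a \<bullet> q u - c\<bar>" using L by (auto simp: excursion_set_def)
  have mid: "\<exists>\<tau>. \<sigma> u < \<sigma> \<tau> \<and> \<sigma> \<tau> < \<sigma> v \<and> a \<bullet> r (\<sigma> \<tau>) = c" if uv: "u \<in> L" "v \<in> L" "u < v" for u v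
  proof -
    have "\<exists>\<tau>\<in>{u..v}. a \<bullet> q \<tau> = c" using L(1) uv unfolding excursion_set_def by blast
    then obtain \<tau> where \<tau>: "u \<le> \<tau>" "\<tau> \<le> v" "a \<bullet> q \<tau> = c" by auto
    have t01: "\<tau> \<in> {0..1}" "u \<in> {0..1}" "v \<in> {0..1}" using \<tau> uv L01 by auto
    have "\<sigma> u \<le> \<sigma> \<tau>" "\<sigma> \<tau> \<le> \<sigma> v" using mono_onD[OF \<sigma>(1)] t01 \<tau> by auto
    moreover have "\<sigma> u \<noteq> \<sigma> \<tau>" "\<sigma> v \<noteq> \<sigma> \<tau>"
      using Ld[OF uv(1)] Ld[OF uv(2)] \<tau>(3) \<sigma>(2)[OF t01(1)] \<sigma>(2)[OF t01(2)] \<sigma>(2)[OF t01(3)] assms(3) by auto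
    moreover have "a \<bullet> r (\<sigma> \<tau>) = c" using \<sigma>(2)[OF t01(1)] \<tau>(3) by simp
    ultimately show ?thesis by (metis order_le_neq_trans)
  qed
  have lt: "\<sigma> u < \<sigma> v" if "u \<in> L" "v \<in> L" "u < v" for u v using mid[OF that] by auto
  have inj: "inj_on \<sigma> L" by (rule linorder_inj_onI) (use lt in \<open>auto simp: less_imp_neq\<close>)
  have "excursion_set a c d r (\<sigma> ` L)"
    unfolding excursion_set_def
  proof (intro conjI ballI impI)
    show "finite (\<sigma> ` L)" using L by (simp add: excursion_set_def)
    show "\<sigma> ` L \<subseteq> {0..1}" using \<sigma>(2) L01 by blast
    show "d \<le> \<bar>a \<bullet> r w - c\<bar>" if "w \<in> \<sigma> ` L" for w
      using that Ld \<sigma>(2) L01 by (metis imageE subsetD)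
    fix w z assume wz: "w \<in> \<sigma> ` L" "z \<in> \<sigma> ` L" "w < z"
    then obtain u v where uv: "u \<in> L" "v \<in> L" "w = \<sigma> u" "z = \<sigma> v" by blast
    then have "u < v" using lt[of v u] wz(3) by (metis linorder_neqE_linordered_idom order_less_asym)
    from mid[OF uv(1,2) this] show "\<exists>\<tau>\<in>{w..z}. a \<bullet> r \<tau> = c" using uv by force
  qed
  then have "card (\<sigma> ` L) \<le> excursions a c d r" by (rule card_le_excursions[OF assms(2,3)])
  then show ?thesis using card_image[OF inj] L(2) by simp
qed

text \<open>The straightened piece stays at level \<open>c\<close>, so an excursion set of the new
  path avoids the interval from \<open>x\<close> to \<open>y\<close> and can be enlarged by
  \<open>l\<close> for the old path.\<close>

lemma excursions_straighten:
  fixes r :: "real \<Rightarrow> 'a::real_inner"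
  assumes "path r" "d > 0" and xy: "0 \<le> x" "x < y" "y \<le> 1" and lev: "a \<bullet> r x = c" "a \<bullet> r y = c"
    and l: "x < l" "l < y" "d \<le> \<bar>a \<bullet> r l - c\<bar>"
  shows "excursions a c d (straighten r x y) < excursions a c d r"
proof -
  let ?q = "straighten r x y"
  have pq: "path ?q" using straighten_path[OF assms(1) xy] .
  obtain L where L: "excursion_set a c d ?q L" "card L = excursions a c d ?q"
    by (rule excursions_attained[OF pq assms(2)])
  have q: "a \<bullet> ?q t = c" if "x \<le> t" "t \<le> y" for t
    using that lev by (simp add: straighten_def linepath_def inner_add_right algebra_simps)
  have q': "?q t = r t" if "\<not> (x \<le> t \<and> t \<le> y)" for t
    unfolding straighten_def using that by (rule if_not_P)
  have L01: "L \<subseteq> {0..1}" and Ld: "\<And>u. u \<in> L \<Longrightarrow> d \<le> \<bar>a \<bullet> ?q u - c\<bar>" using L by (auto simp: excursion_set_def)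
  have out: "u < x \<or> y < u" if "u \<in> L" for u using Ld[OF that] q[of u] assms(2) by force
  have "excursion_set a c d r (insert l L)"
    unfolding excursion_set_def
  proof (intro conjI ballI impI)
    show "finite (insert l L)" using L by (simp add: excursion_set_def)
    show "insert l L \<subseteq> {0..1}" using L01 l xy by auto
    show "d \<le> \<bar>a \<bullet> r u - c\<bar>" if "u \<in> insert l L" for u
      using that l Ld[of u] q'[of u] out[of u] xy by auto
    fix u v assume uv: "u \<in> insert l L" "v \<in> insert l L" "u < v"
    consider "u = l" | "v = l" | "u \<in> L" "v \<in> L" using uv by blast
    then show "\<exists>\<tau>\<in>{u..v}. a \<bullet> r \<tau> = c"
    proof cases
      case 1
      then have "y < v" using uv out[of v] l by auto
      then show ?thesis using 1 l lev by (intro bexI[of _ y]) auto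
    next
      case 2
      then have "u < x" using uv out[of u] l by auto
      then show ?thesis using 2 l lev by (intro bexI[of _ x]) auto
    next
      case 3
      then obtain \<tau> where \<tau>: "\<tau> \<in> {u..v}" "a \<bullet> ?q \<tau> = c" using L(1) uv(3) unfolding excursion_set_def by blast
      show ?thesis
      proof (cases "x \<le> \<tau> \<and> \<tau> \<le> y")
        case True
        then have "u < x" "y < v" using \<tau> out[OF 3(1)] out[OF 3(2)] by auto
        then show ?thesis using lev xy by (intro bexI[of _ x]) auto
      next
        case False
        then show ?thesis using \<tau> q'[OF False] by auto
      qed
    qed
  qed
  then have "card (insert l L) \<le> excursions a c d r" by (rule card_le_excursions[OF assms(1,2)])
  moreover have "l \<notin> L" using out[of l] l by auto
  ultimately show ?thesis using L by (simp add: excursion_set_def)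
qed

text \<open>The state reached by minimizing \<open>excursions a c d\<close>: an excursion that
  reaches distance \<open>d\<close> is not homotopic in \<open>X\<close> to its chord.\<close>

definition tight :: "'a::real_inner set \<Rightarrow> 'a \<Rightarrow> real \<Rightarrow> real \<Rightarrow> (real \<Rightarrow> 'a) \<Rightarrow> bool" where
  "tight X a c d r \<longleftrightarrow> (\<forall>x y l. 0 \<le> x \<and> x < l \<and> l < y \<and> y \<le> 1 \<and> a \<bullet> r x = c \<and> a \<bullet> r y = c \<and>
      homotopic_paths X (subpath x y r) (linepath (r x) (r y)) \<longrightarrow> \<bar>a \<bullet> r l - c\<bar> < d)"

text \<open>\<open>q\<close> minimizes the sum of the excursion counts over \<open>K\<close> among
  the dominated paths of the class. Straightening an offending excursion would lower one count and,
  by \<open>excursions_dominated\<close>, raise none.\<close>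

lemma tighten:
  fixes p :: "real \<Rightarrow> 'a::real_inner"
  assumes "finite K" and d: "\<And>a c d. (a, c, d) \<in> K \<Longrightarrow> d > 0" and r: "homotopic_paths X p r"
  obtains q where "homotopic_paths X p q" "dominated q r" "\<And>a c d. (a, c, d) \<in> K \<Longrightarrow> tight X a c d q"
proof -
  define m where "m q = (\<Sum>(a, c, d)\<in>K. excursions a c d q)" for q :: "real \<Rightarrow> 'a"
  let ?P = "\<lambda>q. homotopic_paths X p q \<and> dominated q r"
  have "?P r" using r dominated_refl by blast
  then obtain q where q: "?P q" "\<And>q'. ?P q' \<Longrightarrow> m q \<le> m q'"
    using ex_has_least_nat[of ?P r m] by blast
  have pq: "path q" "path_image q \<subseteq> X"
    using q(1) homotopic_paths_imp_path homotopic_paths_imp_subset by blast+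
  have "tight X a c e q" if K: "(a, c, e) \<in> K" for a c e
    unfolding tight_def
  proof (intro allI impI)
    fix x y l
    assume *: "0 \<le> x \<and> x < l \<and> l < y \<and> y \<le> 1 \<and> a \<bullet> q x = c \<and> a \<bullet> q y = c \<and>
      homotopic_paths X (subpath x y q) (linepath (q x) (q y))"
    show "\<bar>a \<bullet> q l - c\<bar> < e"
    proof (rule ccontr)
      assume "\<not> \<bar>a \<bullet> q l - c\<bar> < e"
      then have l: "e \<le> \<bar>a \<bullet> q l - c\<bar>" by simp
      let ?s = "straighten q x y"
      have xy: "0 \<le> x" "x < y" "y \<le> 1" using * by auto
      have dom: "dominated ?s q" by (rule straighten_dominated[OF pq(1) xy])
      have "homotopic_paths X q ?s" by (rule straighten_homotopic[OF pq xy]) (use * in blast)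
      then have "?P ?s" using q(1) dom dominated_trans homotopic_paths_trans by blast
      then have "m q \<le> m ?s" by (rule q(2))
      moreover have "m ?s < m q"
        unfolding m_def
      proof (rule sum_strict_mono_ex1[OF assms(1)])
        show "\<forall>k\<in>K. (case k of (a, c, d) \<Rightarrow> excursions a c d ?s) \<le> (case k of (a, c, d) \<Rightarrow> excursions a c d q)"
          using excursions_dominated[OF straighten_path[OF pq(1) xy] pq(1) d dom] by auto
        show "\<exists>k\<in>K. (case k of (a, c, d) \<Rightarrow> excursions a c d ?s) < (case k of (a, c, d) \<Rightarrow> excursions a c d q)"
          using excursions_straighten[OF pq(1) d[OF K] xy _ _ _ _ l] * K by (intro bexI[of _ "(a, c, e)"]) auto
      qed
      ultimately show False by simp
    qed
  qed
  then show thesis using that q(1) by blast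
qed

section \<open>Crossings of one path matched with times of the other\<close>

lemma homotopic_paths_imp_null_loop:
  fixes p r :: "real \<Rightarrow> 'a::real_normed_vector"
  assumes "homotopic_paths X p r"
  defines "f \<equiv> r +++ reversepath p"
  shows "homotopic_paths X f (linepath (f 0) (f 0))" "f 0 = p 0" "f 1 = p 0"
proof -
  have pr: "path p" "path r" "path_image p \<subseteq> X" "pathstart r = pathstart p" "pathfinish r = pathfinish p"
    using homotopic_paths_imp_path[OF assms(1)] homotopic_paths_imp_subset[OF assms(1)]
      homotopic_paths_imp_pathstart[OF assms(1)] homotopic_paths_imp_pathfinish[OF assms(1)] by auto
  show f0: "f 0 = p 0" using pr(4) by (simp add: f_def joinpaths_def pathstart_def)
  show "f 1 = p 0" by (simp add: f_def joinpaths_def reversepath_def)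
  have "homotopic_paths X f (p +++ reversepath p)"
    unfolding f_def using assms(1) pr
    by (intro homotopic_paths_join) (auto simp: homotopic_paths_sym_eq)
  also have "homotopic_paths X \<dots> (linepath (pathstart p) (pathstart p))"
    using pr by (intro homotopic_paths_rinv) auto
  finally show "homotopic_paths X f (linepath (f 0) (f 0))" by (simp add: f0 pathstart_def)
qed

text \<open>Both paths are laid on the bottom side, \<open>r\<close> on the left half and
  \<open>p\<close> reversed on the right. Continua from \<open>r\<close> to \<open>p\<close> then
  have both ends on one line, as \<open>crossing_sets_meet\<close> requires.\<close>

lemma square_of_homotopic_paths:
  fixes p r :: "real \<Rightarrow> real^2"
  assumes "homotopic_paths X p r"
  obtains H where "continuous_on unit_square H" "H ` unit_square \<subseteq> X"
    "\<And>t. t \<in> {0..1/2} \<Longrightarrow> H (pt t) = r (2 * t)" "\<And>t. t \<in> {1/2<..1} \<Longrightarrow> H (pt t) = p (2 - 2 * t)"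
    "\<And>v. v \<in> unit_square \<Longrightarrow> v $ 1 = 0 \<or> v $ 1 = 1 \<or> v $ 2 = 1 \<Longrightarrow> H v = p 0"
proof -
  define f where "f = r +++ reversepath p"
  note null = homotopic_paths_imp_null_loop(1)[OF assms, folded f_def]
  note f0 = homotopic_paths_imp_null_loop(2)[OF assms, folded f_def]
  note f1 = homotopic_paths_imp_null_loop(3)[OF assms, folded f_def]
  obtain h :: "real \<times> real \<Rightarrow> real^2" where h: "continuous_on ({0..1} \<times> {0..1}) h" "h ` ({0..1} \<times> {0..1}) \<subseteq> X"
      and h0: "\<And>t. t \<in> {0..1} \<Longrightarrow> h (0, t) = f t" and h1: "\<And>t. t \<in> {0..1} \<Longrightarrow> h (1, t) = f 0"
      and hs: "\<And>s. s \<in> {0..1} \<Longrightarrow> h (s, 0) = f 0" "\<And>s. s \<in> {0..1} \<Longrightarrow> h (s, 1) = f 1"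
    using null by (rule null_homotopy_square) blast
  define H where "H v = h (v $ 2, v $ 1)" for v :: "real^2"
  have sq: "(\<lambda>v::real^2. (v $ 2, v $ 1)) ` unit_square \<subseteq> {0..1} \<times> {0..1}"
    by (auto simp: mem_unit_square)
  show thesis
  proof (rule that[of H])
    show "continuous_on unit_square H"
      unfolding H_def by (rule continuous_on_compose2[OF h(1) _ sq]) (intro continuous_intros)
    show "H ` unit_square \<subseteq> X"
    proof -
      have "H ` unit_square = h ` ((\<lambda>v::real^2. (v $ 2, v $ 1)) ` unit_square)" by (auto simp: H_def image_image)
      then show ?thesis using sq h(2) by blast
    qed
    show "H (pt t) = r (2 * t)" if "t \<in> {0..1/2}" for t
      using h0[of t] that by (simp add: H_def f_def joinpaths_def)
    show "H (pt t) = p (2 - 2 * t)" if "t \<in> {1/2<..1}" for t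
      using h0[of t] that by (auto simp: H_def f_def joinpaths_def reversepath_def algebra_simps)
    show "H v = p 0" if "v \<in> unit_square" "v $ 1 = 0 \<or> v $ 1 = 1 \<or> v $ 2 = 1" for v
      using that h1[of "v $ 1"] hs[of "v $ 2"] f0 f1 by (auto simp: H_def mem_unit_square)
  qed
qed

text \<open>The level continuum that starts between \<open>s\<close> and \<open>t\<close> reaches
  the outer arc. The three constant sides are excluded by \<open>c \<noteq> a \<bullet> p 0\<close>,
  the half of \<open>r\<close> by tightness: \<open>level_excursion_homotopic\<close> would make an
  excursion of size \<open>d\<close> homotopic to its chord. So it ends on the half of
  \<open>p\<close>.\<close>

lemma crossing_level_continuum:
  fixes p r :: "real \<Rightarrow> real^2"
  assumes H: "continuous_on unit_square H" "H ` unit_square \<subseteq> X"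
    and Hr: "\<And>t. t \<in> {0..1/2} \<Longrightarrow> H (pt t) = r (2 * t)"
    and Hside: "\<And>v. v \<in> unit_square \<Longrightarrow> v $ 1 = 0 \<or> v $ 1 = 1 \<or> v $ 2 = 1 \<Longrightarrow> H v = p 0"
    and "a \<noteq> 0" "d > 0" "tight X a c d r" "c \<noteq> a \<bullet> p 0"
    and st: "0 \<le> s" "s < t" "t \<le> 1"
    and cross: "a \<bullet> r s \<le> c - d \<and> c + d \<le> a \<bullet> r t \<or> a \<bullet> r t \<le> c - d \<and> c + d \<le> a \<bullet> r s"
  obtains G i k where "compact G" "connected G" "G \<subseteq> unit_square" "\<And>v. v \<in> G \<Longrightarrow> a \<bullet> H v = c"
    "pt i \<in> G" "pt k \<in> G" "s \<le> 2 * i" "2 * i \<le> t" "1/2 < k" "k \<le> 1"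
proof -
  have Hst: "H (pt (s/2)) = r s" "H (pt (t/2)) = r t" using Hr[of "s/2"] Hr[of "t/2"] st by auto
  have "continuous_on unit_square (\<lambda>v. a \<bullet> H v)" using H(1) by (intro continuous_intros)
  then obtain G where G: "compact G" "connected G" "G \<subseteq> unit_square" "\<And>v. v \<in> G \<Longrightarrow> a \<bullet> H v = c"
    "\<exists>i\<in>{s/2..t/2}. pt i \<in> G" "G \<inter> outer_arc (s/2) (t/2) \<noteq> {}"
    by (rule level_continuum[of _ "s/2" "t/2" c]) (use st cross Hst \<open>d > 0\<close> in auto)
  obtain i where "i \<in> {s/2..t/2}" "pt i \<in> G" using G(5) by blast
  then have i: "s \<le> 2 * i" "2 * i \<le> t" "pt i \<in> G" by auto
  obtain z where z: "z \<in> G" "z \<in> outer_arc (s/2) (t/2)" using G(6) by blast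
  have "\<not> (z $ 1 = 0 \<or> z $ 1 = 1 \<or> z $ 2 = 1)"
    using Hside[of z] G(4)[OF z(1)] G(3) z(1) \<open>c \<noteq> a \<bullet> p 0\<close> by auto
  then have "z $ 2 = 0" "z $ 1 \<le> s/2 \<or> t/2 \<le> z $ 1" using z(2) by (auto simp: outer_arc_def)
  define k where "k = z $ 1"
  have k: "pt k \<in> G" "k \<le> s/2 \<or> t/2 \<le> k"
    using z(1) \<open>z $ 2 = 0\<close> \<open>z $ 1 \<le> s/2 \<or> t/2 \<le> z $ 1\<close> by (auto simp: k_def vec2_eq) (metis \<open>z $ 2 = 0\<close> pt_simps vec2_eq)+
  have k01: "0 \<le> k" "k \<le> 1" using k(1) G(3) by (auto simp: mem_unit_square)
  have ne: "i \<noteq> s/2" "i \<noteq> t/2" "k \<noteq> s/2" "k \<noteq> t/2"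
    using G(4)[OF i(3)] G(4)[OF k(1)] Hst cross \<open>d > 0\<close> by auto
  have big: "d \<le> \<bar>a \<bullet> r s - c\<bar>" "d \<le> \<bar>a \<bullet> r t - c\<bar>" using cross by auto
  have "1/2 < k"
  proof (rule ccontr)
    assume "\<not> 1/2 < k"
    then have k2: "k \<le> 1/2" by simp
    have *: False if xy: "0 \<le> x" "y \<le> 1/2" "pt x \<in> G" "pt y \<in> G" and l: "2 * x < l" "l < 2 * y" "d \<le> \<bar>a \<bullet> r l - c\<bar>" for x y l
    proof -
      have xy': "x < y" using l by simp
      have Hx: "H (pt x) = r (2 * x)" "H (pt y) = r (2 * y)" using Hr[of x] Hr[of y] xy xy' by auto
      have hom: "homotopic_paths X (\<lambda>u. H (pt ((1 - u) * x + u * y))) (linepath (H (pt x)) (H (pt y)))"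
        by (rule level_excursion_homotopic[OF H G(1,2,3) xy(3,4) xy' \<open>a \<noteq> 0\<close> G(4)])
      have "homotopic_paths X (\<lambda>u. H (pt ((1 - u) * x + u * y))) (subpath (2 * x) (2 * y) r)"
      proof (rule homotopic_paths_eq)
        fix u :: real assume u: "u \<in> {0..1}"
        define w where "w = (1 - u) * x + u * y"
        have "0 \<le> u * (y - x)" "0 \<le> (1 - u) * (y - x)" using u xy' by auto
        moreover have "w = x + u * (y - x)" "w = y - (1 - u) * (y - x)" by (simp_all add: w_def algebra_simps)
        ultimately have "x \<le> w" "w \<le> y" by linarith+
        then have "w \<in> {0..1/2}" using xy by auto
        then have "H (pt w) = r (2 * w)" by (rule Hr)
        moreover have "2 * w = (2 * y - 2 * x) * u + 2 * x" by (simp add: w_def algebra_simps)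
        ultimately show "H (pt ((1 - u) * x + u * y)) = subpath (2 * x) (2 * y) r u"
          by (simp add: subpath_def w_def)
      qed (use homotopic_paths_imp_path[OF hom] homotopic_paths_imp_subset[OF hom] in auto)
      then have "homotopic_paths X (subpath (2 * x) (2 * y) r) (linepath (r (2 * x)) (r (2 * y)))"
        using hom[unfolded Hx] by (rule homotopic_paths_trans[OF homotopic_paths_sym])
      moreover have "a \<bullet> r (2 * x) = c" "a \<bullet> r (2 * y) = c" using G(4)[OF xy(3)] G(4)[OF xy(4)] Hx by simp_all
      ultimately have "\<bar>a \<bullet> r l - c\<bar> < d"
        using \<open>tight X a c d r\<close>[unfolded tight_def, rule_format, of "2 * x" l "2 * y"] xy l by simp
      then show False using l by simp
    qed
    show False
    \<comment> \<open>The piece of \<open>r\<close> between the two ends contains the time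
      \<open>s\<close> if \<open>k\<close> is on the left, otherwise \<open>t\<close>; at both,
      \<open>r\<close> is at least \<open>d\<close> away from the level.\<close>
    proof (cases "k \<le> s/2")
      case True
      then show False using *[of k i s] k k01 i ne st big by auto
    next
      case False
      then show False using *[of i k t] k k2 i ne st big by auto
    qed
  qed
  then show thesis using that[OF G(1-4) i(3) k(1) i(1,2)] k01 by simp
qed

definition crosses :: "'a::real_inner \<Rightarrow> real \<Rightarrow> real \<Rightarrow> (real \<Rightarrow> 'a) \<Rightarrow> real \<Rightarrow> real \<Rightarrow> bool" where
  "crosses a \<alpha> \<beta> r s t \<longleftrightarrow> a \<bullet> r s \<le> \<alpha> \<and> \<beta> \<le> a \<bullet> r t \<or> a \<bullet> r t \<le> \<alpha> \<and> \<beta> \<le> a \<bullet> r s"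

text \<open>Alternately using the levels \<open>c1\<close> and \<open>c2\<close>, every crossing of \<open>r\<close> is joined through the homotopy
  to a time of \<open>p\<close> at that level; the joining continua are disjoint, so these times are ordered.\<close>
lemma crossing_bound:
  fixes p r :: "real \<Rightarrow> real^2"
  assumes hom: "homotopic_paths X p r" and "a \<noteq> 0" "d > 0"
    and tight: "tight X a c1 d r" "tight X a c2 d r" and c: "c1 < c2" "c1 \<noteq> a \<bullet> p 0" "c2 \<noteq> a \<bullet> p 0"
      "\<alpha> + d \<le> c1" "c2 + d \<le> \<beta>"
    and \<delta>: "\<delta> > 0" "\<And>s t. s \<in> {0..1} \<Longrightarrow> t \<in> {0..1} \<Longrightarrow> \<bar>s - t\<bar> < \<delta> \<Longrightarrow> \<bar>a \<bullet> p s - a \<bullet> p t\<bar> < c2 - c1"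
    and ts: "sorted ts" "set ts \<subseteq> {0..1}" and I: "I \<subseteq> {1..<length ts}"
    and cross: "\<And>i. i \<in> I \<Longrightarrow> crosses a \<alpha> \<beta> r (ts ! (i - 1)) (ts ! i)"
  shows "card I \<le> Suc (nat \<lfloor>2 / \<delta>\<rfloor>)"
proof -
  obtain H where H: "continuous_on unit_square H" "H ` unit_square \<subseteq> X"
    and Hr: "\<And>t. t \<in> {0..1/2} \<Longrightarrow> H (pt t) = r (2 * t)" and Hp: "\<And>t. t \<in> {1/2<..1} \<Longrightarrow> H (pt t) = p (2 - 2 * t)"
    and Hside: "\<And>v. v \<in> unit_square \<Longrightarrow> v $ 1 = 0 \<or> v $ 1 = 1 \<or> v $ 2 = 1 \<Longrightarrow> H v = p 0"
    using square_of_homotopic_paths[OF hom] by blast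
  define js where "js = sorted_list_of_set I"
  define m where "m = length js"
  have fin: "finite I" using I finite_subset by blast
  have js: "set js = I" "sorted_wrt (<) js" and m: "m = card I"
    using fin by (simp_all add: js_def m_def)
  define s t where "s j = ts ! (js ! j - 1)" and "t j = ts ! (js ! j)" for j
  have jI: "js ! j \<in> I" if "j < m" for j using that js(1) m_def nth_mem by blast
  have idx: "1 \<le> js ! j" "js ! j < length ts" if "j < m" for j using jI[OF that] I by auto
  have st: "0 \<le> s j" "s j < t j" "t j \<le> 1" if "j < m" for j
  proof -
    have "s j \<in> set ts" "t j \<in> set ts" using idx[OF that] by (auto simp: s_def t_def)
    then show "0 \<le> s j" "t j \<le> 1" using ts(2) by auto
    have "s j \<le> t j" unfolding s_def t_def using idx[OF that] ts(1) by (intro sorted_nth_mono) auto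
    moreover have "s j \<noteq> t j"
      using cross[OF jI[OF that]] c(1,4,5) \<open>d > 0\<close> by (auto simp: s_def t_def crosses_def)
    ultimately show "s j < t j" by simp
  qed
  have ord: "t j \<le> s (Suc j)" if "Suc j < m" for j
  proof -
    have "js ! j < js ! Suc j" using js(2) that by (simp add: m_def sorted_wrt_iff_nth_less)
    then have "js ! j \<le> js ! Suc j - 1" by simp
    then show ?thesis unfolding s_def t_def using idx[OF that] ts(1) by (intro sorted_nth_mono) auto
  qed
  \<comment> \<open>Alternating levels make the continua of consecutive crossings disjoint; on a
    single level they could coincide.\<close>
  define lev where "lev j = (if even j then c1 else c2)" for j :: nat
  define Q where "Q j G i k \<longleftrightarrow> compact G \<and> connected G \<and> G \<subseteq> unit_square \<and> (\<forall>v\<in>G. a \<bullet> H v = lev j) \<and>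
    pt i \<in> G \<and> pt k \<in> G \<and> s j \<le> 2 * i \<and> 2 * i \<le> t j \<and> 1/2 < k \<and> k \<le> 1" for j G i k
  have "\<exists>G i k. Q j G i k" if jm: "j < m" for j
  proof -
    have cr: "a \<bullet> r (s j) \<le> lev j - d \<and> lev j + d \<le> a \<bullet> r (t j) \<or> a \<bullet> r (t j) \<le> lev j - d \<and> lev j + d \<le> a \<bullet> r (s j)"
      using cross[OF jI[OF that]] c by (auto simp: s_def t_def crosses_def lev_def)
    have tl: "tight X a (lev j) d r" "lev j \<noteq> a \<bullet> p 0" using tight c by (auto simp: lev_def)
    show ?thesis
    proof (rule crossing_level_continuum[where p = p and r = r and H = H and X = X and a = a and c = "lev j" and d = d
        and s = "s j" and t = "t j", OF H Hr Hside \<open>a \<noteq> 0\<close> \<open>d > 0\<close> tl st[OF jm] cr])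
      fix G i k
      assume "compact G" "connected G" "G \<subseteq> unit_square" "\<And>v. v \<in> G \<Longrightarrow> a \<bullet> H v = lev j"
        "pt i \<in> G" "pt k \<in> G" "s j \<le> 2 * i" "2 * i \<le> t j" "1/2 < k" "k \<le> 1"
      then have "Q j G i k" by (simp add: Q_def)
      then show ?thesis by blast
    qed
  qed
  then obtain G i k where "\<And>j. j < m \<Longrightarrow> Q j (G j) (i j) (k j)" by metis
  then have G: "\<And>j. j < m \<Longrightarrow> compact (G j)" "\<And>j. j < m \<Longrightarrow> connected (G j)"
    "\<And>j. j < m \<Longrightarrow> G j \<subseteq> unit_square" "\<And>j v. j < m \<Longrightarrow> v \<in> G j \<Longrightarrow> a \<bullet> H v = lev j"
    and ik: "\<And>j. j < m \<Longrightarrow> pt (i j) \<in> G j" "\<And>j. j < m \<Longrightarrow> pt (k j) \<in> G j"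
      "\<And>j. j < m \<Longrightarrow> s j \<le> 2 * i j" "\<And>j. j < m \<Longrightarrow> 2 * i j \<le> t j" "\<And>j. j < m \<Longrightarrow> 1/2 < k j" "\<And>j. j < m \<Longrightarrow> k j \<le> 1"
    by (simp_all add: Q_def)
  \<comment> \<open>Disjoint continua cannot cross, so their right ends come in reversed order.
    There \<open>p\<close> takes values \<open>c2 - c1\<close> apart, and its time
    \<open>2 - 2 * k\<close> doubles differences of \<open>k\<close>, whence
    \<open>\<delta> / 2\<close>.\<close>
  have gap: "k (Suc j) \<le> k j - \<delta> / 2" if j: "Suc j < m" for j
  proof -
    have j': "j < m" using j by simp
    have lne: "lev j \<noteq> lev (Suc j)" "\<bar>lev j - lev (Suc j)\<bar> = c2 - c1" using c(1) by (auto simp: lev_def)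
    have disj: "G j \<inter> G (Suc j) = {}" using G(4)[OF j'] G(4)[OF j] lne(1) by (metis disjoint_iff)
    have "2 * i j \<le> 2 * i (Suc j)" using ik(4)[OF j'] ord[OF j] ik(3)[OF j] by linarith
    moreover have "i j \<noteq> i (Suc j)" using disj ik(1)[OF j'] ik(1)[OF j] by (metis disjoint_iff)
    ultimately have ii: "i j < i (Suc j)" by linarith
    have "2 * i (Suc j) \<le> 1" using ik(4)[OF j] st(3)[OF j] by linarith
    then have ik': "i (Suc j) < k j" using ik(5)[OF j'] by linarith
    have "\<not> k j < k (Suc j)"
    proof
      assume "k j < k (Suc j)"
      have up: "0 \<le> v $ 2" if "v \<in> G j \<union> G (Suc j)" for v
        using that G(3)[OF j'] G(3)[OF j] by (auto simp: mem_unit_square subset_iff)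
      show False
        using crossing_sets_meet[OF G(1,2)[OF j'] G(1,2)[OF j] up ik(1,2)[OF j'] ik(1,2)[OF j] ii ik' \<open>k j < k (Suc j)\<close>] disj
        by blast
    qed
    moreover have "a \<bullet> p (2 - 2 * k j) = lev j" "a \<bullet> p (2 - 2 * k (Suc j)) = lev (Suc j)"
      using G(4)[OF j' ik(2)[OF j']] G(4)[OF j ik(2)[OF j]] Hp[of "k j"] Hp[of "k (Suc j)"] ik(5,6)[OF j'] ik(5,6)[OF j]
      by auto
    then have "\<not> \<bar>(2 - 2 * k j) - (2 - 2 * k (Suc j))\<bar> < \<delta>"
      using \<delta>(2)[of "2 - 2 * k j" "2 - 2 * k (Suc j)"] lne(2) ik(5,6)[OF j'] ik(5,6)[OF j] by auto
    ultimately show ?thesis by (auto simp: abs_if split: if_splits)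
  qed
  have sum: "k j \<le> k 0 - real j * (\<delta> / 2)" if "j < m" for j
    using that
  proof (induction j)
    case (Suc j)
    have "real (Suc j) * (\<delta> / 2) = real j * (\<delta> / 2) + \<delta> / 2" by (simp add: field_simps)
    moreover have "k j \<le> k 0 - real j * (\<delta> / 2)" using Suc by simp
    ultimately show ?case using gap[OF Suc.prems] by linarith
  qed simp
  show ?thesis
  proof (cases m)
    case (Suc n)
    have "real n * (\<delta> / 2) \<le> 1" using sum[of n] ik(5)[of n] ik(6)[of 0] Suc by simp
    then have "real n \<le> 2 / \<delta>" using \<delta>(1) by (simp add: field_simps)
    then have "n \<le> nat \<lfloor>2 / \<delta>\<rfloor>" by linarith
    then show ?thesis using m Suc by simp
  qed (use m in simp)
qed

section \<open>Equicontinuous reparametrization\<close>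

text \<open>A variation that charges only the part of each jump beyond \<open>e\<close>. For a
  continuous path its values over all partitions are bounded, unlike those of the ordinary
  variation, and bounds on strip crossings control it.\<close>

fun jump_sum :: "real \<Rightarrow> (real \<Rightarrow> 'a::metric_space) \<Rightarrow> real list \<Rightarrow> real" where
  "jump_sum e r (x # y # ts) = max 0 (dist (r x) (r y) - e) + jump_sum e r (y # ts)"
| "jump_sum e r _ = 0"

lemma jump_sum_join: "jump_sum e r (xs @ [a] @ ys) = jump_sum e r (xs @ [a]) + jump_sum e r (a # ys)"
proof (induction xs)
  case (Cons x xs)
  then show ?case by (cases xs) auto
qed simp

lemma jump_sum_append_le: "jump_sum e r xs + jump_sum e r ys \<le> jump_sum e r (xs @ ys)"
proof (cases xs rule: rev_cases)
  case (snoc zs a)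
  have "jump_sum e r ys \<le> jump_sum e r (a # ys)" by (cases ys) auto
  then show ?thesis using jump_sum_join[of e r zs a ys] snoc by simp
qed simp

lemma jump_sum_zero:
  assumes "\<And>u v. u \<in> set ts \<Longrightarrow> v \<in> set ts \<Longrightarrow> dist (r u) (r v) \<le> e"
  shows "jump_sum e r ts = 0"
  using assms by (induction e r ts rule: jump_sum.induct) auto

lemma jump_sum_eq_sum:
  "jump_sum e r ts = (\<Sum>i\<in>{1..<length ts}. max 0 (dist (r (ts ! (i - 1))) (r (ts ! i)) - e))"
proof (induction e r ts rule: jump_sum.induct)
  case (1 e r x y ts)
  let ?f = "\<lambda>l i. max 0 (dist (r (l ! (i - 1))) (r (l ! i)) - e)"
  let ?l = "x # y # ts"
  have "(\<Sum>i\<in>{1..<length ?l}. ?f ?l i) = ?f ?l 1 + (\<Sum>i\<in>{Suc 1..<length ?l}. ?f ?l i)"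
    by (rule sum.atLeast_Suc_lessThan) simp
  also have "(\<Sum>i\<in>{Suc 1..<length ?l}. ?f ?l i) = (\<Sum>i\<in>{1..<length (y # ts)}. ?f ?l (Suc i))"
    using sum.shift_bounds_Suc_ivl[of "?f ?l" 1 "length (y # ts)"] by simp
  also have "\<dots> = (\<Sum>i\<in>{1..<length (y # ts)}. ?f (y # ts) i)"
    by (intro sum.cong refl) (auto simp: nth_Cons')
  finally show ?case using 1 by simp
qed auto

definition jump_var :: "real \<Rightarrow> (real \<Rightarrow> 'a::metric_space) \<Rightarrow> real \<Rightarrow> real" where
  "jump_var e r t = Sup (jump_sum e r ` {ts. sorted ts \<and> set ts \<subseteq> {0..t}})"

context
  fixes e :: real and r :: "real \<Rightarrow> 'a::metric_space" and B :: real
  assumes e: "e > 0" and B: "\<And>ts. sorted ts \<Longrightarrow> set ts \<subseteq> {0..1} \<Longrightarrow> jump_sum e r ts \<le> B"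
begin

lemma jump_sum_le_var:
  assumes "sorted ts" "set ts \<subseteq> {0..t}" "t \<le> 1"
  shows "jump_sum e r ts \<le> jump_var e r t"
  unfolding jump_var_def
proof (rule cSup_upper)
  show "bdd_above (jump_sum e r ` {ts. sorted ts \<and> set ts \<subseteq> {0..t}})"
    by (rule bdd_aboveI[of _ B]) (use B assms(3) in force)
qed (use assms in auto)

lemma jump_var_le:
  assumes "\<And>ts. sorted ts \<Longrightarrow> set ts \<subseteq> {0..t} \<Longrightarrow> jump_sum e r ts \<le> b"
  shows "jump_var e r t \<le> b"
  unfolding jump_var_def
  by (rule cSup_least) (use assms in \<open>auto intro!: exI[of _ "[]"]\<close>)

lemma jump_var_bounds:
  assumes "t \<le> 1" shows "0 \<le> jump_var e r t" "jump_var e r t \<le> B"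
proof -
  show "0 \<le> jump_var e r t" using jump_sum_le_var[of "[]" t] assms by simp
  show "jump_var e r t \<le> B" by (rule jump_var_le) (use B assms in force)
qed

lemma jump_var_mono:
  assumes "s \<le> t" "t \<le> 1" shows "jump_var e r s \<le> jump_var e r t"
  by (rule jump_var_le) (use assms in \<open>auto intro!: jump_sum_le_var\<close>)

lemma dist_le_jump_var:
  assumes "0 \<le> s" "s \<le> t" "t \<le> 1"
  shows "dist (r s) (r t) \<le> e + (jump_var e r t - jump_var e r s)"
proof -
  have "jump_var e r s \<le> jump_var e r t - (dist (r s) (r t) - e)"
  proof (rule jump_var_le)
    fix ts assume ts: "sorted ts" "set ts \<subseteq> {0..s}"
    have "jump_sum e r ts + jump_sum e r [s, t] \<le> jump_sum e r (ts @ [s, t])" by (rule jump_sum_append_le)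
    also have "\<dots> \<le> jump_var e r t"
      using ts assms by (intro jump_sum_le_var) (auto simp: sorted_append)
    finally show "jump_sum e r ts \<le> jump_var e r t - (dist (r s) (r t) - e)" by simp
  qed
  then show ?thesis by simp
qed

text \<open>After \<open>s\<close> all mutual jumps of a partition are at most
  \<open>w \<le> e\<close> and cost nothing. Only the jump across \<open>s\<close> counts, and
  ending it at \<open>s\<close> changes its cost by at most \<open>w\<close>.\<close>

lemma jump_var_small:
  assumes st: "0 \<le> s" "s \<le> t" "t \<le> 1" and w: "w \<le> e" "\<And>u v. u \<in> {s..t} \<Longrightarrow> v \<in> {s..t} \<Longrightarrow> dist (r u) (r v) \<le> w"
  shows "jump_var e r t \<le> jump_var e r s + w"
proof (rule jump_var_le)
  fix ts assume ts: "sorted ts" "set ts \<subseteq> {0..t}"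
  have w0: "0 \<le> w" using w(2)[of s s] st by simp
  define xs where "xs = takeWhile (\<lambda>u. u \<le> s) ts"
  define ys where "ys = dropWhile (\<lambda>u. u \<le> s) ts"
  have xys: "ts = xs @ ys" by (simp add: xs_def ys_def)
  have xs: "sorted (xs @ [s])" "set (xs @ [s]) \<subseteq> {0..s}"
  proof -
    have le: "u \<le> s" if "u \<in> set xs" for u using that unfolding xs_def by (auto dest: set_takeWhileD)
    have "sorted xs" "set xs \<subseteq> {0..t}" using ts unfolding xys by (simp_all add: sorted_append)
    then show "sorted (xs @ [s])" "set (xs @ [s]) \<subseteq> {0..s}" using le st by (auto simp: sorted_append)
  qed
  have ys: "u \<in> {s..t}" if "u \<in> set ys" for u
  proof (cases ys)
    case (Cons b zs)
    then have "\<not> b \<le> s" by (simp add: ys_def dropWhile_eq_Cons_conv)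
    moreover have "sorted ys" "set ys \<subseteq> {0..t}" using ts unfolding xys by (simp_all add: sorted_append)
    ultimately show ?thesis using that Cons by auto
  qed (use that in simp)
  have y0: "jump_sum e r ys = 0"
  proof (rule jump_sum_zero)
    fix u v assume "u \<in> set ys" "v \<in> set ys"
    then have "dist (r u) (r v) \<le> w" by (intro w(2) ys)
    then show "dist (r u) (r v) \<le> e" using w(1) by simp
  qed
  have "jump_sum e r ts \<le> jump_sum e r (xs @ [s]) + w"
  proof (cases xs rule: rev_cases)
    case Nil
    then show ?thesis using y0 xys w0 by simp
  next
    case (snoc zs a)
    have 1: "jump_sum e r (xs @ [s]) = jump_sum e r xs + max 0 (dist (r a) (r s) - e)"
      using jump_sum_join[of e r zs a "[s]"] snoc by simp
    have 2: "jump_sum e r ts = jump_sum e r xs + jump_sum e r (a # ys)"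
      using jump_sum_join[of e r zs a ys] snoc xys by simp
    have "jump_sum e r (a # ys) \<le> max 0 (dist (r a) (r s) - e) + w"
    proof (cases ys)
      case (Cons b us)
      have "dist (r a) (r b) \<le> dist (r a) (r s) + dist (r s) (r b)" by (rule dist_triangle)
      also have "dist (r s) (r b) \<le> w" using ys[of b] Cons st by (intro w(2)) auto
      finally show ?thesis using Cons y0 w0 by simp
    qed (use w0 in simp)
    then show ?thesis using 1 2 by simp
  qed
  also have "jump_sum e r (xs @ [s]) \<le> jump_var e r s"
    using xs st by (intro jump_sum_le_var) auto
  finally show "jump_sum e r ts \<le> jump_var e r s + w" by simp
qed

lemma continuous_on_jump_var:
  assumes "continuous_on {0..1} r"
  shows "continuous_on {0..1} (jump_var e r)"
  unfolding continuous_on_iff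
proof (intro ballI allI impI)
  fix s \<epsilon> :: real assume "s \<in> {0..1}" "\<epsilon> > 0"
  define w where "w = min e (\<epsilon> / 2)"
  have w: "w > 0" "w \<le> e" "w < \<epsilon>" using e \<open>\<epsilon> > 0\<close> by (auto simp: w_def)
  have "uniformly_continuous_on {0..1} r" using assms by (intro compact_uniformly_continuous) auto
  then obtain d where d: "d > 0" "\<And>u v. u \<in> {0..1} \<Longrightarrow> v \<in> {0..1} \<Longrightarrow> dist v u < d \<Longrightarrow> dist (r v) (r u) < w"
    using w(1) unfolding uniformly_continuous_on_def by metis
  have *: "dist (jump_var e r u) (jump_var e r v) \<le> w" if "0 \<le> u" "u \<le> v" "v \<le> 1" "v - u < d" for u v
  proof -
    have "jump_var e r v \<le> jump_var e r u + w"
    proof (rule jump_var_small[OF that(1-3) w(2)])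
      fix x y assume "x \<in> {u..v}" "y \<in> {u..v}"
      then show "dist (r x) (r y) \<le> w" using d(2)[of y x] that by (auto simp: dist_real_def less_imp_le)
    qed
    then show ?thesis using jump_var_mono[OF that(2,3)] by (simp add: dist_real_def)
  qed
  have "dist (jump_var e r t) (jump_var e r s) < \<epsilon>" if "t \<in> {0..1}" "dist t s < d" for t
    using *[of t s] *[of s t] that \<open>s \<in> {0..1}\<close> w(3) by (cases "t \<le> s") (auto simp: dist_real_def dist_commute)
  then show "\<exists>d>0. \<forall>t\<in>{0..1}. dist t s < d \<longrightarrow> dist (jump_var e r t) (jump_var e r s) < \<epsilon>" using d(1) by blast
qed

end

text \<open>As with arc length, time is replaced by a variation: a weighted sum of
  \<open>jump_var\<close> over the scales \<open>m \<le> n\<close>, plus \<open>t\<close> itself to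
  make it strictly increasing. The resulting estimate at scale \<open>m\<close> does not depend on
  \<open>n\<close>.\<close>

lemma reparametrize_equicontinuous:
  fixes r :: "real \<Rightarrow> 'a::metric_space"
  assumes r: "continuous_on {0..1} r" and e: "\<And>m. e m > 0" and B0: "\<And>m. B m \<ge> 0"
    and B: "\<And>m ts. m \<le> n \<Longrightarrow> sorted ts \<Longrightarrow> set ts \<subseteq> {0..1} \<Longrightarrow> jump_sum (e m) r ts \<le> B m"
  obtains \<psi> where "continuous_on {0..1} \<psi>" "\<psi> \<in> {0..1} \<rightarrow> {0..1}" "\<psi> 0 = 0" "\<psi> 1 = (1::real)" "mono_on {0..1} \<psi>"
    "\<And>m u v. m \<le> n \<Longrightarrow> u \<in> {0..1} \<Longrightarrow> v \<in> {0..1} \<Longrightarrow> dist (r (\<psi> u)) (r (\<psi> v)) \<le> e m + 2 ^ (m + 2) * (1 + B m) * \<bar>u - v\<bar>"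
proof -
  \<comment> \<open>With these weights the variations add up to at most 1 for any number of scales,
    and the new total time lies between 1 and 2.\<close>
  define c where "c m = 1 / (2 ^ (m + 1) * (1 + B m))" for m :: nat
  have c: "c m > 0" "c m * B m \<le> 1 / 2 ^ (m + 1)" for m
  proof -
    have "1 + B m > 0" using B0[of m] by simp
    then show "c m > 0" "c m * B m \<le> 1 / 2 ^ (m + 1)" by (auto simp: c_def divide_simps)
  qed
  define V where "V m = jump_var (e m) r" for m
  have V: "continuous_on {0..1} (V m)" "\<And>t. t \<le> 1 \<Longrightarrow> 0 \<le> V m t" "\<And>t. t \<le> 1 \<Longrightarrow> V m t \<le> B m"
    "\<And>s t. s \<le> t \<Longrightarrow> t \<le> 1 \<Longrightarrow> V m s \<le> V m t"
    "\<And>s t. 0 \<le> s \<Longrightarrow> s \<le> t \<Longrightarrow> t \<le> 1 \<Longrightarrow> dist (r s) (r t) \<le> e m + (V m t - V m s)" if "m \<le> n" for m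
    unfolding V_def
    using continuous_on_jump_var[OF e B[OF that] r] jump_var_bounds[OF e B[OF that]] jump_var_mono[OF e B[OF that]]
      dist_le_jump_var[OF e B[OF that]] by auto
  define \<phi> where "\<phi> t = t + (\<Sum>m\<le>n. c m * V m t)" for t
  have \<phi>_inc: "\<phi> t - \<phi> s \<ge> (t - s) + c m * (V m t - V m s)" if "0 \<le> s" "s \<le> t" "t \<le> 1" "m \<le> n" for s t m
  proof -
    have "c m * (V m t - V m s) \<le> (\<Sum>m\<le>n. c m * (V m t - V m s))"
      by (rule member_le_sum) (use that c(1) V(4) in \<open>auto intro!: mult_nonneg_nonneg less_imp_le[OF c(1)]\<close>)
    then show ?thesis by (simp add: \<phi>_def sum_subtractf algebra_simps)
  qed
  have \<phi>_mono: "\<phi> s < \<phi> t" if "0 \<le> s" "s < t" "t \<le> 1" for s t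
  proof -
    have "c 0 * (V 0 t - V 0 s) \<ge> 0" using c(1)[of 0] V(4)[of 0 s t] that by simp
    then show ?thesis using \<phi>_inc[of s t 0] that by simp
  qed
  have total: "1 \<le> \<phi> 1 - \<phi> 0" "\<phi> 1 - \<phi> 0 \<le> 2"
  proof -
    have "c 0 * (V 0 1 - V 0 0) \<ge> 0" using c(1)[of 0] V(4)[of 0 0 1] by simp
    then show "1 \<le> \<phi> 1 - \<phi> 0" using \<phi>_inc[of 0 1 0] by simp
    have "(\<Sum>m\<le>n. c m * V m 1) \<le> (\<Sum>m\<le>n. 1 / 2 ^ (m + 1))"
    proof (rule sum_mono)
      fix m assume "m \<in> {..n}"
      then have "c m * V m 1 \<le> c m * B m" using V(3)[of m 1] c(1)[of m] by simp
      then show "c m * V m 1 \<le> 1 / 2 ^ (m + 1)" using c(2)[of m] by simp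
    qed
    also have "\<dots> \<le> 1"
    proof -
      have "(\<Sum>m\<le>n. 1 / 2 ^ (m + 1)) = 1 - (1/2::real) ^ (n + 1)" for n
        by (induction n) (auto simp: field_simps)
      then show ?thesis by simp
    qed
    finally have "\<phi> 1 \<le> 2" by (simp add: \<phi>_def)
    moreover have "\<phi> 0 \<ge> 0" 
    proof -
      have "0 \<le> c m * V m 0" if "m \<le> n" for m
        using less_imp_le[OF c(1)[of m]] V(2)[OF that, of 0] by simp
      then have "0 \<le> (\<Sum>m\<le>n. c m * V m 0)" by (intro sum_nonneg) auto
      then show ?thesis by (simp add: \<phi>_def)
    qed
    ultimately show "\<phi> 1 - \<phi> 0 \<le> 2" by simp
  qed
  define D where "D = \<phi> 1 - \<phi> 0"
  have D: "1 \<le> D" "D \<le> 2" using total by (auto simp: D_def)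
  define \<theta> where "\<theta> t = (\<phi> t - \<phi> 0) / D" for t
  have \<theta>c: "continuous_on {0..1} \<theta>"
    unfolding \<theta>_def \<phi>_def using D V(1) by (intro continuous_intros) auto
  have \<theta>m: "\<theta> s < \<theta> t" if "0 \<le> s" "s < t" "t \<le> 1" for s t
    using \<phi>_mono[OF that] D by (simp add: \<theta>_def divide_strict_right_mono)
  have \<theta>01: "\<theta> 0 = 0" "\<theta> 1 = 1" using D by (auto simp: \<theta>_def D_def)
  have inj: "inj_on \<theta> {0..1}" by (rule linorder_inj_onI) (use \<theta>m in \<open>auto simp: less_imp_neq\<close>)
  have img: "\<theta> ` {0..1} = {0..1}"
  proof
    show "\<theta> ` {0..1} \<subseteq> {0..1}"
    proof clarify
      fix t :: real assume "t \<in> {0..1}"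
      then show "\<theta> t \<in> {0..1}"
        using \<theta>m[of 0 t] \<theta>m[of t 1] \<theta>01 by (cases "t = 0"; cases "t = 1") auto
    qed
    show "{0..1} \<subseteq> \<theta> ` {0..1}"
    proof
      fix u :: real assume "u \<in> {0..1}"
      then obtain t where "0 \<le> t" "t \<le> 1" "\<theta> t = u" using IVT'[of \<theta> 0 u 1] \<theta>c \<theta>01 by auto
      then show "u \<in> \<theta> ` {0..1}" by auto
    qed
  qed
  define \<psi> where "\<psi> = inv_into {0..1} \<theta>"
  have \<psi>\<theta>: "\<psi> (\<theta> t) = t" if "t \<in> {0..1}" for t using inj that by (simp add: \<psi>_def)
  have \<theta>\<psi>: "\<psi> u \<in> {0..1}" "\<theta> (\<psi> u) = u" if "u \<in> {0..1}" for u
    unfolding \<psi>_def using that img by (metis inv_into_into, metis f_inv_into_f)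
  have \<psi>m: "\<psi> u \<le> \<psi> v" if "u \<in> {0..1}" "v \<in> {0..1}" "u \<le> v" for u v
  proof (rule ccontr)
    assume "\<not> \<psi> u \<le> \<psi> v"
    then have "\<theta> (\<psi> v) < \<theta> (\<psi> u)" using \<theta>\<psi>(1)[OF that(1)] \<theta>\<psi>(1)[OF that(2)] by (intro \<theta>m) auto
    then show False using \<theta>\<psi>(2) that by simp
  qed
  have est: "dist (r (\<psi> u)) (r (\<psi> v)) \<le> e m + 2 ^ (m + 2) * (1 + B m) * (v - u)"
    if "m \<le> n" "u \<in> {0..1}" "v \<in> {0..1}" "u \<le> v" for m u v
  proof -
    let ?s = "\<psi> u" and ?t = "\<psi> v"
    have st: "0 \<le> ?s" "?s \<le> ?t" "?t \<le> 1" using \<theta>\<psi>(1) \<psi>m that by auto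
    have vu: "v - u = (\<phi> ?t - \<phi> ?s) / D"
      using \<theta>\<psi>(2)[OF that(2)] \<theta>\<psi>(2)[OF that(3)] by (simp add: \<theta>_def diff_divide_distrib)
    have "\<phi> ?t - \<phi> ?s = D * (v - u)" using vu D by simp
    also have "\<dots> \<le> 2 * (v - u)" using D that(4) by (intro mult_right_mono) auto
    finally have "c m * (V m ?t - V m ?s) \<le> 2 * (v - u)" using \<phi>_inc[OF st that(1)] st by simp
    then have "V m ?t - V m ?s \<le> 2 * (v - u) / c m" using c(1)[of m] by (simp add: field_simps)
    \<comment> \<open>The factor is \<open>2 / c m\<close>, where the 2 comes from
      \<open>D \<le> 2\<close>.\<close>
    also have "\<dots> = 2 ^ (m + 2) * (1 + B m) * (v - u)"
      using B0[of m] by (simp add: c_def algebra_simps)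
    finally show ?thesis using V(5)[OF that(1) st] by simp
  qed
  show thesis
  proof (rule that[of \<psi>])
    have "continuous_on (\<theta> ` {0..1}) \<psi>"
      by (rule continuous_on_inv[OF \<theta>c]) (use \<psi>\<theta> in auto)
    then show "continuous_on {0..1} \<psi>" by (simp add: img)
    show "\<psi> \<in> {0..1} \<rightarrow> {0..1}" using \<theta>\<psi>(1) by auto
    show "\<psi> 0 = 0" "\<psi> 1 = 1" using \<psi>\<theta>[of 0] \<psi>\<theta>[of 1] \<theta>01 by auto
    show "mono_on {0..1} \<psi>" by (intro mono_onI \<psi>m)
    show "dist (r (\<psi> u)) (r (\<psi> v)) \<le> e m + 2 ^ (m + 2) * (1 + B m) * \<bar>u - v\<bar>"
      if "m \<le> n" "u \<in> {0..1}" "v \<in> {0..1}" for m u v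
      using est[OF that] est[OF that(1,3,2)] by (cases "u \<le> v") (auto simp: dist_commute)
  qed
qed

section \<open>Total oscillation\<close>

lemma gprof_eq: "gprof t = max (- 1) (min ((t + 1) / 2) 0) + min 1 (max ((t - 1) / 2) 0)"
  by (auto simp: gprof_def max_def min_def)

lemma tendsto_gPQ: "f \<longlonglongrightarrow> x \<Longrightarrow> (\<lambda>n. gPQ pq (f n)) \<longlonglongrightarrow> gPQ pq x"
  unfolding gPQ_def gprof_eq by (intro tendsto_intros) auto

definition osc_sum :: "(real \<Rightarrow> real^2) \<Rightarrow> linepair \<Rightarrow> real list \<Rightarrow> real" where
  "osc_sum f pq ts = - (\<Sum>i\<in>{1..<length ts}. gPQ pq (f (ts ! (i - 1))) * gPQ pq (f (ts ! i)))"

lemma osc_eq: "osc f pq = (SUP ts\<in>{ts. sorted ts \<and> set ts \<subseteq> {0..1}}. ereal (osc_sum f pq ts))"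
  unfolding osc_def osc_sum_def by (rule arg_cong[where f = Sup]) auto

lemma osc_nonneg: "0 \<le> osc f pq"
  unfolding osc_eq by (rule SUP_upper2[of "[]"]) (auto simp: osc_sum_def)

lemma osc_sum_le_osc: "sorted ts \<Longrightarrow> set ts \<subseteq> {0..1} \<Longrightarrow> ereal (osc_sum f pq ts) \<le> osc f pq"
  unfolding osc_eq by (rule SUP_upper) auto

text \<open>\<open>gPQ\<close> sees a point only through its inner product with
  \<open>fst pq\<close>, so the time change for this direction turns a sample of \<open>q\<close>
  into a sample of \<open>r\<close> with the same sum.\<close>

lemma osc_dominated:
  assumes "dominated q r"
  shows "osc q pq \<le> osc r pq"
proof -
  obtain \<sigma> where \<sigma>: "mono_on {0..1} \<sigma>" "\<And>t. t \<in> {0..1} \<Longrightarrow> \<sigma> t \<in> {0..1} \<and> fst pq \<bullet> q t = fst pq \<bullet> r (\<sigma> t)"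
    using assms unfolding dominated_def by meson
  show ?thesis
    unfolding osc_eq[of q]
  proof (rule SUP_least)
    fix ts :: "real list" assume "ts \<in> {ts. sorted ts \<and> set ts \<subseteq> {0..1}}"
    then have ts: "sorted ts" "set ts \<subseteq> {0..1}" by auto
    have "sorted (map \<sigma> ts)"
      unfolding sorted_iff_nth_mono_less
    proof (intro allI impI)
      fix i j assume ij: "i < j" "j < length (map \<sigma> ts)"
      then have m: "ts ! i \<in> set ts" "ts ! j \<in> set ts" by auto
      then have "ts ! i \<in> {0..1}" "ts ! j \<in> {0..1}" using ts(2) by blast+
      then show "map \<sigma> ts ! i \<le> map \<sigma> ts ! j"
        using ij ts mono_onD[OF \<sigma>(1), of "ts ! i" "ts ! j"] sorted_nth_mono[OF ts(1), of i j] by auto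
    qed
    moreover have "set (map \<sigma> ts) \<subseteq> {0..1}" using \<sigma>(2) ts(2) by auto
    moreover have "osc_sum q pq ts = osc_sum r pq (map \<sigma> ts)"
      unfolding osc_sum_def
    proof (intro arg_cong[where f = uminus] sum.cong)
      fix i assume "i \<in> {1..<length (map \<sigma> ts)}"
      then have i: "i - 1 < length ts" "i < length ts" by auto
      then have "ts ! (i - 1) \<in> set ts" "ts ! i \<in> set ts" by auto
      then have "ts ! (i - 1) \<in> {0..1}" "ts ! i \<in> {0..1}" using ts(2) by blast+
      then show "gPQ pq (q (ts ! (i - 1))) * gPQ pq (q (ts ! i)) =
          gPQ pq (r (map \<sigma> ts ! (i - 1))) * gPQ pq (r (map \<sigma> ts ! i))"
        using \<sigma>(2) i unfolding gPQ_def by simp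
    qed simp
    ultimately show "ereal (osc_sum q pq ts) \<le> osc r pq" using osc_sum_le_osc by metis
  qed
qed

lemma osc_ratio_real: "osc_ratio (ereal x) = x / (1 + x)"
  by (simp add: osc_ratio_def)

lemma ratio_mono: "0 \<le> x \<Longrightarrow> x \<le> y \<Longrightarrow> x / (1 + x) \<le> y / (1 + (y::real))"
  by (simp add: field_simps)

lemma osc_ratio_bounds: "0 \<le> x \<Longrightarrow> 0 \<le> osc_ratio x \<and> osc_ratio x \<le> 1"
  by (cases x) (auto simp: osc_ratio_def)

lemma osc_ratio_mono:
  assumes "0 \<le> x" "x \<le> y" shows "osc_ratio x \<le> osc_ratio y"
proof (cases y)
  case (real v)
  then obtain u where "x = ereal u" using assms by (cases x) auto
  then show ?thesis using assms real ratio_mono[of u v] by (simp add: osc_ratio_real)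
next
  case PInf
  then show ?thesis using osc_ratio_bounds[OF assms(1)] by (simp add: osc_ratio_def)
qed (use assms in auto)

lemma ratio_lipschitz:
  fixes u v :: real
  assumes "0 \<le> u" "0 \<le> v" "u \<le> v + k" "0 \<le> k"
  shows "u / (1 + u) \<le> v / (1 + v) + k"
proof -
  have "u / (1 + u) \<le> (v + k) / (1 + (v + k))" using assms by (intro ratio_mono) auto
  also have "\<dots> \<le> v / (1 + v) + k"
  proof -
    have "(v + k) / (1 + (v + k)) \<le> v / (1 + v) + k / (1 + v)"
      using assms by (simp add: add_divide_distrib[symmetric] frac_le)
    also have "k / (1 + v) \<le> k" using assms by (simp add: divide_le_eq mult_le_cancel_left1)
    finally show ?thesis by simp
  qed
  finally show ?thesis .
qed

lemma total_osc_summable: "summable (\<lambda>i. (1/2) ^ Suc i * osc_ratio (osc f (s i)))"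
proof (rule summable_comparison_test')
  show "summable (\<lambda>i. (1/2::real) ^ Suc i)" by (subst summable_Suc_iff) (simp add: summable_geometric)
  show "norm ((1/2) ^ Suc i * osc_ratio (osc f (s i))) \<le> (1/2) ^ Suc i" if "i \<ge> 0" for i
    using osc_ratio_bounds[OF osc_nonneg, of f "s i"] by (simp add: abs_mult mult_le_cancel_left1)
qed

lemma total_osc_nonneg: "0 \<le> total_osc s f"
  unfolding total_osc_def using osc_ratio_bounds[OF osc_nonneg] by (intro suminf_nonneg total_osc_summable) auto

lemma total_osc_dominated: "dominated q r \<Longrightarrow> total_osc s q \<le> total_osc s r"
  unfolding total_osc_def
  by (intro suminf_le total_osc_summable mult_left_mono osc_ratio_mono osc_nonneg osc_dominated) auto

text \<open>One finite sample nearly attains the supremum, and its sum converges under pointwise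
  convergence. Using \<open>osc_ratio\<close> treats infinite oscillation along with finite, and
  \<open>max 0\<close> keeps the argument where the ratio is monotone.\<close>

lemma osc_ratio_lsc:
  assumes lim: "\<And>t. t \<in> {0..1} \<Longrightarrow> (\<lambda>n. R n t) \<longlonglongrightarrow> q t" and "k > 0"
  shows "\<exists>N. \<forall>n\<ge>N. osc_ratio (osc q pq) \<le> osc_ratio (osc (R n) pq) + k"
proof -
  obtain ts where ts: "sorted ts" "set ts \<subseteq> {0..1}"
    "osc_ratio (osc q pq) \<le> max 0 (osc_sum q pq ts) / (1 + max 0 (osc_sum q pq ts)) + k / 2"
  proof (cases "osc q pq")
    case (real x)
    have "ereal (x - k / 2) < osc q pq" using real \<open>k > 0\<close> by simp
    then obtain ts where ts: "sorted ts" "set ts \<subseteq> {0..1}" "x - k / 2 < osc_sum q pq ts"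
      unfolding osc_eq less_SUP_iff by auto
    have "0 \<le> x" using osc_nonneg[of q pq] real by simp
    then have "x / (1 + x) \<le> max 0 (osc_sum q pq ts) / (1 + max 0 (osc_sum q pq ts)) + k / 2"
      using ts(3) \<open>k > 0\<close> by (intro ratio_lipschitz) auto
    then show ?thesis using real by (intro that[OF ts(1,2)]) (simp add: osc_ratio_real)
  next
    case PInf
    \<comment> \<open>Large enough for \<open>y / (1 + y)\<close> to be at least
      \<open>1 - k / 2\<close>.\<close>
    define y where "y = 2 / k"
    have y: "y > 0" using \<open>k > 0\<close> by (simp add: y_def)
    have "ereal y < osc q pq" using PInf by simp
    then obtain ts where ts: "sorted ts" "set ts \<subseteq> {0..1}" "y < osc_sum q pq ts"
      unfolding osc_eq less_SUP_iff by auto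
    have "1 - k / 2 \<le> y / (1 + y)" using \<open>k > 0\<close> by (simp add: y_def field_simps)
    also have "\<dots> \<le> max 0 (osc_sum q pq ts) / (1 + max 0 (osc_sum q pq ts))"
      using ts(3) y by (intro ratio_mono) auto
    finally show ?thesis using PInf by (intro that[OF ts(1,2)]) (simp add: osc_ratio_def)
  next
    case MInf
    then show ?thesis using osc_nonneg[of q pq] by simp
  qed
  have "(\<lambda>n. osc_sum (R n) pq ts) \<longlonglongrightarrow> osc_sum q pq ts"
    unfolding osc_sum_def
  proof (intro tendsto_minus tendsto_sum tendsto_mult tendsto_gPQ lim)
    fix i assume "i \<in> {1..<length ts}"
    then have "i - 1 < length ts" "i < length ts" by auto
    then have "ts ! (i - 1) \<in> set ts" "ts ! i \<in> set ts" by auto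
    then show "ts ! (i - 1) \<in> {0..1}" "ts ! i \<in> {0..1}" using ts(2) by blast+
  qed
  then obtain N where N: "\<And>n. n \<ge> N \<Longrightarrow> norm (osc_sum (R n) pq ts - osc_sum q pq ts) < k / 2"
    unfolding LIMSEQ_iff using \<open>k > 0\<close> by (metis half_gt_zero)
  have "osc_ratio (osc q pq) \<le> osc_ratio (osc (R n) pq) + k" if "n \<ge> N" for n
  proof -
    have "ereal (max 0 (osc_sum (R n) pq ts)) \<le> osc (R n) pq"
      using osc_nonneg[of "R n" pq] osc_sum_le_osc[OF ts(1,2), of "R n" pq] by (simp add: max_def zero_ereal_def)
    then have "osc_ratio (ereal (max 0 (osc_sum (R n) pq ts))) \<le> osc_ratio (osc (R n) pq)"
      by (intro osc_ratio_mono) (auto simp: zero_ereal_def)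
    then have "max 0 (osc_sum (R n) pq ts) / (1 + max 0 (osc_sum (R n) pq ts)) \<le> osc_ratio (osc (R n) pq)"
      by (simp only: osc_ratio_real)
    moreover have "max 0 (osc_sum q pq ts) / (1 + max 0 (osc_sum q pq ts)) \<le>
        max 0 (osc_sum (R n) pq ts) / (1 + max 0 (osc_sum (R n) pq ts)) + k / 2"
      using N[OF that] \<open>k > 0\<close> by (intro ratio_lipschitz) (auto simp: abs_if split: if_splits)
    ultimately show ?thesis using ts(3) by linarith
  qed
  then show ?thesis by blast
qed

text \<open>Each partial sum is lower semicontinuous; an error \<open>k\<close> in every term costs
  at most \<open>k\<close> in all, because the weights sum to at most 1.\<close>

lemma total_osc_lsc:
  assumes lim: "\<And>t. t \<in> {0..1} \<Longrightarrow> (\<lambda>n. R n t) \<longlonglongrightarrow> q t"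
    and T: "(\<lambda>n. total_osc s (R n)) \<longlonglongrightarrow> c"
  shows "total_osc s q \<le> c"
  unfolding total_osc_def
proof (rule suminf_le_const[OF total_osc_summable])
  fix N
  let ?w = "\<lambda>i::nat. (1/2::real) ^ Suc i"
  have w: "(\<Sum>i<N. ?w i) \<le> 1"
  proof -
    have "(\<Sum>i<N. ?w i) = 1 - (1/2) ^ N" by (induction N) (auto simp: field_simps)
    then show ?thesis by simp
  qed
  show "(\<Sum>i<N. ?w i * osc_ratio (osc q (s i))) \<le> c"
  proof (rule field_le_epsilon)
    fix k :: real assume k: "k > 0"
    have "\<forall>i. \<exists>M. \<forall>n\<ge>M. osc_ratio (osc q (s i)) \<le> osc_ratio (osc (R n) (s i)) + k"
      by (intro allI osc_ratio_lsc lim k)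
    then obtain M where M: "\<And>i n. n \<ge> M i \<Longrightarrow> osc_ratio (osc q (s i)) \<le> osc_ratio (osc (R n) (s i)) + k"
      by metis
    \<comment> \<open>The sum of the \<open>M i\<close> serves as a common threshold, being at least
      each of them.\<close>
    have *: "(\<Sum>i<N. ?w i * osc_ratio (osc q (s i))) \<le> total_osc s (R n) + k" if "n \<ge> (\<Sum>i<N. M i)" for n
    proof -
      have "(\<Sum>i<N. ?w i * osc_ratio (osc q (s i))) \<le> (\<Sum>i<N. ?w i * osc_ratio (osc (R n) (s i)) + ?w i * k)"
      proof (rule sum_mono)
        fix i assume "i \<in> {..<N}"
        then have "M i \<le> n" using that member_le_sum[of i "{..<N}" M] by simp
        then have "?w i * osc_ratio (osc q (s i)) \<le> ?w i * (osc_ratio (osc (R n) (s i)) + k)"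
          by (intro mult_left_mono M) auto
        then show "?w i * osc_ratio (osc q (s i)) \<le> ?w i * osc_ratio (osc (R n) (s i)) + ?w i * k"
          by (simp add: distrib_left)
      qed
      also have "\<dots> = (\<Sum>i<N. ?w i * osc_ratio (osc (R n) (s i))) + (\<Sum>i<N. ?w i) * k"
        by (simp add: sum.distrib sum_distrib_right)
      also have "(\<Sum>i<N. ?w i * osc_ratio (osc (R n) (s i))) \<le> total_osc s (R n)"
        unfolding total_osc_def using osc_ratio_bounds[OF osc_nonneg] by (intro sum_le_suminf total_osc_summable) auto
      also have "(\<Sum>i<N. ?w i) * k \<le> 1 * k" using w k by (intro mult_right_mono) auto
      finally show ?thesis by simp
    qed
    show "(\<Sum>i<N. ?w i * osc_ratio (osc q (s i))) \<le> c + k"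
      by (rule LIMSEQ_le_const[OF tendsto_add[OF T tendsto_const]]) (use * in blast)
  qed
qed

section \<open>Jumps bounded through crossings of grid strips\<close>

text \<open>Both levels come from the interior of a half of the strip that \<open>x0\<close> avoids;
  they are placed at multiples of an eighth of the width, and \<open>d\<close> is one
  eighth.\<close>

lemma levels_in_strip:
  fixes \<alpha> \<beta> x0 :: real
  assumes "\<alpha> < \<beta>"
  obtains c1 c2 d where "d > 0" "c1 < c2" "c1 \<noteq> x0" "c2 \<noteq> x0" "\<alpha> + d \<le> c1" "c2 + d \<le> \<beta>"
proof (cases "x0 \<le> (\<alpha> + \<beta>) / 2")
  case True
  show ?thesis
    by (rule that[of "(\<beta> - \<alpha>) / 8" "\<alpha> + 5/8 * (\<beta> - \<alpha>)" "\<alpha> + 6/8 * (\<beta> - \<alpha>)"]) (use True assms in \<open>auto simp: field_simps\<close>)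
next
  case False
  show ?thesis
    by (rule that[of "(\<beta> - \<alpha>) / 8" "\<alpha> + 2/8 * (\<beta> - \<alpha>)" "\<alpha> + 3/8 * (\<beta> - \<alpha>)"]) (use False assms in \<open>auto simp: field_simps\<close>)
qed

text \<open>The order of quantifiers is the point: the tightness conditions \<open>K\<close> and the
  bound \<open>b\<close> are fixed by \<open>p\<close> and the strip, before \<open>r\<close> is
  given.\<close>

lemma strip_crossing_bound:
  fixes p :: "real \<Rightarrow> real^2"
  assumes "path p" "a \<noteq> 0" "\<alpha> < \<beta>"
  obtains K b where "finite K" "\<And>a c d. (a, c, d) \<in> K \<Longrightarrow> d > 0"
    "\<And>r ts I. homotopic_paths X p r \<Longrightarrow> (\<And>a c d. (a, c, d) \<in> K \<Longrightarrow> tight X a c d r) \<Longrightarrow>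
      sorted ts \<Longrightarrow> set ts \<subseteq> {0..1} \<Longrightarrow> I \<subseteq> {1..<length ts} \<Longrightarrow>
      (\<And>i. i \<in> I \<Longrightarrow> crosses a \<alpha> \<beta> r (ts ! (i - 1)) (ts ! i)) \<Longrightarrow> card I \<le> b"
proof -
  obtain c1 c2 d where c: "d > 0" "c1 < c2" "c1 \<noteq> a \<bullet> p 0" "c2 \<noteq> a \<bullet> p 0" "\<alpha> + d \<le> c1" "c2 + d \<le> \<beta>"
    by (rule levels_in_strip[OF assms(3)])
  have "c2 - c1 > 0" using c by simp
  then obtain \<delta> where \<delta>: "\<delta> > 0" "\<And>s t. s \<in> {0..1} \<Longrightarrow> t \<in> {0..1} \<Longrightarrow> \<bar>s - t\<bar> < \<delta> \<Longrightarrow> \<bar>a \<bullet> p s - a \<bullet> p t\<bar> < c2 - c1"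
    using inner_path_modulus[OF assms(1), of "c2 - c1" a] by blast
  show thesis
  proof (rule that[of "{(a, c1, d), (a, c2, d)}" "Suc (nat \<lfloor>2 / \<delta>\<rfloor>)"])
    fix r ts I
    assume *: "homotopic_paths X p r" "\<And>a' c d'. (a', c, d') \<in> {(a, c1, d), (a, c2, d)} \<Longrightarrow> tight X a' c d' r"
      "sorted ts" "set ts \<subseteq> {0..1}" "I \<subseteq> {1..<length ts}"
      "\<And>i. i \<in> I \<Longrightarrow> crosses a \<alpha> \<beta> r (ts ! (i - 1)) (ts ! i)"
    have "tight X a c1 d r" "tight X a c2 d r" using *(2) by simp_all
    from crossing_bound[OF *(1) assms(2) c(1) this c(2-6) \<delta> *(3-6)]
    show "card I \<le> Suc (nat \<lfloor>2 / \<delta>\<rfloor>)" by blast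
  qed (use c in auto)
qed

text \<open>A jump beyond \<open>4 * h\<close> moves some coordinate by more than
  \<open>2 * h\<close>, enough to pass over a whole strip of the grid of width \<open>h\<close>; the
  bound \<open>M\<close> leaves finitely many strips.\<close>

lemma jump_imp_crosses:
  fixes r :: "real \<Rightarrow> real^2"
  assumes "h > 0" "4 * h < dist (r s) (r t)" "norm (r s) \<le> M" "norm (r t) \<le> M" "M / h + 1 \<le> of_int N"
  shows "\<exists>j. \<exists>k\<in>{- N..N}. crosses (axis j 1) (of_int k * h) ((of_int k + 1) * h) r s t"
proof -
  have "dist (r s) (r t) \<le> \<bar>r s $ 1 - r t $ 1\<bar> + \<bar>r s $ 2 - r t $ 2\<bar>"
    using norm_le_l1_cart[of "r s - r t"] by (simp add: dist_norm sum_2)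
  then have "2 * h < \<bar>r s $ 1 - r t $ 1\<bar> \<or> 2 * h < \<bar>r s $ 2 - r t $ 2\<bar>" using assms(2) by linarith
  then obtain j where j: "2 * h < \<bar>r s $ j - r t $ j\<bar>" by blast
  define u where "u = min (r s $ j) (r t $ j)"
  define w where "w = max (r s $ j) (r t $ j)"
  have uw: "u + 2 * h < w" using j by (auto simp: u_def w_def abs_if min_def max_def split: if_splits)
  define k where "k = \<lceil>u / h\<rceil>"
  have k: "u \<le> of_int k * h" "of_int k * h < u + h"
  proof -
    have "u / h \<le> of_int k" "of_int k < u / h + 1" by (auto simp: k_def) linarith
    then show "u \<le> of_int k * h" "of_int k * h < u + h" using \<open>h > 0\<close>
      by (simp_all add: pos_divide_le_eq field_simps)
  qed
  have "\<bar>r s $ j\<bar> \<le> M" "\<bar>r t $ j\<bar> \<le> M"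
    using component_le_norm_cart[of "r s" j] component_le_norm_cart[of "r t" j] assms(3,4) by linarith+
  then have "\<bar>u\<bar> \<le> M" by (auto simp: u_def min_def)
  then have "\<bar>u / h\<bar> \<le> M / h" using \<open>h > 0\<close> by (simp add: divide_right_mono)
  then have "- (M / h) \<le> u / h" "u / h \<le> M / h" by (simp_all only: abs_le_iff) linarith
  moreover have "u / h \<le> of_int k" "of_int k < u / h + 1" by (auto simp: k_def) linarith
  ultimately have "real_of_int (- N) \<le> of_int k" "real_of_int k \<le> of_int N" using assms(5) by simp_all
  then have "k \<in> {- N..N}" by (simp only: of_int_le_iff atLeastAtMost_iff)
  moreover have "crosses (axis j 1) (of_int k * h) ((of_int k + 1) * h) r s t"
    using k uw unfolding crosses_def by (auto simp: inner_axis' u_def w_def min_def max_def algebra_simps split: if_splits)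
  ultimately show ?thesis by blast
qed

text \<open>Only jumps beyond \<open>e\<close> contribute. Each crosses one of finitely many grid
  strips, so \<open>strip_crossing_bound\<close> limits their number, and each is at most
  \<open>2 * M\<close>.\<close>

lemma jump_sum_bound:
  fixes p :: "real \<Rightarrow> real^2"
  assumes "bounded X" "path p" "e > 0"
  obtains K B where "finite K" "\<And>a c d. (a, c, d) \<in> K \<Longrightarrow> d > 0" "B \<ge> 0"
    "\<And>r ts. homotopic_paths X p r \<Longrightarrow> (\<And>a c d. (a, c, d) \<in> K \<Longrightarrow> tight X a c d r) \<Longrightarrow>
      sorted ts \<Longrightarrow> set ts \<subseteq> {0..1} \<Longrightarrow> jump_sum e r ts \<le> B"
proof -
  obtain M where M: "\<And>x. x \<in> X \<Longrightarrow> norm x \<le> M" "M > 0" using \<open>bounded X\<close> bounded_pos by metis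
  define h where "h = e / 4"
  have h: "h > 0" "4 * h = e" using \<open>e > 0\<close> by (auto simp: h_def)
  define N where "N = \<lceil>M / h\<rceil> + 1"
  have N: "M / h + 1 \<le> of_int N" unfolding N_def by simp
  define S where "S = (UNIV :: 2 set) \<times> {- N..N}"
  have finS: "finite S" by (simp add: S_def)
  define P where "P K b j k \<longleftrightarrow> finite K \<and> (\<forall>a c d. (a, c, d) \<in> K \<longrightarrow> d > 0) \<and>
    (\<forall>r ts I. homotopic_paths X p r \<longrightarrow> (\<forall>a c d. (a, c, d) \<in> K \<longrightarrow> tight X a c d r) \<longrightarrow>
      sorted ts \<longrightarrow> set ts \<subseteq> {0..1} \<longrightarrow> I \<subseteq> {1..<length ts} \<longrightarrow>
      (\<forall>i\<in>I. crosses (axis j 1) (of_int k * h) ((of_int k + 1) * h) r (ts ! (i - 1)) (ts ! i)) \<longrightarrow> card I \<le> b)"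
    for K and b :: nat and j :: 2 and k :: int
  have "\<exists>K b. P K b j k" for j k
  proof -
    have "axis j (1::real) \<noteq> 0" "of_int k * h < (of_int k + 1) * h" using h by (auto simp: axis_eq_0_iff algebra_simps)
    then show ?thesis
    proof (rule strip_crossing_bound[OF assms(2), where X = X])
      fix K b
      assume *: "finite K" "\<And>a c d. (a, c, d) \<in> K \<Longrightarrow> d > 0"
        "\<And>r ts I. homotopic_paths X p r \<Longrightarrow> (\<And>a c d. (a, c, d) \<in> K \<Longrightarrow> tight X a c d r) \<Longrightarrow>
        sorted ts \<Longrightarrow> set ts \<subseteq> {0..1} \<Longrightarrow> I \<subseteq> {1..<length ts} \<Longrightarrow>
        (\<And>i. i \<in> I \<Longrightarrow> crosses (axis j 1) (of_int k * h) ((of_int k + 1) * h) r (ts ! (i - 1)) (ts ! i)) \<Longrightarrow> card I \<le> b"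
      have "P K b j k"
        unfolding P_def
      proof (intro conjI allI impI)
        show "finite K" by (rule *(1))
        show "d > 0" if "(a, c, d) \<in> K" for a c d using that by (rule *(2))
        fix r ts I
        assume h: "homotopic_paths X p r" and t: "\<forall>a c d. (a, c, d) \<in> K \<longrightarrow> tight X a c d r"
          and ts: "sorted ts" "set ts \<subseteq> {0..1}" "I \<subseteq> {1..<length ts}"
          and c: "\<forall>i\<in>I. crosses (axis j 1) (of_int k * h) ((of_int k + 1) * h) r (ts ! (i - 1)) (ts ! i)"
        show "card I \<le> b" by (rule *(3)[OF h _ ts]) (use t c in auto)
      qed
      then show ?thesis by blast
    qed
  qed
  then obtain K b where Kb: "\<And>j k. P (K j k) (b j k) j k" by metis
  let ?K = "\<Union>(j, k)\<in>S. K j k"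
  define b' where "b' = (\<Sum>(j, k)\<in>S. b j k)"
  let ?B = "real b' * (2 * M)"
  show thesis
  proof (rule that[of ?K ?B])
    show "finite ?K" using finS Kb by (auto simp: P_def)
    show "d > 0" if "(a, c, d) \<in> ?K" for a c d using that Kb by (auto simp: P_def)
    show "?B \<ge> 0" using M by simp
    fix r :: "real \<Rightarrow> real^2" and ts :: "real list"
    assume r: "homotopic_paths X p r" and tight: "\<And>a c d. (a, c, d) \<in> ?K \<Longrightarrow> tight X a c d r"
      and ts: "sorted ts" "set ts \<subseteq> {0..1}"
    have rM: "norm (r t) \<le> M" if "t \<in> {0..1}" for t
    proof -
      have "r t \<in> path_image r" using that unfolding path_image_def by (rule imageI)
      then show ?thesis using homotopic_paths_imp_subset[OF r] M(1) by blast
    qed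
    have ti: "ts ! i \<in> {0..1}" if "i < length ts" for i using ts(2) that nth_mem by blast
    let ?c = "\<lambda>j k i. crosses (axis j 1) (of_int k * h) ((of_int k + 1) * h) r (ts ! (i - 1)) (ts ! i)"
    define I where "I = {i \<in> {1..<length ts}. e < dist (r (ts ! (i - 1))) (r (ts ! i))}"
    define J where "J = (\<lambda>(j, k). {i \<in> {1..<length ts}. ?c j k i})"
    have "I \<subseteq> (\<Union>s\<in>S. J s)"
    proof
      fix i assume i: "i \<in> I"
      then have l: "i - 1 < length ts" "i < length ts" by (auto simp: I_def)
      have "\<exists>j. \<exists>k\<in>{- N..N}. ?c j k i"
        using i h(2) by (intro jump_imp_crosses[OF h(1) _ rM[OF ti[OF l(1)]] rM[OF ti[OF l(2)]] N]) (auto simp: I_def)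
      then show "i \<in> (\<Union>s\<in>S. J s)" using i by (auto simp: I_def J_def S_def)
    qed
    moreover have finJ: "finite (\<Union>s\<in>S. J s)" using finS by (auto simp: J_def)
    ultimately have "card I \<le> card (\<Union>s\<in>S. J s)" by (intro card_mono)
    also have "\<dots> \<le> (\<Sum>s\<in>S. card (J s))" by (rule card_UN_le[OF finS])
    also have "\<dots> \<le> (\<Sum>(j, k)\<in>S. b j k)"
    proof (rule sum_mono)
      fix s assume "s \<in> S"
      obtain j k where s: "s = (j, k)" by (cases s)
      have t: "\<forall>a c d. (a, c, d) \<in> K j k \<longrightarrow> tight X a c d r" using tight \<open>s \<in> S\<close> s by blast
      have J: "J (j, k) \<subseteq> {1..<length ts}" "\<forall>i\<in>J (j, k). ?c j k i" by (auto simp: J_def)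
      have "card (J (j, k)) \<le> b j k"
        using Kb[of j k] r t ts J unfolding P_def by blast
      then show "card (J s) \<le> (case s of (j, k) \<Rightarrow> b j k)" by (simp add: s)
    qed
    finally have cI: "card I \<le> b'" by (simp only: b'_def)
    have "jump_sum e r ts = (\<Sum>i\<in>{1..<length ts}. max 0 (dist (r (ts ! (i - 1))) (r (ts ! i)) - e))"
      by (rule jump_sum_eq_sum)
    also have "\<dots> = (\<Sum>i\<in>I. max 0 (dist (r (ts ! (i - 1))) (r (ts ! i)) - e))"
      by (rule sum.mono_neutral_right) (auto simp: I_def)
    also have "\<dots> \<le> (\<Sum>i\<in>I. 2 * M)"
    proof (rule sum_mono)
      fix i assume "i \<in> I"
      then have l: "i - 1 < length ts" "i < length ts" by (auto simp: I_def)
      have "dist (r (ts ! (i - 1))) (r (ts ! i)) \<le> norm (r (ts ! (i - 1))) + norm (r (ts ! i))"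
        by (simp add: dist_norm norm_triangle_ineq4)
      then show "max 0 (dist (r (ts ! (i - 1))) (r (ts ! i)) - e) \<le> 2 * M"
        using rM[OF ti[OF l(1)]] rM[OF ti[OF l(2)]] M(2) \<open>e > 0\<close> by simp
    qed
    also have "\<dots> = real (card I) * (2 * M)" by simp
    also have "\<dots> \<le> ?B" using cI M(2) by (intro mult_right_mono) auto
    finally show "jump_sum e r ts \<le> ?B" .
  qed
qed

section \<open>Limits of paths in one homotopy class\<close>

lemma equicontinuous_joinpaths:
  fixes R :: "nat \<Rightarrow> real \<Rightarrow> 'a::real_normed_vector"
  assumes R: "\<And>e. e > 0 \<Longrightarrow> \<exists>d>0. \<forall>n. \<forall>s\<in>{0..1}. \<forall>t\<in>{0..1}. \<bar>s - t\<bar> < d \<longrightarrow> norm (R n s - R n t) < e"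
    and p: "path p" and joined: "\<And>n. R n 1 = p 0" and "e > 0"
  shows "\<exists>d>0. \<forall>n. \<forall>s\<in>{0..1}. \<forall>t\<in>{0..1}. \<bar>s - t\<bar> < d \<longrightarrow> norm ((R n +++ p) s - (R n +++ p) t) < e"
proof -
  have e2: "e / 2 > 0" using \<open>e > 0\<close> by simp
  obtain d1 where d1: "d1 > 0" "\<And>n s t. s \<in> {0..1} \<Longrightarrow> t \<in> {0..1} \<Longrightarrow> \<bar>s - t\<bar> < d1 \<Longrightarrow> norm (R n s - R n t) < e / 2"
    using R[OF e2] by blast
  have "uniformly_continuous_on {0..1} p" using p unfolding path_def by (intro compact_uniformly_continuous) auto
  then obtain d2 where d2: "d2 > 0" "\<And>s t. s \<in> {0..1} \<Longrightarrow> t \<in> {0..1} \<Longrightarrow> dist t s < d2 \<Longrightarrow> dist (p t) (p s) < e / 2"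
    using e2 unfolding uniformly_continuous_on_def by metis
  define d where "d = min d1 d2 / 2"
  have d: "d > 0" "2 * d \<le> d1" "2 * d \<le> d2" using d1 d2 by (auto simp: d_def)
  have *: "norm ((R n +++ p) s - (R n +++ p) t) < e" if st: "s \<in> {0..1}" "t \<in> {0..1}" "s \<le> t" "t - s < d" for n s t
  proof -
    consider "t \<le> 1/2" | "s \<le> 1/2" "1/2 < t" | "1/2 < s" by linarith
    then show ?thesis
    proof cases
      case 1
      then have "norm (R n (2 * s) - R n (2 * t)) < e / 2" using st d by (intro d1(2)) auto
      then show ?thesis using 1 st e2 by (simp add: joinpaths_def)
    next
      case 2
      have "norm (R n (2 * s) - R n 1) < e / 2" using 2 st d by (intro d1(2)) auto
      moreover have "dist (p 0) (p (2 * t - 1)) < e / 2" using 2 st d by (intro d2(2)) (auto simp: dist_real_def)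
      ultimately have "norm ((R n (2 * s) - R n 1) + (p 0 - p (2 * t - 1))) < e"
        by (intro norm_triangle_lt) (simp add: dist_norm)
      then show ?thesis using 2 joined by (simp add: joinpaths_def)
    next
      case 3
      then have "dist (p (2 * s - 1)) (p (2 * t - 1)) < e / 2" using st d by (intro d2(2)) (auto simp: dist_real_def)
      then show ?thesis using 3 st e2 by (simp add: joinpaths_def dist_norm)
    qed
  qed
  have "norm ((R n +++ p) s - (R n +++ p) t) < e" if "s \<in> {0..1}" "t \<in> {0..1}" "\<bar>s - t\<bar> < d" for n s t
    using *[of s t n] *[of t s n] that by (cases "s \<le> t") (auto simp: norm_minus_commute)
  with d(1) show ?thesis by blast
qed

text \<open>Closing each \<open>R n\<close> by the reversed \<open>p\<close> gives null-homotopic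
  loops with a common modulus; \<open>null_homotopic_limit\<close> applies to their limit, which is
  then split into \<open>q\<close> and the reversed \<open>p\<close> again.\<close>

lemma homotopic_paths_limit:
  fixes p q :: "real \<Rightarrow> real^2"
  assumes "compact X" and R: "\<And>n. homotopic_paths X p (R n)"
    and eqc: "\<And>e. e > 0 \<Longrightarrow> \<exists>d>0. \<forall>n. \<forall>s\<in>{0..1}. \<forall>t\<in>{0..1}. \<bar>s - t\<bar> < d \<longrightarrow> norm (R n s - R n t) < e"
    and lim: "\<And>t. t \<in> {0..1} \<Longrightarrow> (\<lambda>n. R n t) \<longlonglongrightarrow> q t"
  shows "homotopic_paths X p q"
proof -
  have p: "path p" using R homotopic_paths_imp_path by blast
  define f where "f n = R n +++ reversepath p" for n
  define g where "g = q +++ reversepath p"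
  have fin: "R n 1 = p 1" for n
    using homotopic_paths_imp_pathfinish[OF R[of n]] by (simp add: pathfinish_def)
  have "homotopic_paths X g (linepath (g 0) (g 0))"
  proof (rule null_homotopic_limit[OF \<open>compact X\<close>])
    show "homotopic_paths X (f n) (linepath (f n 0) (f n 0))" for n
      unfolding f_def by (rule homotopic_paths_imp_null_loop(1)[OF R])
    show "\<exists>d>0. \<forall>n. \<forall>s\<in>{0..1}. \<forall>t\<in>{0..1}. \<bar>s - t\<bar> < d \<longrightarrow> norm (f n s - f n t) < e" if "e > 0" for e
      unfolding f_def
    proof (rule equicontinuous_joinpaths[OF eqc _ _ that])
      show "path (reversepath p)" using p by simp
      show "R n 1 = reversepath p 0" for n using fin by (simp add: reversepath_def)
    qed
    show "(\<lambda>n. f n t) \<longlonglongrightarrow> g t" if "t \<in> {0..1}" for t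
      using that lim[of "2 * t"] unfolding f_def g_def joinpaths_def by (cases "t \<le> 1/2") auto
  qed
  then have "homotopic_loops X g (linepath (g 0) (g 0))"
  proof (rule homotopic_paths_imp_homotopic_loops)
    show "pathfinish g = pathstart g"
    proof -
      have "q 0 = p 0"
      proof (rule LIMSEQ_unique[OF lim])
        have "R n 0 = p 0" for n using homotopic_paths_imp_pathstart[OF R[of n]] by (simp add: pathstart_def)
        then show "(\<lambda>n. R n 0) \<longlonglongrightarrow> p 0" by simp
      qed simp
      then show ?thesis by (simp add: g_def pathstart_def pathfinish_def joinpaths_def reversepath_def)
    qed
  qed (simp add: pathstart_def)
  then have "homotopic_paths X q p" unfolding g_def using p by (rule homotopic_paths_loop_parts)
  then show ?thesis by (rule homotopic_paths_sym)
qed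

text \<open>\<open>tighten\<close> admits finitely many conditions, so the path with index
  \<open>n\<close> is tightened for the scales \<open>m \<le> n\<close> only. The estimate at scale
  \<open>m\<close> holds from index \<open>m\<close> on; the earlier paths are finitely many, each
  uniformly continuous.\<close>

lemma equicontinuous_tightening:
  fixes p :: "real \<Rightarrow> real^2" and r :: "nat \<Rightarrow> real \<Rightarrow> real^2"
  assumes "bounded X" "path p" and T: "\<And>n. homotopic_paths X p (r n)"
  obtains R where "\<And>n. homotopic_paths X p (R n)" "\<And>n. dominated (R n) (r n)"
    "\<And>e. e > 0 \<Longrightarrow> \<exists>d>0. \<forall>n. \<forall>s\<in>{0..1}. \<forall>t\<in>{0..1}. \<bar>s - t\<bar> < d \<longrightarrow> norm (R n s - R n t) < e"
proof -
  define e where "e m = inverse (real (Suc m))" for m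
  have e: "e m > 0" for m by (simp add: e_def)
  define P where "P m K B \<longleftrightarrow> finite K \<and> (\<forall>a c d. (a, c, d) \<in> K \<longrightarrow> d > 0) \<and> 0 \<le> B \<and>
    (\<forall>r ts. homotopic_paths X p r \<longrightarrow> (\<forall>a c d. (a, c, d) \<in> K \<longrightarrow> tight X a c d r) \<longrightarrow>
      sorted ts \<longrightarrow> set ts \<subseteq> {0..1} \<longrightarrow> jump_sum (e m) r ts \<le> B)" for m and K :: "((real^2) \<times> real \<times> real) set" and B
  have "\<exists>K B. P m K B" for m
  proof (rule jump_sum_bound[OF assms(1,2) e[of m]])
    fix K B
    assume *: "finite K" "\<And>a c d. (a, c, d) \<in> K \<Longrightarrow> d > 0" "B \<ge> 0"
    "\<And>r ts. homotopic_paths X p r \<Longrightarrow> (\<And>a c d. (a, c, d) \<in> K \<Longrightarrow> tight X a c d r) \<Longrightarrow>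
      sorted ts \<Longrightarrow> set ts \<subseteq> {0..1} \<Longrightarrow> jump_sum (e m) r ts \<le> B"
    have "P m K B"
      unfolding P_def
    proof (intro conjI allI impI)
      show "finite K" "0 \<le> B" by (rule *)+
      show "d > 0" if "(a, c, d) \<in> K" for a c d using that by (rule *(2))
      fix r :: "real \<Rightarrow> real^2" and ts :: "real list"
      assume h: "homotopic_paths X p r" and t: "\<forall>a c d. (a, c, d) \<in> K \<longrightarrow> tight X a c d r"
        and ts: "sorted ts" "set ts \<subseteq> {0..1}"
      show "jump_sum (e m) r ts \<le> B" by (rule *(4)[OF h _ ts]) (use t in auto)
    qed
    then show ?thesis by blast
  qed
  then obtain K B where KB: "\<And>m. P m (K m) (B m)" by metis
  have B0: "0 \<le> B m" for m using KB[of m] by (simp add: P_def)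
  have step: "\<exists>R. homotopic_paths X p R \<and> dominated R (r n) \<and>
    (\<forall>m\<le>n. \<forall>u\<in>{0..1}. \<forall>v\<in>{0..1}. dist (R u) (R v) \<le> e m + 2 ^ (m + 2) * (1 + B m) * \<bar>u - v\<bar>)" for n
  proof -
    let ?K = "\<Union>m\<le>n. K m"
    have "finite ?K" using KB by (auto simp: P_def)
    moreover have "d > 0" if "(a, c, d) \<in> ?K" for a c d using that KB by (auto simp: P_def)
    ultimately obtain q where q: "homotopic_paths X p q" "dominated q (r n)"
      "\<And>a c d. (a, c, d) \<in> ?K \<Longrightarrow> tight X a c d q"
      using tighten[of ?K X p "r n"] T by blast
    have pq: "path q" "path_image q \<subseteq> X"
      using q(1) homotopic_paths_imp_path homotopic_paths_imp_subset by blast+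
    have js: "jump_sum (e m) q ts \<le> B m" if "m \<le> n" "sorted ts" "set ts \<subseteq> {0..1}" for m ts
    proof -
      have "\<forall>a c d. (a, c, d) \<in> K m \<longrightarrow> tight X a c d q" using q(3) that(1) by blast
      then show ?thesis using KB[of m] q(1) that unfolding P_def by blast
    qed
    show ?thesis
    proof (rule reparametrize_equicontinuous[where r = q and e = e and B = B and n = n])
      show "continuous_on {0..1} q" using pq(1) by (simp add: path_def)
      show "e m > 0" "0 \<le> B m" for m by (rule e, rule B0)
      show "jump_sum (e m) q ts \<le> B m" if "m \<le> n" "sorted ts" "set ts \<subseteq> {0..1}" for m ts
        using that by (rule js)
      fix \<psi> :: "real \<Rightarrow> real"
      assume \<psi>: "continuous_on {0..1} \<psi>" "\<psi> \<in> {0..1} \<rightarrow> {0..1}" "\<psi> 0 = 0" "\<psi> 1 = 1" "mono_on {0..1} \<psi>"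
        "\<And>m u v. m \<le> n \<Longrightarrow> u \<in> {0..1} \<Longrightarrow> v \<in> {0..1} \<Longrightarrow> dist (q (\<psi> u)) (q (\<psi> v)) \<le> e m + 2 ^ (m + 2) * (1 + B m) * \<bar>u - v\<bar>"
      have "homotopic_paths X q (q \<circ> \<psi>)"
        by (rule homotopic_paths_reparametrize[OF pq \<psi>(1-4)]) simp
      then have "homotopic_paths X p (q \<circ> \<psi>)" using q(1) homotopic_paths_trans by blast
      moreover have "dominated (q \<circ> \<psi>) q"
        unfolding dominated_def using \<psi>(2,5) by (intro allI exI[of _ \<psi>]) auto
      then have "dominated (q \<circ> \<psi>) (r n)" using q(2) dominated_trans by blast
      ultimately show ?thesis using \<psi>(6) by (intro exI[of _ "q \<circ> \<psi>"]) auto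
    qed
  qed
  then obtain R where R: "\<And>n. homotopic_paths X p (R n)" "\<And>n. dominated (R n) (r n)"
    "\<And>n m u v. m \<le> n \<Longrightarrow> u \<in> {0..1} \<Longrightarrow> v \<in> {0..1} \<Longrightarrow> dist (R n u) (R n v) \<le> e m + 2 ^ (m + 2) * (1 + B m) * \<bar>u - v\<bar>"
    by metis
  show thesis
  proof (rule that[OF R(1,2)])
    fix \<epsilon> :: real assume "\<epsilon> > 0"
    then obtain m where m: "e m < \<epsilon> / 2" using reals_Archimedean[of "\<epsilon> / 2"] by (auto simp: e_def)
    define C where "C = 2 ^ (m + 2) * (1 + B m)"
    have C: "C > 0" using B0[of m] by (simp add: C_def)
    have "\<exists>d>0. \<forall>s\<in>{0..1}. \<forall>t\<in>{0..1}. \<bar>s - t\<bar> < d \<longrightarrow> norm (R n s - R n t) < \<epsilon>" for n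
    proof -
      have "path (R n)" using R(1) homotopic_paths_imp_path by blast
      then have "uniformly_continuous_on {0..1} (R n)" unfolding path_def by (intro compact_uniformly_continuous) auto
      then show ?thesis using \<open>\<epsilon> > 0\<close> unfolding uniformly_continuous_on_def dist_norm real_norm_def by metis
    qed
    then obtain D where D: "\<And>n. D n > 0"
      "\<And>n s t. s \<in> {0..1} \<Longrightarrow> t \<in> {0..1} \<Longrightarrow> \<bar>s - t\<bar> < D n \<Longrightarrow> norm (R n s - R n t) < \<epsilon>"
      by metis
    \<comment> \<open>The \<open>D n\<close> provide for the indices below \<open>m\<close>, and
      \<open>\<epsilon> / (2 * C)\<close> for all others.\<close>
    define d where "d = Min (insert (\<epsilon> / (2 * C)) (D ` {..<m}))"
    have d: "d > 0" "d \<le> \<epsilon> / (2 * C)" "\<And>n. n < m \<Longrightarrow> d \<le> D n"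
      using D(1) C \<open>\<epsilon> > 0\<close> by (auto simp: d_def Min_gr_iff)
    have "norm (R n s - R n t) < \<epsilon>" if st: "s \<in> {0..1}" "t \<in> {0..1}" "\<bar>s - t\<bar> < d" for n s t
    proof (cases "n < m")
      case True
      then show ?thesis using D(2)[OF st(1,2), of n] d(3)[OF True] st(3) by simp
    next
      case False
      then have "dist (R n s) (R n t) \<le> e m + C * \<bar>s - t\<bar>" using R(3)[of m n s t] st by (simp add: C_def)
      also have "C * \<bar>s - t\<bar> \<le> C * (\<epsilon> / (2 * C))" using st(3) d(2) C by (intro mult_left_mono) auto
      also have "C * (\<epsilon> / (2 * C)) = \<epsilon> / 2" using C by simp
      finally show ?thesis using m by (simp add: dist_norm)
    qed
    with d(1) show "\<exists>d>0. \<forall>n. \<forall>s\<in>{0..1}. \<forall>t\<in>{0..1}. \<bar>s - t\<bar> < d \<longrightarrow> norm (R n s - R n t) < \<epsilon>" by blast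
  qed
qed

theorem theorem4p4:
  fixes X :: "(real^2) set" and s :: "nat \<Rightarrow> linepair" and p :: "real \<Rightarrow> real^2"
  assumes "compact X" and "connected X"
    and "dense_linepairs s"
    and "path p" and "path_image p \<subseteq> X"
  shows "\<exists>q. path q \<and> path_image q \<subseteq> X \<and> homotopic_paths X p q \<and>
           (\<forall>r. path r \<and> path_image r \<subseteq> X \<and> homotopic_paths X p r
                \<longrightarrow> total_osc s q \<le> total_osc s r)"
proof -
  define A where "A = total_osc s ` {r. homotopic_paths X p r}"
  have pp: "homotopic_paths X p p" using assms(4,5) by simp
  then have ne_A: "A \<noteq> {}" unfolding A_def by blast
  have bdd_A: "bdd_below A"
    by (rule bdd_belowI[of _ 0]) (auto simp: A_def total_osc_nonneg)
  define c where "c = Inf A"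
  have "\<exists>r. homotopic_paths X p r \<and> total_osc s r < c + inverse (real (Suc n))" for n
  proof -
    have "Inf A < c + inverse (real (Suc n))" by (simp add: c_def)
    from cInf_lessD[OF ne_A this] show ?thesis by (auto simp: A_def)
  qed
  then obtain r where r: "\<And>n. homotopic_paths X p (r n)" "\<And>n. total_osc s (r n) < c + inverse (real (Suc n))"
    by metis
  obtain R where R: "\<And>n. homotopic_paths X p (R n)" "\<And>n. dominated (R n) (r n)"
    and eqc: "\<And>e. e > 0 \<Longrightarrow> \<exists>d>0. \<forall>n. \<forall>s\<in>{0..1}. \<forall>t\<in>{0..1}. \<bar>s - t\<bar> < d \<longrightarrow> norm (R n s - R n t) < e"
    by (rule equicontinuous_tightening[of X p r, OF compact_imp_bounded[OF assms(1)] assms(4) r(1)]) blast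
  obtain M where M: "\<And>x. x \<in> X \<Longrightarrow> norm x \<le> M"
    using compact_imp_bounded[OF assms(1)] unfolding bounded_iff by blast
  have RX: "R n t \<in> X" if "t \<in> {0..1}" for n t
  proof -
    have "R n t \<in> path_image (R n)" using that unfolding path_image_def by (rule imageI)
    then show ?thesis using homotopic_paths_imp_subset[OF R(1)[of n]] by blast
  qed
  obtain q k where q: "continuous_on {0..1} q" and k: "strict_mono (k :: nat \<Rightarrow> nat)"
    and unif: "\<And>e. 0 < e \<Longrightarrow> \<exists>N. \<forall>n t. n \<ge> N \<and> t \<in> {0..1} \<longrightarrow> norm (R (k n) t - q t) < e"
  proof (rule Arzela_Ascoli[of "{0..1::real}" R M])
    show "\<exists>d>0. \<forall>n t. t \<in> {0..1} \<and> norm (s - t) < d \<longrightarrow> norm (R n s - R n t) < e"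
      if "s \<in> {0..1}" "0 < e" for s e
      using eqc[OF that(2)] that(1) unfolding real_norm_def by blast
  qed (use M RX in auto)
  have lim: "(\<lambda>n. R (k n) t) \<longlonglongrightarrow> q t" if "t \<in> {0..1}" for t
    unfolding LIMSEQ_iff using unif that by blast
  have hom: "homotopic_paths X p q"
  proof (rule homotopic_paths_limit[OF assms(1) R(1) _ lim])
    show "\<exists>d>0. \<forall>n. \<forall>s\<in>{0..1}. \<forall>t\<in>{0..1}. \<bar>s - t\<bar> < d \<longrightarrow> norm (R (k n) s - R (k n) t) < e" if "e > 0" for e
      using eqc[OF that] by blast
  qed
  have lower: "c \<le> total_osc s r" if "homotopic_paths X p r" for r
    unfolding c_def using bdd_A that by (intro cInf_lower) (auto simp: A_def)
  \<comment> \<open>\<open>R n\<close> lies in the class, so its value is at least \<open>c\<close>;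
    domination by \<open>r n\<close> keeps it below the values of the minimizing sequence.\<close>
  have "(\<lambda>n. total_osc s (R n)) \<longlonglongrightarrow> c"
  proof (rule tendsto_sandwich)
    show "\<forall>\<^sub>F n in sequentially. c \<le> total_osc s (R n)" using lower R(1) by simp
    show "\<forall>\<^sub>F n in sequentially. total_osc s (R n) \<le> c + inverse (real (Suc n))"
      using total_osc_dominated[OF R(2)] r(2) by (intro always_eventually allI) (meson less_imp_le order_trans)
    show "(\<lambda>n. c + inverse (real (Suc n))) \<longlonglongrightarrow> c"
      using tendsto_add[OF tendsto_const LIMSEQ_inverse_real_of_nat, of c] by simp
  qed simp
  then have "(\<lambda>n. total_osc s (R (k n))) \<longlonglongrightarrow> c"
    using LIMSEQ_subseq_LIMSEQ[OF _ k] by (auto simp: o_def)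
  from total_osc_lsc[OF lim this] have "total_osc s q \<le> c" .
  then show ?thesis
    using hom lower homotopic_paths_imp_path[OF hom] homotopic_paths_imp_subset[OF hom] by (meson order_trans)
qed

end
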